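(* Let $d\ge 1$, $T>0$, $\alpha\in(0,1)$, $Q=\mathbb{T}^d\times(0,T)$. Assume: (1) $m_0\in C^{2+\alpha}(\mathbb{T}^d)$ is a probability density ($\int_{\mathbb{T}^d}m_0\,dx=1$) with $m_0(x)\ge\vartheta$ for all $x$, for some constant $\vartheta>0$, and $u_T\in C^{2+\alpha}(\mathbb{T}^d)$. (2) $H\in C^4(\mathbb{T}^d\times\mathbb{R}^+\times\mathbb{R}^d)$, $H=H(x,m,p)$, and there is $\bar C>0$ such that for all $(x,m,p)\in\mathbb{T}^d\times\mathbb{R}^+\times\mathbb{R}^d$: $$|H_{px}|\le\bar C(|p|+1),\quad |H_{xx}|+|H_{xxm}|\le\bar C(|p|^2+1),\quad |H_{mp}|\le\bar C|p|,\quad |H_{mm}|\le\bar C|p|^2,$$ $$|H_{pp}|+|H_{ppm}|\le\bar C,\quad |H_{ppp}|+|H_{pppm}|\le\bar C$$ (all evaluated at $(x,m,p)$); moreover, for all $x\in\mathbb{T}^d$, $p\in\mathbb{R}^d$ and $m>0$ the symmetric $(d+1)\times(d+1)$ matrix $$\begin{pmatrix}-H_m(x,m,p) & \frac m2 H_{pm}(x,m,p)^T\\ \frac m2 H_{pm}(x,m,p) & mH_{pp}(x,m,p)\end{pmatrix}$$ is positive definite. (3) $f:\mathbb{R}^+\to\mathbb{R}$ is such that $f,f',f''$ are bounded on $\mathbb{R}^+$, and $f'\ge0$. Let $(u,m)$ be the (unique) classical solution of $$\begin{cases}-\partial_t u-\Delta u+H(x,m,Du)=f(m) & \text{in }Q,\\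 \partial_t m-\Delta m-\mathrm{div}\big(mH_p(x,m,Du)\big)=0 & \text{in }Q,\\ m(x,0)=m_0(x),\quad u(x,T)=u_T(x) & \text{in }\mathbb{T}^d.\end{cases}$$ Then there exist constants $\eta>0$ and $C>0$ such that for every Newton sequence $(u^n,m^n)_{n\ge0}$ (as defined in the context), setting $v^n=u^n-u$ and $\rho^n=m^n-m$: if $\|v^0\|_{C^{1,0}(Q)}+\|\rho^0\|_{C^0(Q)}\le\eta$, then $$\|v^n\|_{C^{1,0}(Q)}+\|\rho^n\|_{C^0(Q)}\to0\quad\text{as }n\to\infty,$$ with a quadratic rate of convergence, i.e. for all $n\ge1$ $$\|v^n\|_{C^{1,0}(Q)}+\|\rho^n\|_{C^0(Q)}\le C\big(\|v^{n-1}\|_{C^{1,0}(Q)}+\|\rho^{n-1}\|_{C^0(Q)}\big)^2 .$$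
   Context: $\mathbb{T}^d$ is the $d$-dimensional flat unit torus (periodic boundary conditions) and $\mathbb{R}^+=[0,\infty)$. Subscripts on $H$ denote partial derivatives with respect to $x$, $m$, $p$ ($H_p$ is the gradient in $p$, $H_{pp}$ the Hessian in $p$, $H_{pm}=\partial_mH_p\in\mathbb{R}^d$, etc.); $|\cdot|$ is the norm of vectors/matrices/tensors. $D$, $\mathrm{div}$, $\Delta$ act in $x$. $\|\cdot\|_{C^0(Q)}$ is the sup norm and $\|u\|_{C^{1,0}(Q)}=\|u\|_{C^0(Q)}+\|Du\|_{C^0(Q;\mathbb{R}^d)}$. For $\beta\in(0,1)$, $C^{\beta,\beta/2}(Q)$ is the space of bounded functions with finite seminorm $\sup\frac{|u(x_1,t_1)-u(x_2,t_2)|}{(d(x_1,x_2)^2+|t_1-t_2|)^{\beta/2}}$ ($d$ the geodesic distance), and $C^{2+\beta,1+\beta/2}(Q)$ is the usual parabolic Hölder space of functions $u$ with $u,Du,D^2u,\partial_tu$ in $C^{\beta,\beta/2}(Q)$. A classical solution of the Mean Field Game system is a pair $(u,m)$, $m$ taking values in $\mathbb{R}^+$, with $u,m\in C^{2+\beta,1+\beta/2}(Q)$ for some $\beta\in(0,1)$, satisfying the system pointwise. Under the assumptions of the claim it exists and is unique. A Newton sequence is a sequence $(u^n,m^n)_{n\ge0}$ in $C^{2+\alpha,1+\alpha/2}(Q)\times C^{2+\alpha,1+\alpha/2}(Q)$, generated from an initial guess $(u^0,m^0)$, with each $m^{n}$ taking values in $\mathbb{R}^+$ (so that the coefficients below are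 defined), such that for every $n\ge1$, writing $H^{n-1}_{\bullet}$ for $H_{\bullet}(x,m^{n-1},Du^{n-1})$ (and $H^{n-1}$ for $H(x,m^{n-1},Du^{n-1})$), the pair $(u^n,m^n)$ solves the linear system $$\begin{cases}-\partial_tu^n-\Delta u^n+H_p^{n-1}\cdot D(u^n-u^{n-1})+H_m^{n-1}(m^n-m^{n-1})\\ \qquad=-H^{n-1}+f(m^{n-1})+f'(m^{n-1})(m^n-m^{n-1}) & \text{in }Q,\\[3pt] \partial_tm^n-\Delta m^n-\mathrm{div}\big(m^nH_p^{n-1}\big)\\ \qquad=\mathrm{div}\big(m^{n-1}H_{pp}^{n-1}(Du^n-Du^{n-1})\big)+\mathrm{div}\big(m^{n-1}H_{pm}^{n-1}(m^n-m^{n-1})\big) & \text{in }Q,\\[3pt] m^n(x,0)=m_0(x),\quad u^n(x,T)=u_T(x) & \text{in }\mathbb{T}^d.\end{cases}$$ *)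

theory Defs
  imports "HOL-Analysis.Analysis"
begin

text \<open>
  Conventions. The dimension is \<open>d = CARD('d)\<close>, and a function on the flat unit torus is a function
  on \<open>real ^ 'd\<close> that is periodic with respect to the integer lattice. A function on the open cylinder
  \<open>Q = T^d x (0,T)\<close> is a curried function of \<open>x\<close> and \<open>t\<close>; its values at \<open>t = 0\<close> and \<open>t = T\<close> are those of
  its continuous extension to the closed cylinder, and values for \<open>t\<close> outside \<open>[0,T]\<close> play no role.
\<close>

definition int_lattice :: "(real ^ 'd) set" where
  "int_lattice = {k. \<forall>i. k $ i \<in> \<int>}"

definition periodic :: "(real ^ 'd \<Rightarrow> 'b) \<Rightarrow> bool" where
  "periodic g \<longleftrightarrow> (\<forall>x. \<forall>k\<in>int_lattice. g (x + k) = g x)"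

text \<open>The geodesic distance on the torus, in terms of representatives.\<close>

definition torus_dist :: "real ^ 'd \<Rightarrow> real ^ 'd \<Rightarrow> real" where
  "torus_dist x y = infdist (x - y) int_lattice"


section \<open>Differential operators in space and time\<close>

text \<open>\<open>nabla g x $ i\<close> is the partial derivative of \<open>g\<close> in the direction \<open>i\<close>. It is defined for functions with
  values in a normed space, so that it can be iterated: \<open>nabla (nabla g) x\<close> is the Hessian.\<close>

definition nabla :: "(real ^ 'd \<Rightarrow> 'b::real_normed_vector) \<Rightarrow> real ^ 'd \<Rightarrow> 'b ^ 'd" where
  "nabla g x = (\<chi> i. frechet_derivative g (at x) (axis i 1))"

definition Dx :: "(real ^ 'd \<Rightarrow> real \<Rightarrow> 'b::real_normed_vector) \<Rightarrow> real ^ 'd \<Rightarrow> real \<Rightarrow> 'b ^ 'd" where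
  "Dx w x t = nabla (\<lambda>y. w y t) x"

definition Dt :: "(real ^ 'd \<Rightarrow> real \<Rightarrow> real) \<Rightarrow> real ^ 'd \<Rightarrow> real \<Rightarrow> real" where
  "Dt w x t = deriv (\<lambda>s. w x s) t"

definition divergence :: "(real ^ 'd \<Rightarrow> real \<Rightarrow> real ^ 'd) \<Rightarrow> real ^ 'd \<Rightarrow> real \<Rightarrow> real" where
  "divergence F x t = trace (Dx F x t)"

definition laplacian :: "(real ^ 'd \<Rightarrow> real \<Rightarrow> real) \<Rightarrow> real ^ 'd \<Rightarrow> real \<Rightarrow> real" where
  "laplacian w = divergence (Dx w)"


section \<open>Norms and Hoelder spaces\<close>

text \<open>The supremum is only used for functions that are bounded on the cylinder.\<close>

definition C0_norm :: "real \<Rightarrow> (real ^ 'd \<Rightarrow> real \<Rightarrow> 'b::real_normed_vector) \<Rightarrow> real" where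
  "C0_norm T w = (SUP (x, t) \<in> UNIV \<times> {0<..<T}. norm (w x t))"

definition C10_norm :: "real \<Rightarrow> (real ^ 'd \<Rightarrow> real \<Rightarrow> real) \<Rightarrow> real" where
  "C10_norm T w = C0_norm T w + C0_norm T (Dx w)"

definition parabolic_holder ::
  "real \<Rightarrow> real \<Rightarrow> (real ^ 'd \<Rightarrow> real \<Rightarrow> 'b::real_normed_vector) \<Rightarrow> bool" where
  "parabolic_holder \<beta> T w \<longleftrightarrow>
     (\<exists>B. \<forall>x. \<forall>t\<in>{0<..<T}. norm (w x t) \<le> B) \<and>
     (\<exists>K. \<forall>x1 x2. \<forall>t1\<in>{0<..<T}. \<forall>t2\<in>{0<..<T}.
        norm (w x1 t1 - w x2 t2) \<le> K * ((torus_dist x1 x2)\<^sup>2 + \<bar>t1 - t2\<bar>) powr (\<beta> / 2))"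

text \<open>The space \<open>C^(2+beta, 1+beta/2)(Q)\<close>. Continuity on the closed cylinder only fixes the values at
  \<open>t = 0\<close> and \<open>t = T\<close>; the Hoelder bound on \<open>Q\<close> guarantees that the extension exists.\<close>

definition parabolic_C2 :: "real \<Rightarrow> real \<Rightarrow> (real ^ 'd \<Rightarrow> real \<Rightarrow> real) \<Rightarrow> bool" where
  "parabolic_C2 \<beta> T w \<longleftrightarrow>
     (\<forall>t\<in>{0..T}. periodic (\<lambda>x. w x t)) \<and>
     continuous_on (UNIV \<times> {0..T}) (\<lambda>(x, t). w x t) \<and>
     (\<forall>x. \<forall>t\<in>{0<..<T}.
        (\<lambda>y. w y t) differentiable (at x) \<and>
        (\<lambda>y. Dx w y t) differentiable (at x) \<and>
        (\<lambda>s. w x s) differentiable (at t)) \<and>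
     parabolic_holder \<beta> T w \<and> parabolic_holder \<beta> T (Dx w) \<and>
     parabolic_holder \<beta> T (Dx (Dx w)) \<and> parabolic_holder \<beta> T (Dt w)"

text \<open>The space \<open>C^(2+alpha)\<close> on the torus. Boundedness of the function and of its derivatives follows
  from periodicity and continuity.\<close>

definition holder_C2 :: "real \<Rightarrow> (real ^ 'd \<Rightarrow> real) \<Rightarrow> bool" where
  "holder_C2 \<alpha> g \<longleftrightarrow>
     periodic g \<and>
     (\<forall>x. g differentiable (at x) \<and> nabla g differentiable (at x)) \<and>
     (\<exists>K. \<forall>x y. norm (nabla (nabla g) x - nabla (nabla g) y) \<le> K * torus_dist x y powr \<alpha>)"


section \<open>The Hamiltonian and its derivatives\<close>

text \<open>All derivatives of \<open>H\<close> are taken within \<open>phase\<close>, hence are one-sided in \<open>m\<close> at \<open>m = 0\<close>; they are unique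
  there because \<open>phase\<close> is convex with nonempty interior.\<close>

definition phase :: "((real ^ 'd) \<times> real \<times> (real ^ 'd)) set" where
  "phase = UNIV \<times> {0..} \<times> UNIV"

fun Ck_on :: "nat \<Rightarrow> 'a::euclidean_space set \<Rightarrow> ('a \<Rightarrow> real) \<Rightarrow> bool" where
  "Ck_on 0 S F \<longleftrightarrow> continuous_on S F"
| "Ck_on (Suc k) S F \<longleftrightarrow>
     F differentiable_on S \<and>
     (\<forall>b\<in>Basis. Ck_on k S (\<lambda>z. frechet_derivative F (at z within S) b))"

definition d_x :: "((real ^ 'd) \<times> real \<times> (real ^ 'd) \<Rightarrow> 'b::real_normed_vector) \<Rightarrow>
    (real ^ 'd) \<times> real \<times> (real ^ 'd) \<Rightarrow> 'b ^ 'd" where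
  "d_x F z = (\<chi> i. frechet_derivative F (at z within phase) (axis i 1, 0, 0))"

definition d_m :: "((real ^ 'd) \<times> real \<times> (real ^ 'd) \<Rightarrow> 'b::real_normed_vector) \<Rightarrow>
    (real ^ 'd) \<times> real \<times> (real ^ 'd) \<Rightarrow> 'b" where
  "d_m F z = frechet_derivative F (at z within phase) (0, 1, 0)"

definition d_p :: "((real ^ 'd) \<times> real \<times> (real ^ 'd) \<Rightarrow> 'b::real_normed_vector) \<Rightarrow>
    (real ^ 'd) \<times> real \<times> (real ^ 'd) \<Rightarrow> 'b ^ 'd" where
  "d_p F z = (\<chi> i. frechet_derivative F (at z within phase) (0, 0, axis i 1))"

definition positive_definite :: "real ^ 'n ^ 'n \<Rightarrow> bool" where
  "positive_definite A \<longleftrightarrow> transpose A = A \<and> (\<forall>v. v \<noteq> 0 \<longrightarrow> v \<bullet> (A *v v) > 0)"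

text \<open>The (d+1) x (d+1) block matrix; the index \<open>None\<close> stands for the first row and column.\<close>

definition monotonicity_matrix ::
  "((real ^ 'd) \<times> real \<times> (real ^ 'd) \<Rightarrow> real) \<Rightarrow> (real ^ 'd) \<times> real \<times> (real ^ 'd) \<Rightarrow>
     real ^ ('d option) ^ ('d option)" where
  "monotonicity_matrix H z = (let m = fst (snd z) in
     \<chi> a b. case (a, b) of
        (None, None) \<Rightarrow> - d_m H z
      | (None, Some j) \<Rightarrow> m / 2 * d_m (d_p H) z $ j
      | (Some i, None) \<Rightarrow> m / 2 * d_m (d_p H) z $ i
      | (Some i, Some j) \<Rightarrow> m * d_p (d_p H) z $ i $ j)"


section \<open>The Mean Field Game system and Newton sequences\<close>

text \<open>The point at which \<open>H\<close> and its derivatives are evaluated.\<close>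

definition jet :: "(real ^ 'd \<Rightarrow> real \<Rightarrow> real) \<Rightarrow> (real ^ 'd \<Rightarrow> real \<Rightarrow> real) \<Rightarrow>
    real ^ 'd \<Rightarrow> real \<Rightarrow> (real ^ 'd) \<times> real \<times> (real ^ 'd)" where
  "jet u m x t = (x, m x t, Dx u x t)"

definition classical_solution ::
  "real \<Rightarrow> ((real ^ 'd) \<times> real \<times> (real ^ 'd) \<Rightarrow> real) \<Rightarrow> (real \<Rightarrow> real) \<Rightarrow>
   (real ^ 'd \<Rightarrow> real) \<Rightarrow> (real ^ 'd \<Rightarrow> real) \<Rightarrow>
   (real ^ 'd \<Rightarrow> real \<Rightarrow> real) \<Rightarrow> (real ^ 'd \<Rightarrow> real \<Rightarrow> real) \<Rightarrow> bool" where
  "classical_solution T H f m0 uT u m \<longleftrightarrow>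
     (\<exists>\<beta>. 0 < \<beta> \<and> \<beta> < 1 \<and> parabolic_C2 \<beta> T u \<and> parabolic_C2 \<beta> T m) \<and>
     (\<forall>x. \<forall>t\<in>{0<..<T}.
        0 \<le> m x t \<and>
        - Dt u x t - laplacian u x t + H (jet u m x t) = f (m x t) \<and>
        Dt m x t - laplacian m x t
          - divergence (\<lambda>y s. m y s *\<^sub>R d_p H (jet u m y s)) x t = 0) \<and>
     (\<forall>x. m x 0 = m0 x \<and> u x T = uT x)"

text \<open>One step of the linearised system: \<open>(u, m)\<close> is the new and \<open>(u', m')\<close> the previous iterate, and
  \<open>f'\<close> is the derivative of \<open>f\<close>.\<close>

definition newton_step ::
  "real \<Rightarrow> ((real ^ 'd) \<times> real \<times> (real ^ 'd) \<Rightarrow> real) \<Rightarrow> (real \<Rightarrow> real) \<Rightarrow> (real \<Rightarrow> real) \<Rightarrow>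
   (real ^ 'd \<Rightarrow> real) \<Rightarrow> (real ^ 'd \<Rightarrow> real) \<Rightarrow>
   (real ^ 'd \<Rightarrow> real \<Rightarrow> real) \<Rightarrow> (real ^ 'd \<Rightarrow> real \<Rightarrow> real) \<Rightarrow>
   (real ^ 'd \<Rightarrow> real \<Rightarrow> real) \<Rightarrow> (real ^ 'd \<Rightarrow> real \<Rightarrow> real) \<Rightarrow> bool" where
  "newton_step T H f f' m0 uT u' m' u m \<longleftrightarrow>
     (\<forall>x. \<forall>t\<in>{0<..<T}.
        - Dt u x t - laplacian u x t
          + d_p H (jet u' m' x t) \<bullet> Dx (\<lambda>y s. u y s - u' y s) x t
          + d_m H (jet u' m' x t) * (m x t - m' x t)
        = - H (jet u' m' x t) + f (m' x t) + f' (m' x t) * (m x t - m' x t) \<and>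
        Dt m x t - laplacian m x t
          - divergence (\<lambda>y s. m y s *\<^sub>R d_p H (jet u' m' y s)) x t
        = divergence (\<lambda>y s. m' y s *\<^sub>R
              (d_p (d_p H) (jet u' m' y s) *v (Dx u y s - Dx u' y s))) x t
          + divergence (\<lambda>y s. (m' y s * (m y s - m' y s)) *\<^sub>R d_m (d_p H) (jet u' m' y s)) x t) \<and>
     (\<forall>x. m x 0 = m0 x \<and> u x T = uT x)"

definition newton_sequence ::
  "real \<Rightarrow> real \<Rightarrow> ((real ^ 'd) \<times> real \<times> (real ^ 'd) \<Rightarrow> real) \<Rightarrow> (real \<Rightarrow> real) \<Rightarrow> (real \<Rightarrow> real) \<Rightarrow>
   (real ^ 'd \<Rightarrow> real) \<Rightarrow> (real ^ 'd \<Rightarrow> real) \<Rightarrow>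
   (nat \<Rightarrow> real ^ 'd \<Rightarrow> real \<Rightarrow> real) \<Rightarrow> (nat \<Rightarrow> real ^ 'd \<Rightarrow> real \<Rightarrow> real) \<Rightarrow> bool" where
  "newton_sequence \<alpha> T H f f' m0 uT U M \<longleftrightarrow>
     (\<forall>n. parabolic_C2 \<alpha> T (U n) \<and> parabolic_C2 \<alpha> T (M n) \<and>
          (\<forall>x. \<forall>t\<in>{0<..<T}. 0 \<le> M n x t)) \<and>
     (\<forall>n\<ge>1. newton_step T H f f' m0 uT (U (n - 1)) (M (n - 1)) (U n) (M n))"

end

theory Submission
  imports Defs
begin

text \<open>
  Newton's method converges quadratically as soon as the linearisation at the solution \<open>(u, m)\<close> has a
  bounded inverse in the norms in which the error is measured. Let \<open>e'\<close> be the error before a step, let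
  \<open>e\<close> be the error after it, and let \<open>(v, \<rho>)\<close> be the new iterate minus the solution. Subtracting the
  two systems and expanding to second order gives
  \<open>- v_t - \<Delta>v + H_p \<bullet> Dv + (H_m - f') \<rho> = a\<close> and
  \<open>\<rho>_t - \<Delta>\<rho> = div (\<rho> H_p + m H_pp Dv + m \<rho> H_pm + b)\<close>
  with coefficients taken at \<open>(u, m)\<close>, with \<open>v = 0\<close> at the final and \<open>\<rho> = 0\<close> at the initial time, and with
  \<open>a\<close>, \<open>b\<close> of size \<open>e'\<^sup>2 + e' e\<close> (lemma \<open>newton_linear_problem\<close>). If the sup norms of \<open>v\<close>, \<open>Dv\<close> and
  \<open>\<rho>\<close> are bounded by a constant times those of \<open>a\<close> and \<open>b\<close>, which is \<open>linear_problem_stability\<close>, then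
  \<open>e \<le> C (e'\<^sup>2 + e' e)\<close>; for small \<open>e'\<close> the mixed term is absorbed (\<open>quadratic_recursion\<close>).

  The stability estimate rests on two facts. The first is monotonicity. The integral of \<open>\<rho> v\<close> over a
  period cell vanishes at both ends of the time interval, and up to the data its time derivative is
  minus the integral of the quadratic form of the monotonicity matrix (\<open>energy_identity\<close>). That form is
  coercive along the solution, because the solution stays in a compact set of the phase space on which
  the density is bounded away from zero (\<open>density_bounded_below\<close>, \<open>matrix_coercive\<close>). So the space-time
  integral of \<open>W = |\<rho>| + |Dv|\<close> is controlled by the data.

  The second fact turns this integral bound into a pointwise one. For a Gaussian weight \<open>\<gamma>\<close>, the average
  \<open>\<integral> \<gamma>(z) w(x0 + \<sigma> z, t0 - \<sigma>\<^sup>2/2) dz\<close> leads from a multiple of \<open>w(x0, t0)\<close> at \<open>\<sigma> = 0\<close> to an average of the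
  initial values, which vanish. Its derivative in \<open>\<sigma>\<close> sees only \<open>w_t - \<Delta>w\<close>; if that is a divergence
  \<open>div F\<close>, an integration by parts turns the derivative into \<open>- \<integral> \<gamma>(z) z \<bullet> F dz\<close>, without any singularity
  at \<open>\<sigma> = 0\<close>. With the weight \<open>z_i \<gamma>\<close> the same works for \<open>\<partial>_i w\<close>, and time reversal handles \<open>v\<close>. Hence
  \<open>\<rho>\<close> and \<open>Dv\<close> at any point are bounded by integrals over \<open>\<sigma>\<close> of Gaussian averages of \<open>L W + D\<close>, where
  \<open>D\<close> is the size of the data. Widths below a small \<open>\<epsilon>\<close> and the tails of the Gaussian contribute at most a
  small multiple of \<open>sup W\<close>, which is absorbed; for larger widths the Gaussian average is dominated by the
  integral over a period cell (\<open>gauss_far_part\<close>), and the first fact applies. This is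
  \<open>dominated_path_bound\<close>. Integrals are taken over space only: in time, derivatives are compared by the
  mean value inequality.
\<close>

section \<open>Differentiation under the integral sign\<close>

text \<open>
  Dominated convergence along difference quotients, which the mean value theorem bounds by \<open>W\<close>. The
  lemma is applied with \<open>F'\<close> a partial derivative of a flux, of which boundedness is known but not
  continuity.
\<close>

lemma has_derivative_under_integral:
  fixes F F' :: "real \<Rightarrow> 'a \<Rightarrow> real"
  assumes s: "a < s" "s < b"
    and int: "\<And>r. a < r \<Longrightarrow> r < b \<Longrightarrow> integrable M (F r)"
    and der: "\<And>r x. a < r \<Longrightarrow> r < b \<Longrightarrow> x \<in> space M \<Longrightarrow>
      ((\<lambda>r. F r x) has_real_derivative F' r x) (at r)"
    and bd: "\<And>r x. a < r \<Longrightarrow> r < b \<Longrightarrow> x \<in> space M \<Longrightarrow> \<bar>F' r x\<bar> \<le> W x"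
    and W: "integrable M W"
  shows "((\<lambda>r. \<integral>x. F r x \<partial>M) has_real_derivative (\<integral>x. F' s x \<partial>M)) (at s)"
    and "integrable M (F' s)"
proof -
  have mvt: "\<bar>(F (s + h) x - F s x) / h\<bar> \<le> W x"
    if h: "h \<noteq> 0" "a < s + h" "s + h < b" and x: "x \<in> space M" for h x
  proof (cases "h > 0")
    case True
    obtain z where z: "s < z" "z < s + h" "F (s + h) x - F s x = (s + h - s) * F' z x"
      using MVT2[of s "s + h" "\<lambda>r. F r x" "\<lambda>r. F' r x"] der[OF _ _ x] h s True by auto
    then have "(F (s + h) x - F s x) / h = F' z x" using h by simp
    then show ?thesis using bd[OF _ _ x, of z] z s h by auto
  next
    case False
    obtain z where z: "s + h < z" "z < s" "F s x - F (s + h) x = (s - (s + h)) * F' z x"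
      using MVT2[of "s + h" s "\<lambda>r. F r x" "\<lambda>r. F' r x"] der[OF _ _ x] h s False by auto
    then have "(F (s + h) x - F s x) / h = F' z x" using h by (simp add: field_simps)
    then show ?thesis using bd[OF _ _ x, of z] z s h by auto
  qed
  have quot: "(\<lambda>h. (F (s + h) x - F s x) / h) \<midarrow>0\<rightarrow> F' s x" if x: "x \<in> space M" for x
    using der[OF s x] by (simp add: DERIV_def)
  have key: "F' s \<in> borel_measurable M \<and>
      (\<lambda>i. \<integral>x. (F (s + X i) x - F s x) / X i \<partial>M) \<longlonglongrightarrow> (\<integral>x. F' s x \<partial>M) \<and> integrable M (F' s)"
    if X: "\<And>i. X i \<noteq> 0" "X \<longlonglongrightarrow> 0" "\<And>i. a < s + X i" "\<And>i. s + X i < b" for X :: "nat \<Rightarrow> real"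
  proof -
    have lim: "(\<lambda>i. (F (s + X i) x - F s x) / X i) \<longlonglongrightarrow> F' s x" if x: "x \<in> space M" for x
      using quot[OF x] X(1,2) by (auto simp: tendsto_at_iff_sequentially comp_def)
    have meas: "(\<lambda>x. (F (s + X i) x - F s x) / X i) \<in> borel_measurable M" for i
      using int[of "s + X i"] int[of s] X(3,4)[of i] s by (auto intro!: borel_measurable_divide borel_measurable_diff)
    have m: "F' s \<in> borel_measurable M"
      by (rule borel_measurable_LIMSEQ_real[OF lim meas])
    show ?thesis
    proof (intro conjI m)
      show "(\<lambda>i. \<integral>x. (F (s + X i) x - F s x) / X i \<partial>M) \<longlonglongrightarrow> (\<integral>x. F' s x \<partial>M)"
        by (rule integral_dominated_convergence[where w=W])
          (auto intro!: m meas W AE_I2 lim mvt[unfolded abs_divide] X)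
      show "integrable M (F' s)"
        by (rule Bochner_Integration.integrable_bound[OF W m])
          (auto intro!: AE_I2 order_trans[OF bd[OF s]])
    qed
  qed
  define X0 where "X0 i = (b - s) / 2 * inverse (real (Suc i))" for i
  have "integrable M (F' s)"
  proof (intro conjunct2[OF conjunct2[OF key]])
    show "X0 \<longlonglongrightarrow> 0"
      unfolding X0_def by (rule tendsto_mult_right_zero[OF LIMSEQ_inverse_real_of_nat])
    have "0 < X0 i \<and> X0 i \<le> (b - s) / 2" for i
      using s mult_left_le[of "inverse (real (Suc i))" "(b - s) / 2"] by (auto simp: X0_def inverse_le_1_iff)
    moreover have "(b - s) / 2 < b - s" using s by simp
    ultimately have X0: "0 < X0 i" "X0 i < b - s" for i by (blast intro: le_less_trans)+
    show "X0 i \<noteq> 0" "a < s + X0 i" "s + X0 i < b" for i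
      using X0[of i] s by auto
  qed
  then show "integrable M (F' s)" .
  show "((\<lambda>r. \<integral>x. F r x \<partial>M) has_real_derivative (\<integral>x. F' s x \<partial>M)) (at s)"
    unfolding DERIV_def tendsto_at_iff_sequentially
  proof (intro allI impI)
    fix X :: "nat \<Rightarrow> real"
    assume X: "\<forall>i. X i \<in> UNIV - {0}" "X \<longlonglongrightarrow> 0"
    have "\<forall>\<^sub>F i in sequentially. X i > a - s \<and> X i < b - s"
      using order_tendstoD[OF X(2), of "a - s"] order_tendstoD[OF X(2), of "b - s"] s
      by (auto intro: eventually_conj)
    then obtain N where N: "\<And>i. i \<ge> N \<Longrightarrow> X i > a - s \<and> X i < b - s"
      by (auto simp: eventually_sequentially)
    define Y where "Y i = X (i + N)" for i
    have "(\<lambda>i. \<integral>x. (F (s + Y i) x - F s x) / Y i \<partial>M) \<longlonglongrightarrow> (\<integral>x. F' s x \<partial>M)"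
    proof (intro conjunct1[OF conjunct2[OF key]])
      show "Y \<longlonglongrightarrow> 0" unfolding Y_def by (rule LIMSEQ_ignore_initial_segment[OF X(2)])
      show "Y i \<noteq> 0" "a < s + Y i" "s + Y i < b" for i
        using X(1) N[of "i + N"] by (auto simp: Y_def)
    qed
    moreover have "(\<integral>x. (F (s + Y i) x - F s x) / Y i \<partial>M) =
        ((\<integral>x. F (s + Y i) x \<partial>M) - (\<integral>x. F s x \<partial>M)) / Y i" for i
      using int[of "s + Y i"] int[of s] s N[of "i + N"] by (simp add: Y_def)
    ultimately have "(\<lambda>i. ((\<lambda>h. ((\<integral>x. F (s + h) x \<partial>M) - (\<integral>x. F s x \<partial>M)) / h) \<circ> X) (i + N))
        \<longlonglongrightarrow> (\<integral>x. F' s x \<partial>M)"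
      by (simp only: comp_def Y_def[symmetric])
    then show "((\<lambda>h. ((\<integral>x. F (s + h) x \<partial>M) - (\<integral>x. F s x \<partial>M)) / h) \<circ> X) \<longlonglongrightarrow> (\<integral>x. F' s x \<partial>M)"
      by (rule LIMSEQ_offset)
  qed
qed

section \<open>Integration over the period cell\<close>

text \<open>
  Half-open, so that the translates by integer vectors partition the space and the identities below
  hold exactly rather than up to null sets.
\<close>

definition cell :: "(real ^ 'd) set" where
  "cell = {x. \<forall>i. 0 \<le> x $ i \<and> x $ i < 1}"

abbreviation cell_measure :: "(real ^ 'd) measure" where
  "cell_measure \<equiv> restrict_space lborel cell"

lemma cell_measurable [measurable]: "cell \<in> sets borel"
proof -
  have "cell = (\<Inter>i. {x::real^'d. 0 \<le> x $ i} \<inter> {x. x $ i < 1})" by (auto simp: cell_def)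
  also have "\<dots> \<in> sets borel"
    by (intro sets.countable_INT'' sets.Int borel_closed borel_open closed_Collect_le open_Collect_less)
       (auto intro!: continuous_intros)
  finally show ?thesis .
qed

lemma space_cell_measure [simp]: "space cell_measure = cell"
  by (simp add: space_restrict_space)

lemma emeasure_cell_le: "emeasure lborel (cell :: (real^'d) set) \<le> 1"
proof -
  have "emeasure lborel (cell :: (real^'d) set) \<le> emeasure lborel (cbox 0 (\<chi> i. 1) :: (real^'d) set)"
    by (intro emeasure_mono) (auto simp: cell_def mem_box_cart less_imp_le)
  also have "\<dots> = 1"
    by (subst emeasure_lborel_cbox) (auto simp: Basis_vec_def inner_axis prod_constant intro!: prod.neutral)
  finally show ?thesis .
qed

lemma finite_measure_cell: "finite_measure (cell_measure :: (real^'d) measure)"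
  by (rule finite_measureI)
    (use le_less_trans[OF emeasure_cell_le[where 'd='d], of top] in \<open>auto simp: emeasure_restrict_space\<close>)

lemma measure_cell_le: "measure cell_measure (cell :: (real^'d) set) \<le> 1"
  using emeasure_cell_le[where 'd='d]
  by (simp add: measure_def emeasure_restrict_space enn2real_leI)

lemma integrable_cell:
  fixes g :: "real^'d \<Rightarrow> real"
  assumes "g \<in> borel_measurable borel" "\<And>x. x \<in> cell \<Longrightarrow> \<bar>g x\<bar> \<le> B"
  shows "integrable cell_measure g"
proof (rule finite_measure.integrable_const_bound[OF finite_measure_cell])
  show "AE x in cell_measure. norm (g x) \<le> B" using assms(2) by (auto intro!: AE_I2)
  show "g \<in> borel_measurable cell_measure" using assms(1) by (intro measurable_restrict_space1) auto
qed

lemma integral_cell_eq: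
  fixes g :: "real^'d \<Rightarrow> real"
  shows "(\<integral>x. g x \<partial>cell_measure) = (\<integral>x. indicator cell x * g x \<partial>lborel)"
  by (subst integral_restrict_space) (auto simp: set_lebesgue_integral_def)

lemma integral_translate_lborel:
  fixes g :: "'a::euclidean_space \<Rightarrow> real"
  assumes [measurable]: "g \<in> borel_measurable borel"
  shows "(\<integral>x. g (x + a) \<partial>lborel) = (\<integral>x. g x \<partial>lborel)"
proof -
  have "(\<integral>x. g x \<partial>lborel) = (\<integral>x. g x \<partial>distr lborel borel ((+) a))"
    by (simp add: lborel_distr_plus)
  also have "\<dots> = (\<integral>x. g (a + x) \<partial>lborel)"
    by (subst integral_distr) auto
  finally show ?thesis by (simp add: add.commute)
qed

lemma axis_in_lattice: "axis i 1 \<in> int_lattice"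
  by (auto simp: int_lattice_def axis_def)

lemma integrable_lborel_bounded_support:
  fixes g :: "real^'d \<Rightarrow> real"
  assumes [measurable]: "g \<in> borel_measurable borel" "A \<in> sets borel" 
    and bd: "\<And>x. \<bar>g x\<bar> \<le> B" and A: "A \<subseteq> cbox a b"
  shows "integrable lborel (\<lambda>x. indicator A x * g x)"
proof -
  have "integrable lborel (\<lambda>x. indicator (cbox a b) x *\<^sub>R B)"
    by (rule integrable_scaleR_left) (auto intro!: integrable_real_indicator emeasure_lborel_cbox_finite)
  then show ?thesis
  proof (rule Bochner_Integration.integrable_bound)
    have "\<bar>g x\<bar> \<le> \<bar>B\<bar>" for x using bd[of x] by linarith
    then show "AE x in lborel. norm (indicator A x * g x) \<le> norm (indicator (cbox a b) x *\<^sub>R B)"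
      using A by (auto simp: indicator_def intro!: AE_I2)
  qed auto
qed

text \<open>
  The shifted cell sticks out of the cell by a slab; moving this slab back by one period fills the gap
  that the shift has left.
\<close>

lemma integral_cell_shift_axis:
  fixes g :: "real^'d \<Rightarrow> real"
  assumes [measurable]: "g \<in> borel_measurable borel" and bd: "\<And>x. \<bar>g x\<bar> \<le> B"
    and per: "periodic g" and s: "0 \<le> s" "s < 1"
  shows "(\<integral>x. g (x + s *\<^sub>R axis i 1) \<partial>cell_measure) = (\<integral>x. g x \<partial>cell_measure)"
proof -
  let ?e = "axis i 1 :: real^'d"
  define A where "A = {x :: real^'d. x - s *\<^sub>R ?e \<in> cell}"
  define A1 where "A1 = A \<inter> {x. x $ i < 1}"
  define A2 where "A2 = A \<inter> {x. 1 \<le> x $ i}"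
  have [measurable]: "A \<in> sets borel"
    unfolding A_def by measurable
  have [measurable]: "A1 \<in> sets borel" "A2 \<in> sets borel"
    unfolding A1_def A2_def
    by (measurable; intro continuous_intros)+
  have Asub: "A \<subseteq> cbox 0 (\<chi> i. 2)"
  proof
    fix x assume "x \<in> A"
    then have *: "0 \<le> x $ j - s * ?e $ j \<and> x $ j - s * ?e $ j < 1" for j
      by (auto simp: A_def cell_def)
    have "0 \<le> x $ j \<and> x $ j \<le> 2" for j
      using *[of j] s by (auto simp: axis_def split: if_splits)
    then show "x \<in> cbox 0 (\<chi> i. 2)" by (auto simp: mem_box_cart)
  qed
  have int1: "integrable lborel (\<lambda>x. indicator A1 x * g x)" 
    by (rule integrable_lborel_bounded_support[OF _ _ bd, where a=0 and b="\<chi> i. 2"])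
       (use Asub in \<open>auto simp: A1_def\<close>)
  have int2: "integrable lborel (\<lambda>x. indicator A2 x * g x)"
    by (rule integrable_lborel_bounded_support[OF _ _ bd, where a=0 and b="\<chi> i. 2"])
       (use Asub in \<open>auto simp: A2_def\<close>)
  have A12: "indicator A x = indicator A1 x + (indicator A2 x :: real)" for x
    by (auto simp: A1_def A2_def indicator_def)
  have A12': "indicator cell x = indicator A1 x + (indicator A2 (x + ?e) :: real)" for x
  proof -
    have "x \<in> cell \<longleftrightarrow> x \<in> A1 \<or> x + ?e \<in> A2"
    proof -
      have 1: "x \<in> A1 \<longleftrightarrow> (\<forall>j. j \<noteq> i \<longrightarrow> 0 \<le> x $ j \<and> x $ j < 1) \<and> s \<le> x $ i \<and> x $ i < 1"
        using s by (auto simp: A1_def A_def cell_def axis_def)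
      have 2: "x + ?e \<in> A2 \<longleftrightarrow> (\<forall>j. j \<noteq> i \<longrightarrow> 0 \<le> x $ j \<and> x $ j < 1) \<and> 0 \<le> x $ i \<and> x $ i < s"
        using s by (auto simp: A2_def A_def cell_def axis_def split: if_splits)
      have 3: "x \<in> cell \<longleftrightarrow> (\<forall>j. j \<noteq> i \<longrightarrow> 0 \<le> x $ j \<and> x $ j < 1) \<and> 0 \<le> x $ i \<and> x $ i < 1"
        by (auto simp: cell_def)
      show ?thesis unfolding 1 2 3 using s by auto
    qed
    moreover have "\<not> (x \<in> A1 \<and> x + ?e \<in> A2)"
      using s by (auto simp: A1_def A2_def A_def cell_def axis_def dest!: spec[of _ i])
    ultimately show ?thesis by (auto simp: indicator_def)
  qed
  have per': "g (x + ?e) = g x" for x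
    using per axis_in_lattice[of i] unfolding periodic_def by auto
  have "(\<integral>x. g (x + s *\<^sub>R ?e) \<partial>cell_measure) = (\<integral>x. indicator A (x + s *\<^sub>R ?e) * g (x + s *\<^sub>R ?e) \<partial>lborel)"
    unfolding integral_cell_eq by (simp add: A_def indicator_def)
  also have "\<dots> = (\<integral>x. indicator A x * g x \<partial>lborel)"
    by (rule integral_translate_lborel) measurable
  also have "\<dots> = (\<integral>x. indicator A1 x * g x \<partial>lborel) + (\<integral>x. indicator A2 x * g x \<partial>lborel)"
    unfolding A12 ring_distribs by (rule Bochner_Integration.integral_add[OF int1 int2])
  also have "(\<integral>x. indicator A2 x * g x \<partial>lborel) = (\<integral>x. indicator A2 (x + ?e) * g (x + ?e) \<partial>lborel)"
    by (rule integral_translate_lborel[symmetric]) measurable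
  also have "(\<integral>x. indicator A1 x * g x \<partial>lborel) + \<dots> = (\<integral>x. indicator cell x * g x \<partial>lborel)"
  proof -
    have "integrable lborel (\<lambda>x. indicator A2 (x + ?e) * g (x + ?e))"
    proof -
      have eq: "(\<lambda>x. indicator A2 (x + ?e) * g (x + ?e)) = (\<lambda>x. indicator {x. x + ?e \<in> A2} x * g x)"
        by (auto simp: per' indicator_def)
      show ?thesis unfolding eq
      proof (rule integrable_lborel_bounded_support[OF _ _ bd])
        show "{x. x + ?e \<in> A2} \<subseteq> cbox (- ?e) ((\<chi> i. 2) - ?e)"
        proof
          fix x assume "x \<in> {x. x + ?e \<in> A2}"
          then have "x + ?e \<in> cbox 0 (\<chi> i. 2)" using Asub by (auto simp: A2_def)
          then show "x \<in> cbox (- ?e) ((\<chi> i. 2) - ?e)"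
            by (auto simp: mem_box_cart algebra_simps)
              (metis add.commute add_le_cancel_left add.right_neutral add.right_inverse add.assoc)
        qed
      qed (auto simp: pred_def)
    qed
    from Bochner_Integration.integral_add[OF int1 this] show ?thesis
      unfolding A12' ring_distribs by (simp add: per')
  qed
  finally show ?thesis unfolding integral_cell_eq .
qed

lemma periodic_shift: "periodic g \<Longrightarrow> periodic (\<lambda>x. g (x + a))"
  unfolding periodic_def by (metis add.assoc add.commute)

lemma integral_cell_shift:
  fixes g :: "real^'d \<Rightarrow> real"
  assumes [measurable]: "g \<in> borel_measurable borel" and bd: "\<And>x. \<bar>g x\<bar> \<le> B"
    and per: "periodic g"
  shows "(\<integral>x. g (x + a) \<partial>cell_measure) = (\<integral>x. g x \<partial>cell_measure)"
proof -
  have 1: "(\<integral>x. k (x + s *\<^sub>R axis i 1) \<partial>cell_measure) = (\<integral>x. k x \<partial>cell_measure)"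
    if [measurable]: "k \<in> borel_measurable borel" and bd: "\<And>x. \<bar>k x\<bar> \<le> B" and per: "periodic k"
    for s i and k :: "real^'d \<Rightarrow> real"
  proof -
    have "real_of_int \<lfloor>s\<rfloor> *\<^sub>R axis i 1 \<in> (int_lattice :: (real^'d) set)"
      by (auto simp: int_lattice_def axis_def)
    then have "k (x + frac s *\<^sub>R axis i 1) = k (x + frac s *\<^sub>R axis i 1 + real_of_int \<lfloor>s\<rfloor> *\<^sub>R axis i 1)" for x
      using per unfolding periodic_def by auto
    also have "\<dots> x = k (x + s *\<^sub>R axis i 1)" for x
      by (simp add: frac_def add.assoc flip: scaleR_left_distrib)
    finally show ?thesis
      using integral_cell_shift_axis[OF _ bd per, of "frac s" i] by (simp add: frac_lt_1)
  qed
  have "(\<integral>x. g (x + (\<Sum>i\<in>I. (a $ i) *\<^sub>R axis i 1)) \<partial>cell_measure) = (\<integral>x. g x \<partial>cell_measure)"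
    if "finite I" for I
    using that
  proof induction
    case (insert i I)
    let ?k = "\<lambda>x. g (x + (\<Sum>i\<in>I. (a $ i) *\<^sub>R axis i 1))"
    have "(\<integral>x. ?k (x + (a $ i) *\<^sub>R axis i 1) \<partial>cell_measure) = (\<integral>x. ?k x \<partial>cell_measure)"
      by (rule 1) (auto intro: bd periodic_shift per)
    with insert show ?case by (simp add: add_ac)
  qed simp
  from this[of UNIV] show ?thesis
    using basis_expansion[of a] by (simp add: scalar_mult_eq_scaleR)
qed

lemma DERIV_along:
  fixes h :: "'a::real_normed_vector \<Rightarrow> real"
  assumes "\<And>x. ((\<lambda>s. h (x + s *\<^sub>R e)) has_real_derivative h' x) (at 0)"
  shows "((\<lambda>s. h (x + s *\<^sub>R e)) has_real_derivative h' (x + r *\<^sub>R e)) (at r)"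
  using assms[of "x + r *\<^sub>R e"]  DERIV_shift[of "\<lambda>s. h (x + s *\<^sub>R e)" "h' (x + r *\<^sub>R e)" 0 r]
  by (simp add: scaleR_left_distrib add.assoc add.commute[of "r *\<^sub>R e"])

text \<open>
  The integral of the translate \<open>h (x + r e)\<close> does not depend on \<open>r\<close>, so its derivative in \<open>r\<close>
  vanishes. This is the divergence theorem on the torus.
\<close>

lemma integral_cell_partial_eq_0:
  fixes h h' :: "real^'d \<Rightarrow> real"
  assumes m: "h \<in> borel_measurable borel" and bd: "\<And>x. \<bar>h x\<bar> \<le> B" and bd': "\<And>x. \<bar>h' x\<bar> \<le> B'"
    and der: "\<And>x. ((\<lambda>s. h (x + s *\<^sub>R axis i 1)) has_real_derivative h' x) (at 0)"
    and per: "periodic h"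
  shows "integrable cell_measure h'" "(\<integral>x. h' x \<partial>cell_measure) = 0"
proof -
  note [measurable] = m
  let ?F = "\<lambda>r x. h (x + r *\<^sub>R axis i 1)" and ?F' = "\<lambda>r x. h' (x + r *\<^sub>R axis i 1)"
  note D = has_derivative_under_integral[of "-1" 0 1 cell_measure ?F ?F' "\<lambda>_. B'"]
  have 1: "integrable cell_measure (?F r)" for r
    by (rule integrable_cell[of _ B]) (auto intro: bd)
  have 2: "integrable cell_measure (\<lambda>_. B')"
    by (rule integrable_cell[of _ "\<bar>B'\<bar>"]) auto
  show "integrable cell_measure h'"
    using D(2) 1 2 DERIV_along[OF der] bd' by simp
  have "((\<lambda>r. \<integral>x. ?F r x \<partial>cell_measure) has_real_derivative (\<integral>x. ?F' 0 x \<partial>cell_measure)) (at 0)"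
    using D(1) 1 2 DERIV_along[OF der] bd' by simp
  moreover have "(\<integral>x. ?F r x \<partial>cell_measure) = (\<integral>x. h x \<partial>cell_measure)" for r
    by (rule integral_cell_shift[OF m bd per])
  ultimately have "((\<lambda>r. \<integral>x. h x \<partial>cell_measure) has_real_derivative (\<integral>x. h' x \<partial>cell_measure)) (at 0)"
    by simp
  then show "(\<integral>x. h' x \<partial>cell_measure) = 0"
    using DERIV_unique DERIV_const by blast
qed

section \<open>Gaussian integrals and integration by parts\<close>

lemma nn_integral_exp_abs_finite:
  assumes "c > 0"
  shows "(\<integral>\<^sup>+x. ennreal (exp (- c * \<bar>x\<bar>)) \<partial>lborel) < \<infinity>"
proof -
  let ?g = "\<lambda>x. ennreal (exp (- c * x)) * indicator {0..} x"
  have lim: "((\<lambda>x. - exp (- c * x) / c) \<longlongrightarrow> 0) at_top"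
  proof -
    have "filterlim (\<lambda>x. - (c * x)) at_bot at_top"
      using assms by (intro filterlim_compose[OF filterlim_uminus_at_bot_at_top] filterlim_tendsto_pos_mult_at_top[OF tendsto_const] filterlim_ident) auto
    then have "((\<lambda>x. exp (- (c * x))) \<longlongrightarrow> 0) at_top"
      by (rule filterlim_compose[OF exp_at_bot])
    from tendsto_divide[OF tendsto_minus[OF this] tendsto_const[of c]] show ?thesis using assms by simp
  qed
  have a: "(\<integral>\<^sup>+x. ?g x \<partial>lborel) = ennreal (0 - (- exp (- c * 0) / c))"
    by (rule nn_integral_FTC_atLeast[OF _ _ _ lim])
      (use assms in \<open>auto intro!: derivative_eq_intros simp: field_simps\<close>)
  have b: "(\<integral>\<^sup>+x. ?g x \<partial>lborel) = (\<integral>\<^sup>+x. ?g (- x) \<partial>lborel)"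
    using nn_integral_real_affine[of ?g "-1" 0] by simp
  have "(\<integral>\<^sup>+x. ennreal (exp (- c * \<bar>x\<bar>)) \<partial>lborel) \<le> (\<integral>\<^sup>+x. ?g x + ?g (- x) \<partial>lborel)"
    by (intro nn_integral_mono) (auto simp: indicator_def)
  also have "\<dots> = (\<integral>\<^sup>+x. ?g x \<partial>lborel) + (\<integral>\<^sup>+x. ?g (- x) \<partial>lborel)"
    by (rule nn_integral_add) auto
  also have "\<dots> < \<infinity>"
    unfolding b[symmetric] a by simp
  finally show ?thesis .
qed

text \<open>
  The norm dominates the mean of the moduli of the coordinates, which leaves a product of
  one-dimensional exponentials.
\<close>

lemma integrable_exp_norm: "integrable lborel (\<lambda>z::real^'d. exp (- norm z))"
proof -
  define c where "c = 1 / real DIM(real^'d)"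
  have c: "c > 0" by (simp add: c_def)
  have le: "exp (- norm z) \<le> (\<Prod>b\<in>Basis. exp (- c * \<bar>z \<bullet> b\<bar>))" for z :: "real^'d"
  proof -
    have "(\<Sum>b\<in>Basis. \<bar>z \<bullet> b\<bar>) \<le> (\<Sum>b\<in>(Basis::(real^'d) set). norm z)"
      by (intro sum_mono Basis_le_norm)
    then have "c * (\<Sum>b\<in>Basis. \<bar>z \<bullet> b\<bar>) \<le> norm z"
      by (simp add: c_def field_simps)
    then show ?thesis
      by (simp add: exp_sum[symmetric] sum_distrib_left sum_negf)
  qed
  have "(\<integral>\<^sup>+z. ennreal (exp (- norm z)) \<partial>(lborel :: (real^'d) measure))
      \<le> (\<integral>\<^sup>+z. (\<Prod>b\<in>Basis. ennreal (exp (- c * \<bar>z \<bullet> b\<bar>))) \<partial>(lborel :: (real^'d) measure))"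
    using le by (intro nn_integral_mono) (simp add: prod_ennreal ennreal_leI)
  also have "\<dots> = (\<Prod>b\<in>(Basis :: (real^'d) set). (\<integral>\<^sup>+x. ennreal (exp (- c * \<bar>x\<bar>)) \<partial>lborel))"
    using nn_integral_lborel_prod[where 'a="real^'d" and f="\<lambda>_ x. ennreal (exp (- c * \<bar>x\<bar>))"] by simp
  also have "\<dots> < \<infinity>"
    using nn_integral_exp_abs_finite[OF c] by (simp add: power_less_top_ennreal)
  finally show ?thesis
    by (intro integrableI_bounded) auto
qed

text \<open>
  The standard Gaussian density up to normalisation.
\<close>

definition gauss :: "real^'d \<Rightarrow> real" where
  "gauss z = exp (- (z \<bullet> z) / 2)"

lemma gauss_pos: "gauss z > 0" by (simp add: gauss_def)

lemma gauss_measurable [measurable]: "gauss \<in> borel_measurable borel"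
  unfolding gauss_def by measurable

text \<open>
  Every Gaussian integral below carries a weight of at most cubic growth, so this bound dominates all
  of them. The constant comes from \<open>4 r - r\<^sup>2 / 2 \<le> 8\<close>.
\<close>

lemma gauss_weight: "(1 + norm z) ^ 3 * gauss z \<le> exp 8 * exp (- norm z)"
proof -
  let ?r = "norm z"
  have "(1 + ?r) ^ 3 \<le> exp ?r ^ 3" by (intro power_mono exp_ge_add_one_self) auto
  also have "\<dots> = exp (3 * ?r)" by (simp add: exp_of_nat_mult[symmetric])
  finally have "(1 + ?r) ^ 3 * gauss z \<le> exp (3 * ?r) * exp (- (?r\<^sup>2) / 2)"
    by (intro mult_mono) (auto simp: gauss_def power2_norm_eq_inner)
  also have "\<dots> \<le> exp 8 * exp (- ?r)"
  proof -
    have "0 \<le> (?r - 4)\<^sup>2" by simp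
    then have "3 * ?r + - (?r\<^sup>2) / 2 \<le> 8 + - ?r" by (simp add: power2_eq_square algebra_simps)
    then show ?thesis by (simp flip: exp_add)
  qed
  finally show ?thesis .
qed

lemma integrable_gauss_weight:
  fixes f :: "real^'d \<Rightarrow> real"
  assumes [measurable]: "f \<in> borel_measurable borel" and "\<And>z. \<bar>f z\<bar> \<le> B * (1 + norm z) ^ 3"
  shows "integrable lborel (\<lambda>z. gauss z * f z)"
proof (rule Bochner_Integration.integrable_bound)
  show "integrable lborel (\<lambda>z::real^'d. (\<bar>B\<bar> * exp 8) *\<^sub>R exp (- norm z))"
    by (intro integrable_scaleR_right integrable_exp_norm)
  have "norm (gauss z * f z) \<le> norm ((\<bar>B\<bar> * exp 8) *\<^sub>R exp (- norm z))" for z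
  proof -
    have "norm (gauss z * f z) \<le> gauss z * (\<bar>B\<bar> * (1 + norm z) ^ 3)"
      using assms(2)[of z] gauss_pos[of z]
      by (auto simp: abs_mult intro!: mult_left_mono order_trans[OF assms(2)] mult_right_mono)
    also have "\<dots> \<le> \<bar>B\<bar> * (exp 8 * exp (- norm z))"
      using mult_left_mono[OF gauss_weight[of z], of "\<bar>B\<bar>"] by (simp add: mult_ac)
    finally show ?thesis by (simp add: mult_ac)
  qed
  then show "AE z in lborel. norm (gauss z * f z) \<le> norm ((\<bar>B\<bar> * exp 8) *\<^sub>R exp (- norm z))" by simp
qed measurable

text \<open>
  The whole-space analogue of the divergence theorem on the cell, again by translation invariance. The
  exponential bound survives a translation by a vector of length at most one up to the factor \<open>exp 1\<close>.
\<close>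

lemma integral_partial_eq_0:
  fixes h h' :: "real^'d \<Rightarrow> real"
  assumes m: "h \<in> borel_measurable borel" and bd: "\<And>x. \<bar>h x\<bar> \<le> B * exp (- norm x)"
    and bd': "\<And>x. \<bar>h' x\<bar> \<le> B * exp (- norm x)"
    and der: "\<And>x. ((\<lambda>s. h (x + s *\<^sub>R axis i 1)) has_real_derivative h' x) (at 0)"
  shows "integrable lborel h'" "(\<integral>x. h' x \<partial>lborel) = 0"
proof -
  note [measurable] = m
  let ?F = "\<lambda>r x. h (x + r *\<^sub>R axis i 1)" and ?F' = "\<lambda>r x. h' (x + r *\<^sub>R axis i 1)"
  let ?W = "\<lambda>x::real^'d. (B * exp 1) *\<^sub>R exp (- norm x)"
  have B: "B \<ge> 0" using order_trans[OF abs_ge_zero bd[of 0]] by simp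
  have W: "integrable lborel ?W" by (intro integrable_scaleR_right integrable_exp_norm)
  have le: "B * exp (- norm (x + r *\<^sub>R axis i 1)) \<le> ?W x" if "-1 < r" "r < 1" for x r
  proof -
    have "norm x \<le> norm (x + r *\<^sub>R axis i 1) + norm (r *\<^sub>R axis i 1 :: real^'d)"
      using norm_triangle_ineq4[of "x + r *\<^sub>R axis i 1" "r *\<^sub>R axis i 1"] by simp
    then have "- norm (x + r *\<^sub>R axis i 1) \<le> 1 + - norm x"
      using that by (simp add: norm_axis_1)
    then show ?thesis using B by (simp flip: exp_add add: mult.assoc mult_left_mono)
  qed
  note D = has_derivative_under_integral[of "-1" 0 1 lborel ?F ?F' ?W]
  have 1: "integrable lborel (?F r)" if "-1 < r" "r < 1" for r
    by (rule Bochner_Integration.integrable_bound[OF W])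
      (use order_trans[OF order_trans[OF bd le[OF that]] abs_ge_self] in \<open>auto intro!: AE_I2\<close>)
  have 2: "\<bar>?F' r x\<bar> \<le> ?W x" if "-1 < r" "r < 1" for r x
    by (rule order_trans[OF bd' le[OF that]])
  show "integrable lborel h'"
    using D(2)[OF _ _ 1 DERIV_along[OF der] 2 W] by simp
  have "((\<lambda>r. \<integral>x. ?F r x \<partial>lborel) has_real_derivative (\<integral>x. ?F' 0 x \<partial>lborel)) (at 0)"
    using D(1)[OF _ _ 1 DERIV_along[OF der] 2 W] by simp
  moreover have "(\<integral>x. ?F r x \<partial>lborel) = (\<integral>x. h x \<partial>lborel)" for r
    by (rule integral_translate_lborel[OF m])
  ultimately have "((\<lambda>r. \<integral>x. h x \<partial>lborel) has_real_derivative (\<integral>x. h' x \<partial>lborel)) (at 0)"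
    by simp
  then show "(\<integral>x. h' x \<partial>lborel) = 0"
    using DERIV_unique DERIV_const by blast
qed

text \<open>
  The partial derivative of \<open>gauss\<close> is \<open>- z_i gauss\<close>. The weight \<open>P\<close> will be \<open>1\<close> or a coordinate.
\<close>

lemma gauss_integration_by_parts:
  fixes g g' P P' :: "real^'d \<Rightarrow> real"
  assumes [measurable]: "g \<in> borel_measurable borel" "P \<in> borel_measurable borel" "P' \<in> borel_measurable borel"
    and g: "\<And>x. \<bar>g x\<bar> \<le> B" and g': "\<And>x. \<bar>g' x\<bar> \<le> B"
    and P: "\<And>x. \<bar>P x\<bar> \<le> 1 + norm x" and P': "\<And>x. \<bar>P' x\<bar> \<le> 1"
    and dg: "\<And>x. ((\<lambda>s. g (x + s *\<^sub>R axis i 1)) has_real_derivative g' x) (at 0)"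
    and dP: "\<And>x. ((\<lambda>s. P (x + s *\<^sub>R axis i 1)) has_real_derivative P' x) (at 0)"
  shows "integrable lborel (\<lambda>z. gauss z * (P z * g' z))"
    and "(\<integral>z. gauss z * (P z * z $ i * g z) \<partial>lborel) =
         (\<integral>z. gauss z * (P' z * g z) \<partial>lborel) + (\<integral>z. gauss z * (P z * g' z) \<partial>lborel)"
proof -
  define Q where "Q z = P' z * g z + P z * g' z - P z * z $ i * g z" for z
  have B: "B \<ge> 0" using order_trans[OF abs_ge_zero g[of 0]] by simp
  have [measurable]: "(\<lambda>z::real^'d. z $ i) \<in> borel_measurable borel"
    by (intro borel_measurable_continuous_onI continuous_intros)
  have p1: "1 \<le> 1 + norm (z::real^'d)" "1 + norm z \<le> (1 + norm z)^3" "(1 + norm z)^2 \<le> (1 + norm z)^3"  "1 \<le> (1 + norm z)^3" for z :: "real^'d"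
    by (auto intro!: self_le_power power_increasing one_le_power)
  have b1: "\<bar>P z * g z\<bar> \<le> B * (1 + norm z)^3" for z
  proof -
    have "\<bar>P z * g z\<bar> \<le> (1 + norm z) * B" unfolding abs_mult using P g by (intro mult_mono) auto
    also have "\<dots> \<le> (1 + norm z)^3 * B" by (intro mult_right_mono p1 B)
    finally show ?thesis by (simp add: mult.commute)
  qed
  have b2: "\<bar>P' z * g z\<bar> \<le> B * (1 + norm z)^3" for z
  proof -
    have "\<bar>P' z * g z\<bar> \<le> 1 * B" unfolding abs_mult using P' g by (intro mult_mono) auto
    also have "\<dots> \<le> (1 + norm z)^3 * B" by (intro mult_right_mono p1 B)
    finally show ?thesis by (simp add: mult.commute)
  qed
  have b3: "\<bar>P z * z $ i * g z\<bar> \<le> B * (1 + norm z)^3" for z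
  proof -
    have "\<bar>P z * z $ i * g z\<bar> \<le> (1 + norm z) * (1 + norm z) * B" unfolding abs_mult
      using P g component_le_norm_cart[of z i] by (intro mult_mono) auto
    also have "\<dots> \<le> (1 + norm z)^3 * B" using p1(3)[of z] by (intro mult_right_mono B) (simp add: power2_eq_square)
    finally show ?thesis by (simp add: mult.commute)
  qed
  have b4: "\<bar>P z * g' z\<bar> \<le> B * (1 + norm z)^3" for z
  proof -
    have "\<bar>P z * g' z\<bar> \<le> (1 + norm z) * B" unfolding abs_mult using P g' by (intro mult_mono) auto
    also have "\<dots> \<le> (1 + norm z)^3 * B" by (intro mult_right_mono p1 B)
    finally show ?thesis by (simp add: mult.commute)
  qed
  have bQ: "\<bar>Q z\<bar> \<le> 3 * B * (1 + norm z)^3" for z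
    using b2[of z] b3[of z] b4[of z] unfolding Q_def by linarith
  have wt: "\<bar>gauss z * q\<bar> \<le> (3 * B * exp 8) * exp (- norm z)" if "\<bar>q\<bar> \<le> 3 * B * (1 + norm z)^3"
    for q and z :: "real^'d"
  proof -
    have "\<bar>gauss z * q\<bar> \<le> gauss z * (3 * B * (1 + norm z)^3)"
      using that gauss_pos[of z] by (auto simp: abs_mult intro!: mult_left_mono)
    also have "\<dots> \<le> 3 * B * (exp 8 * exp (- norm z))"
      using mult_left_mono[OF gauss_weight[of z], of "3 * B"] B by (simp add: mult_ac)
    finally show ?thesis by (simp add: mult_ac)
  qed
  have b1': "\<bar>P z * g z\<bar> \<le> 3 * B * (1 + norm z)^3" for z
    using b1[of z] by linarith
  have dgauss: "((\<lambda>s. gauss (x + s *\<^sub>R axis i 1)) has_real_derivative - (x $ i) * gauss x) (at 0)" for x :: "real^'d"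
  proof -
    have eq: "(x + s *\<^sub>R axis i 1) \<bullet> (x + s *\<^sub>R axis i 1) = x \<bullet> x + 2 * s * x $ i + s * s" for s
      by (simp add: inner_add_left inner_add_right inner_axis inner_axis' inner_axis_axis algebra_simps)
    show ?thesis unfolding gauss_def eq
      by (auto intro!: derivative_eq_intros simp: field_simps)
  qed
  have dh: "((\<lambda>s. gauss (x + s *\<^sub>R axis i 1) * (P (x + s *\<^sub>R axis i 1) * g (x + s *\<^sub>R axis i 1)))
      has_real_derivative gauss x * Q x) (at 0)" for x
    by (rule derivative_eq_intros dgauss dg dP refl)+ (simp add: Q_def algebra_simps)
  note Z = integral_partial_eq_0[of "\<lambda>z. gauss z * (P z * g z)" "3 * B * exp 8" "\<lambda>z. gauss z * Q z" i]
  have i1: "integrable lborel (\<lambda>z. gauss z * Q z)"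
    by (rule Z) (auto intro!: wt b1' bQ dh)
  have i0: "(\<integral>z. gauss z * Q z \<partial>lborel) = 0"
    by (rule Z) (auto intro!: wt b1' bQ dh)
  have i2: "integrable lborel (\<lambda>z. gauss z * (P' z * g z))"
    by (rule integrable_gauss_weight[OF _ b2]) measurable
  have i3: "integrable lborel (\<lambda>z. gauss z * (P z * z $ i * g z))"
    by (rule integrable_gauss_weight[OF _ b3]) measurable
  have eq: "gauss z * (P z * g' z) = gauss z * Q z - gauss z * (P' z * g z) + gauss z * (P z * z $ i * g z)" for z
    by (simp add: Q_def algebra_simps)
  show "integrable lborel (\<lambda>z. gauss z * (P z * g' z))"
    unfolding eq by (intro Bochner_Integration.integrable_add Bochner_Integration.integrable_diff i1 i2 i3)
  show "(\<integral>z. gauss z * (P z * z $ i * g z) \<partial>lborel) =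
         (\<integral>z. gauss z * (P' z * g z) \<partial>lborel) + (\<integral>z. gauss z * (P z * g' z) \<partial>lborel)"
    unfolding eq using i0 i1 i2 i3 by simp
qed

section \<open>Gaussian averages of periodic functions\<close>

lemma integrable_gauss_cmult_bounded:
  fixes f :: "real^'d \<Rightarrow> real"
  assumes "f \<in> borel_measurable borel" "\<And>z. \<bar>f z\<bar> \<le> B * (1 + norm z)" "B \<ge> 0"
  shows "integrable lborel (\<lambda>z. gauss z * f z)"
proof (rule integrable_gauss_weight[OF assms(1)])
  fix z
  have "\<bar>f z\<bar> \<le> B * (1 + norm z)" by (rule assms)
  also have "\<dots> \<le> B * (1 + norm z) ^ 3" using assms(3) by (intro mult_left_mono self_le_power) auto
  finally show "\<bar>f z\<bar> \<le> B * (1 + norm z) ^ 3" .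
qed

lemma cball_subset_cbox_cart: "cball x0 r \<subseteq> cbox (x0 - (\<chi> i. r)) (x0 + (\<chi> i. r))" for x0 :: "real^'d"
proof
  fix y assume "y \<in> cball x0 r"
  then have n: "norm (y - x0) \<le> r" by (simp add: dist_norm norm_minus_commute)
  have "x0 $ i - r \<le> y $ i \<and> y $ i \<le> x0 $ i + r" for i
    using order_trans[OF component_le_norm_cart[of "y - x0" i] n] by (simp add: abs_le_iff)
  then show "y \<in> cbox (x0 - (\<chi> i. r)) (x0 + (\<chi> i. r))" by (simp add: mem_box_cart)
qed

lemma finite_cover_by_cells:
  "\<exists>Q. finite Q \<and> cball 0 r \<subseteq> (\<Union>q\<in>Q. {y::real^'d. y - q \<in> cell})"
proof -
  have "\<forall>e>0. \<exists>k. finite k \<and> cball (0::real^'d) r \<subseteq> (\<Union>x\<in>k. ball x e)"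
    using compact_cball[of "0::real^'d" r] unfolding compact_eq_totally_bounded by (rule conjunct2)
  from this[rule_format, of "1/4", simplified] obtain k
    where k: "finite k" "cball (0::real^'d) r \<subseteq> (\<Union>x\<in>k. ball x (1/4))"
    by auto
  let ?h = "(\<chi> i. 1/2) :: real^'d"
  have sub: "ball x (1/4) \<subseteq> {y. y - (x - ?h) \<in> cell}" for x :: "real^'d"
  proof
    fix y assume "y \<in> ball x (1/4)"
    then have n: "norm (y - x) < 1/4" by (simp add: dist_norm norm_minus_commute)
    have "\<bar>(y - x) $ i\<bar> < 1/4" for i
      by (rule le_less_trans[OF component_le_norm_cart n])
    then have "\<bar>y $ i - x $ i\<bar> < 1/4" for i by simp
    then have "0 \<le> y $ i - (x $ i - 1/2) \<and> y $ i - (x $ i - 1/2) < 1" for i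
      unfolding abs_less_iff by (auto dest: meta_spec[of _ i])
    then show "y \<in> {y. y - (x - ?h) \<in> cell}" by (simp add: cell_def)
  qed
  have "cball 0 r \<subseteq> (\<Union>q\<in>(\<lambda>x. x - ?h) ` k. {y::real^'d. y - q \<in> cell})"
  proof
    fix y :: "real^'d" assume "y \<in> cball 0 r"
    then obtain x where "x \<in> k" "y \<in> ball x (1/4)" using k(2) by blast
    then show "y \<in> (\<Union>q\<in>(\<lambda>x. x - ?h) ` k. {y::real^'d. y - q \<in> cell})"
      using subsetD[OF sub] by blast
  qed
  with k(1) show ?thesis by blast
qed

text \<open>
  The ball is covered by finitely many translates of the cell. Their corners need not be lattice points,
  since a periodic function has the same integral over every translate.
\<close>

lemma integral_ball_le_integral_cell:
  fixes r :: real
  shows "\<exists>N::nat. \<forall>g S. \<forall>x0::real^'d. g \<in> borel_measurable borel \<longrightarrow> periodic g \<longrightarrow> (\<forall>x. 0 \<le> g x \<and> g x \<le> (S::real)) \<longrightarrow>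
    (\<integral>y. indicator (cball x0 r) y * g y \<partial>lborel) \<le> N * (\<integral>x. g x \<partial>cell_measure)"
proof -
  obtain Q where Q: "finite Q" "cball 0 r \<subseteq> (\<Union>q\<in>Q. {y::real^'d. y - q \<in> cell})"
    using finite_cover_by_cells by blast
  have "(\<integral>y. indicator (cball x0 r) y * g y \<partial>lborel) \<le> real (card Q) * (\<integral>x. g x \<partial>cell_measure)"
    if [measurable]: "g \<in> borel_measurable borel" and per: "periodic g" and g: "\<And>x. 0 \<le> g x \<and> g x \<le> S"
    for g S and x0 :: "real^'d"
  proof -
    have bd: "\<bar>g x\<bar> \<le> S" for x using g[of x] by simp
    have int: "integrable lborel (\<lambda>y. indicator cell (y - x0 - q) * g y)" for q
    proof -
      have eq: "(\<lambda>y. indicator cell (y - x0 - q) * g y) = (\<lambda>y. indicator {y. y - x0 - q \<in> cell} y * g y)"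
        by (auto simp: indicator_def)
      show ?thesis unfolding eq
      proof (rule integrable_lborel_bounded_support[OF _ _ bd])
        show "{y. y - x0 - q \<in> cell} \<subseteq> cbox (x0 + q) (x0 + q + (\<chi> i. 1))"
        proof
          fix y assume "y \<in> {y. y - x0 - q \<in> cell}"
          then have "0 \<le> (y - x0 - q) $ i \<and> (y - x0 - q) $ i < 1" for i by (auto simp: cell_def)
          then have "(x0 + q) $ i \<le> y $ i \<and> y $ i \<le> (x0 + q + (\<chi> i. 1)) $ i" for i
            by (simp add: algebra_simps less_imp_le)
          then show "y \<in> cbox (x0 + q) (x0 + q + (\<chi> i. 1))" by (simp add: mem_box_cart)
        qed
      qed measurable
    qed
    have "(\<integral>y. indicator (cball x0 r) y * g y \<partial>lborel) \<le> (\<integral>y. (\<Sum>q\<in>Q. indicator cell (y - x0 - q) * g y) \<partial>lborel)"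
    proof (rule integral_mono)
      show "integrable lborel (\<lambda>y. indicator (cball x0 r) y * g y)"
        by (rule integrable_lborel_bounded_support[OF _ _ bd, where a="x0 - (\<chi> i. r)" and b="x0 + (\<chi> i. r)"])
          (simp_all add: cball_subset_cbox_cart[simplified])
      show "integrable lborel (\<lambda>y. \<Sum>q\<in>Q. indicator cell (y - x0 - q) * g y)"
        by (intro Bochner_Integration.integrable_sum int)
      fix y :: "real^'d"
      show "indicator (cball x0 r) y * g y \<le> (\<Sum>q\<in>Q. indicator cell (y - x0 - q) * g y)"
      proof (cases "y \<in> cball x0 r")
        case True
        then have "y - x0 \<in> cball 0 r" by (simp add: dist_norm norm_minus_commute)
        then obtain q where q: "q \<in> Q" "y - x0 - q \<in> cell" using Q by auto
        have "indicator cell (y - x0 - q) * g y \<le> (\<Sum>q\<in>Q. indicator cell (y - x0 - q) * g y)"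
          by (rule member_le_sum) (use q g Q in auto)
        with q True show ?thesis by simp
      qed (auto intro!: sum_nonneg simp: g)
    qed
    also have "\<dots> = (\<Sum>q\<in>Q. \<integral>y. indicator cell (y - x0 - q) * g y \<partial>lborel)"
      by (rule Bochner_Integration.integral_sum[OF int])
    also have "\<dots> = (\<Sum>q\<in>Q. \<integral>x. g x \<partial>cell_measure)"
    proof (rule sum.cong[OF refl])
      fix q
      have "(\<integral>y. indicator cell (y - x0 - q) * g y \<partial>lborel) =
         (\<integral>y. indicator cell (y + (x0 + q) - x0 - q) * g (y + (x0 + q)) \<partial>lborel)"
        by (rule integral_translate_lborel[symmetric]) measurable
      also have "\<dots> = (\<integral>y. indicator cell y * g (y + (x0 + q)) \<partial>lborel)"
        by simp
      also have "\<dots> = (\<integral>x. g x \<partial>cell_measure)"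
        unfolding integral_cell_eq[symmetric] by (rule integral_cell_shift[OF _ bd per]) measurable
      finally show "(\<integral>y. indicator cell (y - x0 - q) * g y \<partial>lborel) = (\<integral>x. g x \<partial>cell_measure)" .
    qed
    finally show ?thesis by simp
  qed
  then show ?thesis by (intro exI[of _ "card Q"]) blast
qed

lemma integral_scale_lborel:
  fixes G :: "real^'d \<Rightarrow> real"
  assumes [measurable]: "G \<in> borel_measurable borel" and s: "\<sigma> > 0"
  shows "(\<integral>z. G (x0 + \<sigma> *\<^sub>R z) \<partial>lborel) = (\<integral>y. G y \<partial>lborel) / \<sigma> ^ CARD('d)"
proof -
  have "(\<integral>y. G y \<partial>lborel) = (\<integral>y. G y \<partial>density (distr lborel borel (\<lambda>x. x0 + \<sigma> *\<^sub>R x)) (\<lambda>_. \<bar>\<sigma>\<bar>^DIM(real^'d)))"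
    using lborel_affine[of \<sigma> x0] s by simp
  also have "\<dots> = (\<integral>y. \<sigma> ^ CARD('d) * G y \<partial>distr lborel borel (\<lambda>x. x0 + \<sigma> *\<^sub>R x))"
    using s by (subst integral_density) (auto simp: ennreal_power)
  also have "\<dots> = (\<integral>z. \<sigma> ^ CARD('d) * G (x0 + \<sigma> *\<^sub>R z) \<partial>lborel)"
    by (subst integral_distr) auto
  finally show ?thesis using s by simp
qed

text \<open>
  Beyond a radius \<open>R\<close> the first moment of the Gaussian is at most the second moment divided by \<open>R\<close>; this
  gives the small multiple of \<open>S\<close>. Inside, the weight is bounded, and after rescaling the ball is covered
  by a bounded number of cells; the Jacobian is bounded because the width stays above \<open>\<epsilon>\<close>.
\<close>

lemma gauss_far_part:
  assumes \<delta>: "\<delta> > 0" and \<epsilon>: "\<epsilon> > 0"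
  shows "\<exists>K\<ge>0. \<forall>\<sigma> g S. \<forall>x0::real^'d. \<epsilon> \<le> \<sigma> \<longrightarrow> \<sigma> \<le> \<sigma>M \<longrightarrow> g \<in> borel_measurable borel \<longrightarrow> periodic g \<longrightarrow>
    (\<forall>x. 0 \<le> g x \<and> g x \<le> (S::real)) \<longrightarrow>
    (\<integral>z. gauss z * (norm z * g (x0 + \<sigma> *\<^sub>R z)) \<partial>lborel) \<le> \<delta> * S + K * (\<integral>x. g x \<partial>cell_measure)"
proof -
  let ?m2 = "\<integral>z. gauss z * (norm z)\<^sup>2 \<partial>(lborel :: (real^'d) measure)"
  have p2: "(norm z)\<^sup>2 \<le> (1 + norm z)^3" for z :: "real^'d"
  proof -
    have "(norm z)\<^sup>2 \<le> (1 + norm z)\<^sup>2" by (intro power_mono) auto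
    also have "\<dots> \<le> (1 + norm z)^3" by (intro power_increasing) auto
    finally show ?thesis .
  qed
  have im2: "integrable lborel (\<lambda>z::real^'d. gauss z * (norm z)\<^sup>2)"
    by (rule integrable_gauss_weight[of _ 1]) (use p2 in auto)
  have m2: "?m2 \<ge> 0" by (rule Bochner_Integration.integral_nonneg) (simp add: gauss_def)
  define R where "R = (?m2 + 1) / \<delta>"
  have R: "R > 0" using m2 \<delta> by (simp add: R_def add_nonneg_pos)
  have R2: "?m2 / R \<le> \<delta>"
    using m2 \<delta> by (simp add: R_def divide_simps)
  obtain N :: nat where N: "\<And>g S. \<And>x0::real^'d. g \<in> borel_measurable borel \<Longrightarrow> periodic g \<Longrightarrow> (\<And>x. 0 \<le> g x \<and> g x \<le> (S::real)) \<Longrightarrow>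
    (\<integral>y. indicator (cball x0 (\<sigma>M * R)) y * g y \<partial>lborel) \<le> N * (\<integral>x. g x \<partial>cell_measure)"
    using integral_ball_le_integral_cell[where r="\<sigma>M * R" and 'd='d] by blast
  define K where "K = exp 8 * (N / \<epsilon> ^ CARD('d))"
  have "(\<integral>z. gauss z * (norm z * g (x0 + \<sigma> *\<^sub>R z)) \<partial>lborel) \<le> \<delta> * S + K * (\<integral>x. g x \<partial>cell_measure)"
    if \<sigma>: "\<epsilon> \<le> \<sigma>" "\<sigma> \<le> \<sigma>M" and gm[measurable]: "g \<in> borel_measurable borel" and per: "periodic g"
      and g: "\<And>x. 0 \<le> g x \<and> g x \<le> S" for \<sigma> g S and x0 :: "real^'d"
  proof -
    have s0: "\<sigma> > 0" using \<sigma> \<epsilon> by simp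
    have S: "S \<ge> 0" using g[of 0] by linarith
    have bd: "\<bar>g x\<bar> \<le> S" for x using g[of x] by simp
    let ?G = "\<lambda>y. indicator (cball x0 (\<sigma> * R)) y * g y"
    have iG: "integrable lborel (\<lambda>z. indicator (cball 0 R) z * g (x0 + \<sigma> *\<^sub>R z))"
      by (rule integrable_lborel_bounded_support[of "\<lambda>z. g (x0 + \<sigma> *\<^sub>R z)", OF _ _ bd, where a="0 - (\<chi> i. R)" and b="0 + (\<chi> i. R)"])
         (use cball_subset_cbox_cart[of 0 R] in simp_all)
    have pt: "gauss z * (norm z * g (x0 + \<sigma> *\<^sub>R z)) \<le>
        S / R * (gauss z * (norm z)\<^sup>2) + exp 8 * (indicator (cball 0 R) z * g (x0 + \<sigma> *\<^sub>R z))" for z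
    proof (cases "norm z \<le> R")
      case True
      have "gauss z * norm z \<le> (1 + norm z)^3 * gauss z"
        using gauss_pos[of z] self_le_power[of "1 + norm z" 3] by (auto simp: mult.commute[of "gauss z"] intro!: mult_right_mono)
      also have "\<dots> \<le> exp 8 * exp (- norm z)" by (rule gauss_weight)
      also have "\<dots> \<le> exp 8 * 1" by (intro mult_left_mono) auto
      finally have "gauss z * norm z * g (x0 + \<sigma> *\<^sub>R z) \<le> exp 8 * g (x0 + \<sigma> *\<^sub>R z)"
        using g by (intro mult_right_mono) auto
      moreover have "0 \<le> S / R * (gauss z * (norm z)\<^sup>2)" using S R gauss_pos[of z] by simp
      ultimately show ?thesis using True by (simp add: mult.assoc)
    next
      case False
      then have "norm z * g (x0 + \<sigma> *\<^sub>R z) \<le> (norm z)\<^sup>2 / R * S"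
      proof (intro mult_mono)
        have "norm z * R \<le> norm z * norm z" using False by (intro mult_left_mono) auto
        then show "norm z \<le> (norm z)\<^sup>2 / R" using R by (simp add: pos_le_divide_eq power2_eq_square)
      qed (use R g S in auto)
      then have "gauss z * (norm z * g (x0 + \<sigma> *\<^sub>R z)) \<le> gauss z * ((norm z)\<^sup>2 / R * S)"
        using gauss_pos[of z] by (intro mult_left_mono) auto
      with False show ?thesis by (simp add: mult_ac)
    qed
    have i1: "integrable lborel (\<lambda>z. gauss z * (norm z * g (x0 + \<sigma> *\<^sub>R z)))"
    proof (rule integrable_gauss_cmult_bounded[of _ S])
      show "\<bar>norm z * g (x0 + \<sigma> *\<^sub>R z)\<bar> \<le> S * (1 + norm z)" for z
        unfolding abs_mult mult.commute[of S] using bd by (intro mult_mono) auto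
    qed (use S in auto)
    have "(\<integral>z. gauss z * (norm z * g (x0 + \<sigma> *\<^sub>R z)) \<partial>lborel) \<le>
       (\<integral>z. S / R * (gauss z * (norm z)\<^sup>2) + exp 8 * (indicator (cball 0 R) z * g (x0 + \<sigma> *\<^sub>R z)) \<partial>lborel)"
      by (intro integral_mono i1 pt Bochner_Integration.integrable_add integrable_mult_right im2 iG)
    also have "\<dots> = S / R * ?m2 + exp 8 * (\<integral>z. indicator (cball 0 R) z * g (x0 + \<sigma> *\<^sub>R z) \<partial>lborel)"
      using im2 iG by simp
    also have "(\<integral>z. indicator (cball 0 R) z * g (x0 + \<sigma> *\<^sub>R z) \<partial>lborel) = (\<integral>z. ?G (x0 + \<sigma> *\<^sub>R z) \<partial>lborel)"
    proof (intro Bochner_Integration.integral_cong refl)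
      fix z :: "real^'d"
      have "norm (\<sigma> *\<^sub>R z) \<le> \<sigma> * R \<longleftrightarrow> norm z \<le> R" using s0 by simp
      then show "indicator (cball 0 R) z * g (x0 + \<sigma> *\<^sub>R z) = ?G (x0 + \<sigma> *\<^sub>R z)"
        by (simp add: indicator_def dist_norm)
    qed
    also have "\<dots> = (\<integral>y. ?G y \<partial>lborel) / \<sigma> ^ CARD('d)"
      by (rule integral_scale_lborel[OF _ s0]) (intro borel_measurable_times borel_measurable_indicator gm; simp)
    also have "\<dots> \<le> (N * (\<integral>x. g x \<partial>cell_measure)) / \<epsilon> ^ CARD('d)"
    proof (intro frac_le)
      have "(\<integral>y. ?G y \<partial>lborel) \<le> (\<integral>y. indicator (cball x0 (\<sigma>M * R)) y * g y \<partial>lborel)"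
      proof (rule integral_mono)
        have *: "integrable lborel (\<lambda>y. indicator (cball x0 r) y * g y)" for r
          by (rule integrable_lborel_bounded_support[OF _ _ bd, where a="x0 - (\<chi> i. r)" and b="x0 + (\<chi> i. r)"])
            (simp_all add: cball_subset_cbox_cart[simplified])
        show "integrable lborel ?G" "integrable lborel (\<lambda>y. indicator (cball x0 (\<sigma>M * R)) y * g y)"
          by (rule *)+
        have "\<sigma> * R \<le> \<sigma>M * R" using \<sigma> R by simp
        then show "?G y \<le> indicator (cball x0 (\<sigma>M * R)) y * g y" for y
          using g[of y] by (auto simp: indicator_def)
      qed
      also have "\<dots> \<le> N * (\<integral>x. g x \<partial>cell_measure)" by (rule N[OF gm per g])
      finally show "(\<integral>y. ?G y \<partial>lborel) \<le> N * (\<integral>x. g x \<partial>cell_measure)" .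
      show "0 \<le> N * (\<integral>x. g x \<partial>cell_measure)" using g by (intro mult_nonneg_nonneg Bochner_Integration.integral_nonneg) auto
      show "\<epsilon> ^ CARD('d) \<le> \<sigma> ^ CARD('d)" using \<sigma> \<epsilon> by (intro power_mono) auto
    qed (use \<epsilon> in auto)
    also have "S / R * ?m2 \<le> \<delta> * S"
      using mult_left_mono[OF R2 S] by (simp add: mult_ac)
    finally show ?thesis by (simp add: K_def mult_ac)
  qed
  moreover have "K \<ge> 0" using \<epsilon> by (simp add: K_def)
  ultimately show ?thesis by blast
qed

section \<open>Functions with continuous and bounded parabolic derivatives\<close>

text \<open>
  What the proof uses of the parabolic Hoelder spaces. The Hoelder exponent is left out because that of
  the solution may differ from that of the iterates, while the errors must lie in one class.
\<close>

definition regular :: "real \<Rightarrow> (real ^ 'd \<Rightarrow> real \<Rightarrow> real) \<Rightarrow> bool" where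
  "regular T w \<longleftrightarrow>
     (\<forall>t\<in>{0..T}. periodic (\<lambda>x. w x t)) \<and>
     continuous_on (UNIV \<times> {0..T}) (\<lambda>(x, t). w x t) \<and>
     (\<forall>x. \<forall>t\<in>{0<..<T}.
        (\<lambda>y. w y t) differentiable (at x) \<and>
        (\<lambda>y. Dx w y t) differentiable (at x) \<and>
        (\<lambda>s. w x s) differentiable (at t)) \<and>
     continuous_on (UNIV \<times> {0<..<T}) (\<lambda>(x, t). Dx w x t) \<and>
     continuous_on (UNIV \<times> {0<..<T}) (\<lambda>(x, t). Dx (Dx w) x t) \<and>
     continuous_on (UNIV \<times> {0<..<T}) (\<lambda>(x, t). Dt w x t) \<and>
     (\<exists>B. \<forall>x. \<forall>t\<in>{0<..<T}. \<bar>w x t\<bar> \<le> B \<and> norm (Dx w x t) \<le> B \<and>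
        norm (Dx (Dx w) x t) \<le> B \<and> \<bar>Dt w x t\<bar> \<le> B)"

lemma torus_dist_le: "torus_dist x y \<le> norm (x - y)"
proof -
  have "(0 :: real^'a) \<in> int_lattice" by (simp add: int_lattice_def)
  from infdist_le[OF this, of "x - y"] show ?thesis by (simp add: torus_dist_def)
qed

lemma torus_dist_nonneg: "0 \<le> torus_dist x y"
  by (simp add: torus_dist_def infdist_nonneg)

text \<open>
  The torus distance is at most the distance of the representatives, so the Hoelder bound gives joint
  continuity on the covering space.
\<close>

lemma parabolic_holder_continuous_on:
  fixes w :: "real ^ 'd \<Rightarrow> real \<Rightarrow> 'b::real_normed_vector"
  assumes w: "parabolic_holder \<beta> T w" and \<beta>: "\<beta> > 0"
  shows "continuous_on (UNIV \<times> {0<..<T}) (\<lambda>(x, t). w x t)"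
  unfolding continuous_on_def
proof
  fix z0 :: "(real^'d) \<times> real" assume z0: "z0 \<in> UNIV \<times> {0<..<T}"
  obtain K where K: "\<And>x1 x2 t1 t2. t1 \<in> {0<..<T} \<Longrightarrow> t2 \<in> {0<..<T} \<Longrightarrow>
      norm (w x1 t1 - w x2 t2) \<le> K * ((torus_dist x1 x2)\<^sup>2 + \<bar>t1 - t2\<bar>) powr (\<beta> / 2)"
    using w unfolding parabolic_holder_def by meson
  let ?b = "\<lambda>z. \<bar>K\<bar> * ((norm (fst z - fst z0))\<^sup>2 + \<bar>snd z - snd z0\<bar>) powr (\<beta> / 2)"
  have lim: "(?b \<longlongrightarrow> 0) (at z0 within UNIV \<times> {0<..<T})"
  proof (rule tendsto_mult_right_zero, rule tendsto_zero_powrI[where b="\<beta> / 2"])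
    have "((\<lambda>z. (norm (fst z - fst z0))\<^sup>2 + \<bar>snd z - snd z0\<bar>) \<longlongrightarrow>
        (norm (fst z0 - fst z0))\<^sup>2 + \<bar>snd z0 - snd z0\<bar>) (at z0 within UNIV \<times> {0<..<T})"
      by (intro tendsto_intros)
    then show "((\<lambda>z. (norm (fst z - fst z0))\<^sup>2 + \<bar>snd z - snd z0\<bar>) \<longlongrightarrow> 0) (at z0 within UNIV \<times> {0<..<T})"
      by simp
  qed (use \<beta> in auto)
  have "\<forall>\<^sub>F z in at z0 within UNIV \<times> {0<..<T}.
      norm ((case z of (x, t) \<Rightarrow> w x t) - (case z0 of (x, t) \<Rightarrow> w x t)) \<le> ?b z"
    unfolding eventually_at_filter
  proof (rule always_eventually, intro allI impI)
    fix z :: "(real^'d) \<times> real" assume "z \<in> UNIV \<times> {0<..<T}"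
    then have "norm (w (fst z) (snd z) - w (fst z0) (snd z0)) \<le>
        K * ((torus_dist (fst z) (fst z0))\<^sup>2 + \<bar>snd z - snd z0\<bar>) powr (\<beta> / 2)"
      using z0 by (intro K) auto
    also have "\<dots> \<le> \<bar>K\<bar> * ((torus_dist (fst z) (fst z0))\<^sup>2 + \<bar>snd z - snd z0\<bar>) powr (\<beta> / 2)"
      by (intro mult_right_mono) auto
    also have "\<dots> \<le> ?b z"
      using \<beta> by (intro mult_left_mono powr_mono2 add_mono power_mono torus_dist_le torus_dist_nonneg) auto
    finally show "norm ((case z of (x, t) \<Rightarrow> w x t) - (case z0 of (x, t) \<Rightarrow> w x t)) \<le> ?b z"
      by (simp add: case_prod_beta)
  qed
  then have "((\<lambda>z. (case z of (x, t) \<Rightarrow> w x t) - (case z0 of (x, t) \<Rightarrow> w x t)) \<longlongrightarrow> 0) (at z0 within UNIV \<times> {0<..<T})"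
    by (rule Lim_null_comparison[OF _ lim])
  then show "((\<lambda>(x, t). w x t) \<longlongrightarrow> (case z0 of (x, t) \<Rightarrow> w x t)) (at z0 within UNIV \<times> {0<..<T})"
    by (simp add: LIM_zero_iff)
qed

lemma parabolic_C2_regular:
  assumes w: "parabolic_C2 \<beta> T w" and \<beta>: "\<beta> > 0"
  shows "regular T w"
proof -
  have h: "parabolic_holder \<beta> T w" "parabolic_holder \<beta> T (Dx w)"
     "parabolic_holder \<beta> T (Dx (Dx w))" "parabolic_holder \<beta> T (Dt w)"
    using w by (auto simp: parabolic_C2_def)
  obtain B1 B2 B3 B4 where B: "\<forall>x. \<forall>t\<in>{0<..<T}. norm (w x t) \<le> B1" "\<forall>x. \<forall>t\<in>{0<..<T}. norm (Dx w x t) \<le> B2"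
     "\<forall>x. \<forall>t\<in>{0<..<T}. norm (Dx (Dx w) x t) \<le> B3" "\<forall>x. \<forall>t\<in>{0<..<T}. norm (Dt w x t) \<le> B4"
    using h unfolding parabolic_holder_def by meson
  have "\<forall>x. \<forall>t\<in>{0<..<T}. \<bar>w x t\<bar> \<le> max (max B1 B2) (max B3 B4) \<and> norm (Dx w x t) \<le> max (max B1 B2) (max B3 B4) \<and>
        norm (Dx (Dx w) x t) \<le> max (max B1 B2) (max B3 B4) \<and> \<bar>Dt w x t\<bar> \<le> max (max B1 B2) (max B3 B4)"
    using B by (simp add: le_max_iff_disj)
  with w show ?thesis
    unfolding regular_def parabolic_C2_def
    by (auto intro!: parabolic_holder_continuous_on[OF _ \<beta>])
qed

lemma has_derivative_nabla:
  fixes g :: "real^'d \<Rightarrow> real"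
  assumes "g differentiable (at x)"
  shows "(g has_derivative (\<lambda>h. h \<bullet> nabla g x)) (at x)"
proof -
  let ?D = "frechet_derivative g (at x)"
  have D: "(g has_derivative ?D) (at x)" using assms by (simp add: frechet_derivative_works)
  interpret bounded_linear ?D by (rule has_derivative_bounded_linear[OF D])
  have eq: "?D = (\<lambda>h. h \<bullet> nabla g x)"
  proof
    fix h
    have "?D h = ?D (\<Sum>i\<in>UNIV. (h $ i) *\<^sub>R axis i 1)"
      using basis_expansion[of h] by (simp add: scalar_mult_eq_scaleR)
    also have "\<dots> = (\<Sum>i\<in>UNIV. (h $ i) * ?D (axis i 1))"
      by (simp add: sum scaleR)
    finally show "?D h = h \<bullet> nabla g x" by (simp add: nabla_def inner_vec_def)
  qed
  show ?thesis using D unfolding eq .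
qed

lemma DERIV_axis:
  fixes g :: "real^'d \<Rightarrow> real"
  assumes "g differentiable (at x)"
  shows "((\<lambda>s. g (x + s *\<^sub>R axis i 1)) has_real_derivative nabla g x $ i) (at 0)"
proof -
  have "((\<lambda>s. g (x + s *\<^sub>R axis i 1)) has_derivative (\<lambda>s. (s *\<^sub>R axis i 1) \<bullet> nabla g x)) (at 0)"
  proof (rule has_derivative_compose[where g=g and f="\<lambda>s. x + s *\<^sub>R axis i 1"])
    show "((\<lambda>s. x + s *\<^sub>R axis i 1) has_derivative (\<lambda>s. s *\<^sub>R axis i 1)) (at 0)"
      by (auto intro!: derivative_eq_intros)
    show "(g has_derivative (\<lambda>h. h \<bullet> nabla g x)) (at (x + 0 *\<^sub>R axis i 1))"
      using has_derivative_nabla[OF assms] by simp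
  qed
  then show ?thesis
    by (simp add: has_field_derivative_def inner_axis' mult.commute[of _ "nabla g x $ i"])
qed

lemma nabla_component:
  fixes g :: "real^'d \<Rightarrow> real^'n"
  assumes "g differentiable (at x)"
  shows "(\<lambda>y. g y $ j) differentiable (at x)" "nabla (\<lambda>y. g y $ j) x $ i = nabla g x $ i $ j"
proof -
  have D: "(g has_derivative frechet_derivative g (at x)) (at x)"
    using assms by (simp add: frechet_derivative_works)
  have D2: "((\<lambda>y. g y $ j) has_derivative (\<lambda>h. frechet_derivative g (at x) h $ j)) (at x)"
    by (rule bounded_linear.has_derivative[OF bounded_linear_vec_nth D])
  then show "(\<lambda>y. g y $ j) differentiable (at x)" by (auto simp: differentiable_def)
  show "nabla (\<lambda>y. g y $ j) x $ i = nabla g x $ i $ j"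
    using frechet_derivative_at[OF D2] by (simp add: nabla_def fun_eq_iff)
qed

context
  fixes T :: real and w :: "real^'d \<Rightarrow> real \<Rightarrow> real"
  assumes w: "regular T w"
begin

lemma regular_periodic: "t \<in> {0..T} \<Longrightarrow> periodic (\<lambda>x. w x t)"
  using w by (auto simp: regular_def)

lemma regular_differentiable:
  assumes "t \<in> {0<..<T}"
  shows "(\<lambda>y. w y t) differentiable (at x)" "(\<lambda>y. Dx w y t) differentiable (at x)"
  using w assms by (auto simp: regular_def)

lemma regular_continuous_on:
  "continuous_on (UNIV \<times> {0..T}) (\<lambda>z. w (fst z) (snd z))"
  "continuous_on (UNIV \<times> {0<..<T}) (\<lambda>z. Dx w (fst z) (snd z))"
  "continuous_on (UNIV \<times> {0<..<T}) (\<lambda>z. Dx (Dx w) (fst z) (snd z))"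
  "continuous_on (UNIV \<times> {0<..<T}) (\<lambda>z. Dt w (fst z) (snd z))"
  using w by (auto simp: regular_def case_prod_unfold)

lemma regular_continuous_slice:
  shows "t \<in> {0..T} \<Longrightarrow> continuous_on UNIV (\<lambda>x. w x t)"
    "t \<in> {0<..<T} \<Longrightarrow> continuous_on UNIV (\<lambda>x. Dx w x t)"
    "t \<in> {0<..<T} \<Longrightarrow> continuous_on UNIV (\<lambda>x. Dx (Dx w) x t)"
    "t \<in> {0<..<T} \<Longrightarrow> continuous_on UNIV (\<lambda>x. Dt w x t)"
     by (rule continuous_on_compose2[OF regular_continuous_on(1), of UNIV "\<lambda>x. (x, t)", simplified]
          continuous_on_compose2[OF regular_continuous_on(2), of UNIV "\<lambda>x. (x, t)", simplified]
          continuous_on_compose2[OF regular_continuous_on(3), of UNIV "\<lambda>x. (x, t)", simplified]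
          continuous_on_compose2[OF regular_continuous_on(4), of UNIV "\<lambda>x. (x, t)", simplified];
         auto intro!: continuous_intros)+

lemma regular_DERIV_t:
  assumes "t \<in> {0<..<T}"
  shows "((\<lambda>s. w x s) has_real_derivative Dt w x t) (at t)"
  using w assms by (auto simp: regular_def Dt_def DERIV_deriv_iff_real_differentiable)

lemma regular_DERIV_x:
  assumes "t \<in> {0<..<T}"
  shows "((\<lambda>s. w (x + s *\<^sub>R axis i 1) t) has_real_derivative Dx w x t $ i) (at 0)"
    and "((\<lambda>s. Dx w (x + s *\<^sub>R axis i 1) t $ j) has_real_derivative Dx (Dx w) x t $ i $ j) (at 0)"
proof -
  note d = regular_differentiable[OF assms, of x]
  show "((\<lambda>s. w (x + s *\<^sub>R axis i 1) t) has_real_derivative Dx w x t $ i) (at 0)"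
    unfolding Dx_def by (rule DERIV_axis[OF d(1)])
  have "Dx (Dx w) x t $ i $ j = nabla (\<lambda>y. Dx w y t $ j) x $ i"
    unfolding Dx_def[of "Dx w"] by (rule nabla_component(2)[OF d(2), symmetric])
  then show "((\<lambda>s. Dx w (x + s *\<^sub>R axis i 1) t $ j) has_real_derivative Dx (Dx w) x t $ i $ j) (at 0)"
    using DERIV_axis[OF nabla_component(1)[OF d(2)], of i j] by simp
qed

lemma regular_bounded:
  obtains B where "B \<ge> 0" "\<And>x t. t \<in> {0..T} \<Longrightarrow> 0 < T \<Longrightarrow> \<bar>w x t\<bar> \<le> B"
    "\<And>x t. t \<in> {0<..<T} \<Longrightarrow> norm (Dx w x t) \<le> B"
    "\<And>x t. t \<in> {0<..<T} \<Longrightarrow> norm (Dx (Dx w) x t) \<le> B"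
    "\<And>x t. t \<in> {0<..<T} \<Longrightarrow> \<bar>Dt w x t\<bar> \<le> B"
proof -
  obtain B where B: "\<forall>x. \<forall>t\<in>{0<..<T}. \<bar>w x t\<bar> \<le> B \<and> norm (Dx w x t) \<le> B \<and>
        norm (Dx (Dx w) x t) \<le> B \<and> \<bar>Dt w x t\<bar> \<le> B"
    using w unfolding regular_def by blast
  have "\<bar>w x t\<bar> \<le> B" if t: "t \<in> {0..T}" and T: "0 < T" for x t
  proof (rule continuous_le_on_closure[of "{0<..<T}" "\<lambda>t. \<bar>w x t\<bar>"])
    show "t \<in> closure {0<..<T}" using t T by simp
    have "continuous_on {0..T} (\<lambda>t. w x t)"
      by (rule continuous_on_compose2[OF regular_continuous_on(1), of _ "\<lambda>t. (x, t)", simplified])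
        (auto intro!: continuous_intros)
    then show "continuous_on (closure {0<..<T}) (\<lambda>t. \<bar>w x t\<bar>)"
      using T by (auto intro!: continuous_intros)
  qed (use B in auto)
  with that[of "max B 0"] B show ?thesis by (metis max.cobounded2 max.coboundedI1)
qed

end

lemma regular_diff:
  fixes v w :: "real^'d \<Rightarrow> real \<Rightarrow> real"
  assumes "regular T v" "regular T w"
  shows "regular T (\<lambda>x t. v x t - w x t)"
    and "t \<in> {0<..<T} \<Longrightarrow> Dx (\<lambda>x t. v x t - w x t) x t = Dx v x t - Dx w x t"
    and "t \<in> {0<..<T} \<Longrightarrow> Dx (Dx (\<lambda>x t. v x t - w x t)) x t = Dx (Dx v) x t - Dx (Dx w) x t"
    and "t \<in> {0<..<T} \<Longrightarrow> Dt (\<lambda>x t. v x t - w x t) x t = Dt v x t - Dt w x t"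
proof -
  note r = regular_differentiable[OF assms(1)] regular_differentiable[OF assms(2)]
  have nd: "nabla (\<lambda>y. f y - g y) x = nabla f x - nabla g x"
    if "f differentiable (at x)" "g differentiable (at x)"
    for f g :: "real^'d \<Rightarrow> 'b::real_normed_vector" and x
  proof -
    have "((\<lambda>y. f y - g y) has_derivative (\<lambda>h. frechet_derivative f (at x) h - frechet_derivative g (at x) h)) (at x)"
      using that by (intro has_derivative_diff) (auto simp: frechet_derivative_works)
    from frechet_derivative_at[OF this] show ?thesis by (simp add: nabla_def vec_eq_iff fun_eq_iff)
  qed
  show 1: "Dx (\<lambda>x t. v x t - w x t) x t = Dx v x t - Dx w x t" if "t \<in> {0<..<T}" for x t
    unfolding Dx_def by (rule nd) (use r that in auto)
  have eq: "(\<lambda>y. Dx (\<lambda>x t. v x t - w x t) y t) = (\<lambda>y. Dx v y t - Dx w y t)" if "t \<in> {0<..<T}" for t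
    using 1[OF that] by auto
  show 2: "Dx (Dx (\<lambda>x t. v x t - w x t)) x t = Dx (Dx v) x t - Dx (Dx w) x t" if "t \<in> {0<..<T}" for x t
    unfolding Dx_def[of "Dx _"] eq[OF that] by (rule nd) (use r that in auto)
  show 3: "Dt (\<lambda>x t. v x t - w x t) x t = Dt v x t - Dt w x t" if "t \<in> {0<..<T}" for x t
    unfolding Dt_def[of "\<lambda>x t. v x t - w x t"]
    by (intro DERIV_imp_deriv DERIV_diff regular_DERIV_t[OF assms(1) that] regular_DERIV_t[OF assms(2) that])
  obtain B1 where B1: "B1 \<ge> 0" "\<And>x t. t \<in> {0..T} \<Longrightarrow> 0 < T \<Longrightarrow> \<bar>v x t\<bar> \<le> B1"
    "\<And>x t. t \<in> {0<..<T} \<Longrightarrow> norm (Dx v x t) \<le> B1"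
    "\<And>x t. t \<in> {0<..<T} \<Longrightarrow> norm (Dx (Dx v) x t) \<le> B1"
    "\<And>x t. t \<in> {0<..<T} \<Longrightarrow> \<bar>Dt v x t\<bar> \<le> B1"
    using regular_bounded[OF assms(1)] by blast
  obtain B2 where B2: "B2 \<ge> 0" "\<And>x t. t \<in> {0..T} \<Longrightarrow> 0 < T \<Longrightarrow> \<bar>w x t\<bar> \<le> B2"
    "\<And>x t. t \<in> {0<..<T} \<Longrightarrow> norm (Dx w x t) \<le> B2"
    "\<And>x t. t \<in> {0<..<T} \<Longrightarrow> norm (Dx (Dx w) x t) \<le> B2"
    "\<And>x t. t \<in> {0<..<T} \<Longrightarrow> \<bar>Dt w x t\<bar> \<le> B2"
    using regular_bounded[OF assms(2)] by blast
  show "regular T (\<lambda>x t. v x t - w x t)"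
    unfolding regular_def
  proof (intro conjI ballI allI exI[of _ "B1 + B2"])
    show "periodic (\<lambda>x. v x t - w x t)" if "t \<in> {0..T}" for t
      using regular_periodic[OF assms(1) that] regular_periodic[OF assms(2) that] by (auto simp: periodic_def)
    show "continuous_on (UNIV \<times> {0..T}) (\<lambda>(x, t). v x t - w x t)"
      using regular_continuous_on(1)[OF assms(1)] regular_continuous_on(1)[OF assms(2)]
      by (auto simp: case_prod_unfold intro!: continuous_intros)
    fix x :: "real^'d" and t assume t: "t \<in> {0<..<T}"
    then have t': "t \<in> {0..T}" "0 < T" by auto
    show "(\<lambda>y. v y t - w y t) differentiable at x" using r t by (intro differentiable_diff) auto
    show "(\<lambda>y. Dx (\<lambda>x t. v x t - w x t) y t) differentiable at x"
      unfolding eq[OF t] using r t by (intro differentiable_diff) auto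
    show "(\<lambda>s. v x s - w x s) differentiable at t"
      using regular_DERIV_t[OF assms(1) t] regular_DERIV_t[OF assms(2) t]
      by (intro differentiable_diff) (auto simp: real_differentiable_def)
    show "\<bar>v x t - w x t\<bar> \<le> B1 + B2" using B1(2)[OF t', of x] B2(2)[OF t', of x] by linarith
    show "norm (Dx (\<lambda>x t. v x t - w x t) x t) \<le> B1 + B2"
      unfolding 1[OF t] using B1(3)[OF t, of x] B2(3)[OF t, of x] by (intro norm_triangle_le_diff) auto
    show "norm (Dx (Dx (\<lambda>x t. v x t - w x t)) x t) \<le> B1 + B2"
      unfolding 2[OF t] using B1(4)[OF t, of x] B2(4)[OF t, of x] by (intro norm_triangle_le_diff) auto
    show "\<bar>Dt (\<lambda>x t. v x t - w x t) x t\<bar> \<le> B1 + B2"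
      unfolding 3[OF t] using B1(5)[OF t, of x] B2(5)[OF t, of x] by linarith
  next
    have "continuous_on (UNIV \<times> {0<..<T}) (\<lambda>z. Dx v (fst z) (snd z) - Dx w (fst z) (snd z))"
      using regular_continuous_on(2)[OF assms(1)] regular_continuous_on(2)[OF assms(2)] by (rule continuous_on_diff)
    then show "continuous_on (UNIV \<times> {0<..<T}) (\<lambda>(x, t). Dx (\<lambda>x t. v x t - w x t) x t)"
      by (rule continuous_on_eq) (auto simp: 1)
    have "continuous_on (UNIV \<times> {0<..<T}) (\<lambda>z. Dx (Dx v) (fst z) (snd z) - Dx (Dx w) (fst z) (snd z))"
      using regular_continuous_on(3)[OF assms(1)] regular_continuous_on(3)[OF assms(2)] by (rule continuous_on_diff)
    then show "continuous_on (UNIV \<times> {0<..<T}) (\<lambda>(x, t). Dx (Dx (\<lambda>x t. v x t - w x t)) x t)"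
      by (rule continuous_on_eq) (auto simp: 2)
    have "continuous_on (UNIV \<times> {0<..<T}) (\<lambda>z. Dt v (fst z) (snd z) - Dt w (fst z) (snd z))"
      using regular_continuous_on(4)[OF assms(1)] regular_continuous_on(4)[OF assms(2)] by (rule continuous_on_diff)
    then show "continuous_on (UNIV \<times> {0<..<T}) (\<lambda>(x, t). Dt (\<lambda>x t. v x t - w x t) x t)"
      by (rule continuous_on_eq) (auto simp: 3)
  qed
qed

lemma continuous_on_integral_dominated:
  fixes F :: "real \<Rightarrow> 'a \<Rightarrow> real"
  assumes meas: "\<And>s. s \<in> S \<Longrightarrow> F s \<in> borel_measurable M"
    and bd: "\<And>s x. s \<in> S \<Longrightarrow> x \<in> space M \<Longrightarrow> \<bar>F s x\<bar> \<le> W x" and W: "integrable M W"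
    and cont: "\<And>x. x \<in> space M \<Longrightarrow> continuous_on S (\<lambda>s. F s x)"
  shows "continuous_on S (\<lambda>s. \<integral>x. F s x \<partial>M)"
  unfolding continuous_on_sequentially
proof (intro allI ballI impI)
  fix X a assume a: "a \<in> S" and X: "(\<forall>n. X n \<in> S) \<and> X \<longlonglongrightarrow> a"
  have "(\<lambda>n. \<integral>x. F (X n) x \<partial>M) \<longlonglongrightarrow> (\<integral>x. F a x \<partial>M)"
  proof (rule integral_dominated_convergence[where w=W])
    show "AE x in M. (\<lambda>n. F (X n) x) \<longlonglongrightarrow> F a x"
      using cont a X unfolding continuous_on_sequentially by (auto simp: comp_def intro!: AE_I2)
  qed (use meas a X bd W in \<open>auto intro!: AE_I2\<close>)
  then show "((\<lambda>s. \<integral>x. F s x \<partial>M) \<circ> X) \<longlonglongrightarrow> (\<integral>x. F a x \<partial>M)" by (simp add: comp_def)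
qed

section \<open>Gaussian averages along the parabolic scaling\<close>

text \<open>
  The second partial derivative is known only at the point itself: differentiability in time is given for
  fixed \<open>x\<close>, and joint differentiability has to come from the continuity of the spatial gradient.
\<close>

lemma DERIV_diagonal:
  fixes f :: "real \<Rightarrow> real \<Rightarrow> real"
  assumes e: "e > 0"
    and fq: "\<And>q r. \<bar>q - \<sigma>\<bar> < e \<Longrightarrow> \<bar>r - \<sigma>\<bar> < e \<Longrightarrow> ((\<lambda>q. f q r) has_real_derivative A q r) (at q)"
    and cont: "isCont (\<lambda>z. A (fst z) (snd z)) (\<sigma>, \<sigma>)"
    and fr: "((\<lambda>r. f \<sigma> r) has_real_derivative B) (at \<sigma>)"
  shows "((\<lambda>s. f s s) has_real_derivative A \<sigma> \<sigma> + B) (at \<sigma>)"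
proof -
  let ?I = "ball \<sigma> e"
  have I: "\<sigma> \<in> ?I" using e by simp
  have "((\<lambda>(r, q). f q r) has_derivative (\<lambda>(tr, tq). tr * B + blinfun_mult_left (A \<sigma> \<sigma>) tq)) (at (\<sigma>, \<sigma>) within ?I \<times> ?I)"
  proof (rule has_derivative_partialsI[where fy="\<lambda>r q. blinfun_mult_left (A q r)" and fx="\<lambda>tr. tr * B"])
    show "((\<lambda>r. f \<sigma> r) has_derivative (\<lambda>tr. tr * B)) (at \<sigma> within ?I)"
    proof -
      have "(\<lambda>tr. tr * B) = (*) B" by (rule ext) (rule mult.commute)
      then show ?thesis
        using fr by (simp only: has_field_derivative_def has_derivative_at_withinI)
    qed
    show "((\<lambda>q. f q r) has_derivative blinfun_apply (blinfun_mult_left (A q r))) (at q within ?I)"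
      if "r \<in> ?I" "q \<in> ?I" for r q
    proof -
      have "blinfun_apply (blinfun_mult_left (A q r)) = (*) (A q r)" by (rule ext) simp
      moreover have "\<bar>q - \<sigma>\<bar> < e" "\<bar>r - \<sigma>\<bar> < e" using that by (auto simp: dist_real_def)
      ultimately show ?thesis
        using fq[of q r] by (simp only: has_field_derivative_def has_derivative_at_withinI)
    qed
    have "isCont (\<lambda>(z::real\<times>real). A (snd z) (fst z)) (\<sigma>, \<sigma>)"
    proof -
      have c: "isCont (\<lambda>z::real\<times>real. (snd z, fst z)) (\<sigma>, \<sigma>)" by (intro continuous_intros)
      show ?thesis using isCont_o2[OF c, of "\<lambda>z. A (fst z) (snd z)"] cont by simp
    qed
    then have "isCont (\<lambda>z::real\<times>real. blinfun_mult_left (A (snd z) (fst z))) (\<sigma>, \<sigma>)"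
      by (rule bounded_linear.isCont[OF bounded_linear_blinfun_mult_left])
    then show "continuous (at (\<sigma>, \<sigma>) within ?I \<times> ?I) (\<lambda>(r, q). blinfun_mult_left (A q r))"
      by (simp add: case_prod_unfold continuous_at_imp_continuous_at_within)
  qed (use I in auto)
  then have "((\<lambda>(r, q). f q r) has_derivative (\<lambda>(tr, tq). tr * B + tq * A \<sigma> \<sigma>)) (at (\<sigma>, \<sigma>))"
    using at_within_open[of "(\<sigma>, \<sigma>)" "?I \<times> ?I"] I by (simp add: open_Times)
  moreover have "((\<lambda>s. (s, s)) has_derivative (\<lambda>h. (h, h))) (at \<sigma>)"
    by (auto intro!: derivative_eq_intros)
  ultimately have "((\<lambda>s. (\<lambda>(r, q). f q r) (s, s)) has_derivative (\<lambda>h. (\<lambda>(tr, tq). tr * B + tq * A \<sigma> \<sigma>) (h, h))) (at \<sigma>)"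
    by (rule has_derivative_compose[rotated])
  then have "((\<lambda>s. f s s) has_derivative (\<lambda>h. h * B + h * A \<sigma> \<sigma>)) (at \<sigma>)" by simp
  also have "(\<lambda>h. h * B + h * A \<sigma> \<sigma>) = (*) (A \<sigma> \<sigma> + B)" by (auto simp: algebra_simps)
  finally show ?thesis by (simp add: has_field_derivative_def)
qed

text \<open>
  The time at which an average of width \<open>\<sigma>\<close> is taken: it runs backwards from \<open>t0\<close> if \<open>\<tau> = 1\<close> and forwards
  if \<open>\<tau> = -1\<close>. The heat kernel at elapsed time \<open>\<sigma>\<^sup>2 / 2\<close> is a Gaussian of width \<open>\<sigma>\<close>, so a fixed Gaussian
  weight follows the heat flow, and \<open>\<sigma>\<close> is a coordinate in which the gradient of the kernel is integrable
  without a singularity.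
\<close>

definition clock :: "real \<Rightarrow> real \<Rightarrow> real \<Rightarrow> real" where
  "clock \<tau> t0 \<sigma> = t0 - \<tau> * \<sigma>\<^sup>2 / 2"

text \<open>
  The width at which the clock reaches the end of the time interval.
\<close>

definition final_width :: "real \<Rightarrow> real \<Rightarrow> real \<Rightarrow> real" where
  "final_width T \<tau> t0 = sqrt (2 * (if \<tau> = 1 then t0 else T - t0))"

definition end_time :: "real \<Rightarrow> real \<Rightarrow> real" where
  "end_time T \<tau> = (if \<tau> = 1 then 0 else T)"

context
  fixes T \<tau> t0 :: real
  assumes \<tau>: "\<tau> = 1 \<or> \<tau> = -1" and t0: "t0 \<in> {0<..<T}"
begin

lemma final_width_pos: "final_width T \<tau> t0 > 0"
  using t0 by (simp add: final_width_def)

lemma clock_interior: "\<bar>\<sigma>\<bar> < final_width T \<tau> t0 \<Longrightarrow> clock \<tau> t0 \<sigma> \<in> {0<..<T}"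
proof -
  assume "\<bar>\<sigma>\<bar> < final_width T \<tau> t0"
  then have "\<bar>\<sigma>\<bar>\<^sup>2 < (final_width T \<tau> t0)\<^sup>2" by (intro power_strict_mono) auto
  moreover obtain q where q: "\<sigma>\<^sup>2 = q" "0 \<le> q" by (metis zero_le_power2)
  ultimately show ?thesis
    using \<tau> t0 q(2) by (auto simp: clock_def final_width_def q(1) split: if_splits)
qed

lemma clock_closed: "\<bar>\<sigma>\<bar> \<le> final_width T \<tau> t0 \<Longrightarrow> clock \<tau> t0 \<sigma> \<in> {0..T}"
proof -
  assume "\<bar>\<sigma>\<bar> \<le> final_width T \<tau> t0"
  then have "\<bar>\<sigma>\<bar>\<^sup>2 \<le> (final_width T \<tau> t0)\<^sup>2" by (intro power_mono) auto
  moreover obtain q where q: "\<sigma>\<^sup>2 = q" "0 \<le> q" by (metis zero_le_power2)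
  ultimately show ?thesis
    using \<tau> t0 q(2) by (auto simp: clock_def final_width_def q(1) split: if_splits)
qed

lemma clock_final: "clock \<tau> t0 (final_width T \<tau> t0) = end_time T \<tau>"
  using \<tau> t0 by (auto simp: clock_def final_width_def end_time_def)

lemma DERIV_clock: "(clock \<tau> t0 has_real_derivative - \<tau> * \<sigma>) (at \<sigma>)"
  unfolding clock_def[abs_def] by (auto intro!: derivative_eq_intros)

end

definition gauss_mass :: "'d::finite itself \<Rightarrow> real" where
  "gauss_mass _ = (\<integral>z. gauss z \<partial>(lborel :: (real^'d) measure))"

text \<open>
  The common form of the representation formulas for \<open>w x0 t0\<close> and for its partial derivatives: a path
  from a multiple of the value \<open>a\<close> to zero, with speed at most a weighted Gaussian average of \<open>h\<close>. The
  bound on \<open>a\<close> is then proved once for both.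
\<close>

definition dominated_path :: "real \<Rightarrow> real \<Rightarrow> real \<Rightarrow> real^'d \<Rightarrow> (real^'d \<Rightarrow> real \<Rightarrow> real) \<Rightarrow> real \<Rightarrow> bool" where
  "dominated_path T \<tau> t0 x0 h a \<longleftrightarrow> (\<exists>\<Phi> \<Phi>'. continuous_on {0..final_width T \<tau> t0} \<Phi> \<and>
     \<Phi> 0 = gauss_mass TYPE('d) * a \<and> \<Phi> (final_width T \<tau> t0) = 0 \<and>
     (\<forall>\<sigma>. 0 < \<sigma> \<longrightarrow> \<sigma> < final_width T \<tau> t0 \<longrightarrow> (\<Phi> has_real_derivative \<Phi>' \<sigma>) (at \<sigma>) \<and>
        \<bar>\<Phi>' \<sigma>\<bar> \<le> (\<integral>z. gauss z * (norm z * h (x0 + \<sigma> *\<^sub>R z) (clock \<tau> t0 \<sigma>)) \<partial>lborel)))"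

lemma gauss_integrable: "integrable lborel (gauss :: real^'d \<Rightarrow> real)"
  using integrable_gauss_cmult_bounded[of "\<lambda>_::real^'d. 1" 1] by simp

lemma gauss_mass_pos: "gauss_mass TYPE('d::finite) > 0"
proof -
  have "(\<integral>z. gauss z \<partial>(lborel :: (real^'d) measure)) \<noteq> 0"
  proof
    assume "(\<integral>z. gauss z \<partial>(lborel :: (real^'d) measure)) = 0"
    then have "AE z in (lborel :: (real^'d) measure). gauss z = 0"
      by (subst (asm) integral_nonneg_eq_0_iff_AE) (auto intro: gauss_integrable less_imp_le gauss_pos)
    moreover have "gauss z \<noteq> 0" for z :: "real^'d" using gauss_pos[of z] by simp
    ultimately show False
      by (simp add: eventually_False ae_filter_eq_bot_iff emeasure_lborel_UNIV)
  qed
  moreover have "(\<integral>z. gauss z \<partial>(lborel :: (real^'d) measure)) \<ge> 0"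
    by (rule Bochner_Integration.integral_nonneg) (simp add: less_imp_le gauss_pos)
  ultimately show ?thesis by (simp add: gauss_mass_def)
qed

lemma borel_measurable_component [measurable]: "(\<lambda>z::real^'d. z $ j) \<in> borel_measurable borel"
  by (intro borel_measurable_continuous_onI continuous_intros)

text \<open>
  Fluxes are differentiated only in forming their divergence, hence the bound on the diagonal alone.
\<close>

definition flux :: "real \<Rightarrow> (real^'d \<Rightarrow> real \<Rightarrow> real^'d) \<Rightarrow> bool" where
  "flux T F \<longleftrightarrow> (\<forall>t\<in>{0<..<T}. periodic (\<lambda>x. F x t) \<and> (\<forall>x. (\<lambda>y. F y t) differentiable (at x)) \<and>
     (\<exists>B. \<forall>x. norm (F x t) \<le> B \<and> (\<forall>j. \<bar>Dx F x t $ j $ j\<bar> \<le> B)))"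

lemma flux_DERIV:
  assumes "flux T F" "t \<in> {0<..<T}"
  shows "((\<lambda>s. F (x + s *\<^sub>R axis j 1) t $ j) has_real_derivative Dx F x t $ j $ j) (at 0)"
proof -
  have d: "(\<lambda>y. F y t) differentiable (at x)" using assms by (auto simp: flux_def)
  show ?thesis
    using DERIV_axis[OF nabla_component(1)[OF d, of j], of j] nabla_component(2)[OF d, of j j]
    by (simp add: Dx_def)
qed

lemma flux_measurable:
  assumes "flux T F" "t \<in> {0<..<T}"
  shows "(\<lambda>x. F x t) \<in> borel_measurable borel"
proof -
  have "\<And>x. isCont (\<lambda>y. F y t) x"
    using assms by (auto simp: flux_def intro!: differentiable_imp_continuous_within)
  then show ?thesis
    by (intro borel_measurable_continuous_onI) (simp add: continuous_at_imp_continuous_on)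
qed

lemma DERIV_axis_scaled:
  fixes f :: "real^'d \<Rightarrow> real"
  assumes "((\<lambda>s. f ((x0 + \<sigma> *\<^sub>R z) + s *\<^sub>R axis i 1)) has_real_derivative d) (at 0)"
  shows "((\<lambda>s. f (x0 + \<sigma> *\<^sub>R (z + s *\<^sub>R axis i 1))) has_real_derivative \<sigma> * d) (at 0)"
proof -
  have a: "((\<lambda>s. f ((x0 + \<sigma> *\<^sub>R z) + s *\<^sub>R axis i 1)) has_real_derivative d) (at (\<sigma> * 0))"
    using assms by simp
  have m: "((\<lambda>s. \<sigma> * s) has_real_derivative \<sigma>) (at 0)" by (auto intro!: derivative_eq_intros)
  show ?thesis
    using DERIV_chain2[where f="\<lambda>s. f ((x0 + \<sigma> *\<^sub>R z) + s *\<^sub>R axis i 1)" and g="\<lambda>s. \<sigma> * s", OF a m]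
    by (simp add: algebra_simps)
qed

context
  fixes T \<tau> t0 :: real and w :: "real^'d \<Rightarrow> real \<Rightarrow> real" and x0 :: "real^'d"
  assumes w: "regular T w" and \<tau>: "\<tau> = 1 \<or> \<tau> = -1" and t0: "t0 \<in> {0<..<T}"
begin

private abbreviation "\<sigma>M \<equiv> final_width T \<tau> t0"
private abbreviation "ct \<equiv> clock \<tau> t0"

private abbreviation "pt \<sigma> z \<equiv> x0 + \<sigma> *\<^sub>R z"
private abbreviation "heat \<sigma> z \<equiv> \<tau> * Dt w (pt \<sigma> z) (ct \<sigma>) - laplacian w (pt \<sigma> z) (ct \<sigma>)"
private abbreviation "drift \<sigma> z \<equiv> z \<bullet> Dx w (pt \<sigma> z) (ct \<sigma>) - \<tau> * \<sigma> * Dt w (pt \<sigma> z) (ct \<sigma>)"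

lemma DERIV_along_clock:
  assumes \<sigma>: "\<bar>\<sigma>\<bar> < \<sigma>M"
  shows "((\<lambda>\<sigma>. w (pt \<sigma> z) (ct \<sigma>)) has_real_derivative
    drift \<sigma> z) (at \<sigma>)"
proof -
  have "((\<lambda>s. w (pt s z) (ct s)) has_real_derivative
     z \<bullet> Dx w (pt \<sigma> z) (ct \<sigma>) + Dt w (pt \<sigma> z) (ct \<sigma>) * (- \<tau> * \<sigma>)) (at \<sigma>)"
  proof (rule DERIV_diagonal[where e="\<sigma>M - \<bar>\<sigma>\<bar>" and f="\<lambda>q r. w (x0 + q *\<^sub>R z) (ct r)"
        and A="\<lambda>q r. z \<bullet> Dx w (x0 + q *\<^sub>R z) (ct r)"])
    show "\<sigma>M - \<bar>\<sigma>\<bar> > 0" using \<sigma> by simp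
    show "((\<lambda>q. w (x0 + q *\<^sub>R z) (ct r)) has_real_derivative z \<bullet> Dx w (x0 + q *\<^sub>R z) (ct r)) (at q)"
      if "\<bar>q - \<sigma>\<bar> < \<sigma>M - \<bar>\<sigma>\<bar>" "\<bar>r - \<sigma>\<bar> < \<sigma>M - \<bar>\<sigma>\<bar>" for q r
    proof -
      have r: "ct r \<in> {0<..<T}" by (rule clock_interior[OF \<tau> t0]) (use that in auto)
      have 1: "((\<lambda>y. w y (ct r)) has_derivative (\<lambda>h. h \<bullet> Dx w (x0 + q *\<^sub>R z) (ct r))) (at (x0 + q *\<^sub>R z))"
        using has_derivative_nabla[OF regular_differentiable(1)[OF w r, of "x0 + q *\<^sub>R z"]] by (simp add: Dx_def)
      have 2: "((\<lambda>q. x0 + q *\<^sub>R z) has_derivative (\<lambda>q. q *\<^sub>R z)) (at q)"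
        by (auto intro!: derivative_eq_intros)
      show ?thesis using has_derivative_compose[OF 2 1]
        by (simp add: has_field_derivative_def mult.commute[of _ "z \<bullet> _"])
    qed
    have o: "open ((UNIV :: (real^'d) set) \<times> {0<..<T})" by (intro open_Times) auto
    have c: "isCont (\<lambda>y. Dx w (fst y) (snd y)) (x0 + \<sigma> *\<^sub>R z, ct \<sigma>)"
      using regular_continuous_on(2)[OF w] clock_interior[OF \<tau> t0 \<sigma>] o by (simp add: continuous_on_eq_continuous_at)
    have c2: "isCont (\<lambda>y. (x0 + fst y *\<^sub>R z, ct (snd y))) (\<sigma>, \<sigma>)"
      unfolding clock_def by (intro continuous_intros) auto
    have "isCont (\<lambda>y. Dx w (x0 + fst y *\<^sub>R z) (ct (snd y))) (\<sigma>, \<sigma>)"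
      using isCont_o2[OF c2, of "\<lambda>y. Dx w (fst y) (snd y)"] c by simp
    then show "isCont (\<lambda>y. z \<bullet> Dx w (x0 + fst y *\<^sub>R z) (ct (snd y))) (\<sigma>, \<sigma>)"
      by (intro continuous_intros)
    show "((\<lambda>r. w (pt \<sigma> z) (ct r)) has_real_derivative Dt w (pt \<sigma> z) (ct \<sigma>) * (- \<tau> * \<sigma>)) (at \<sigma>)"
      using DERIV_chain2[OF regular_DERIV_t[OF w clock_interior[OF \<tau> t0 \<sigma>]] DERIV_clock[OF \<tau> t0]] .
  qed
  then show ?thesis by (simp add: algebra_simps)
qed

lemma measurable_slices:
  assumes t: "t \<in> {0<..<T}"
  shows "(\<lambda>z. w (pt \<sigma> z) t) \<in> borel_measurable borel"
    "(\<lambda>z. Dx w (pt \<sigma> z) t $ j) \<in> borel_measurable borel"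
    "(\<lambda>z. Dx (Dx w) (pt \<sigma> z) t $ j $ k) \<in> borel_measurable borel"
    "(\<lambda>z. Dt w (pt \<sigma> z) t) \<in> borel_measurable borel"
    "(\<lambda>z. laplacian w (pt \<sigma> z) t) \<in> borel_measurable borel"
proof -
  have t': "t \<in> {0..T}" using t by auto
  note c = regular_continuous_slice(1)[OF w t'] regular_continuous_slice(2-)[OF w t]
  have a: "continuous_on UNIV (\<lambda>z. x0 + \<sigma> *\<^sub>R z)" by (intro continuous_intros)
  show "(\<lambda>z. w (pt \<sigma> z) t) \<in> borel_measurable borel"
    by (intro borel_measurable_continuous_onI continuous_on_compose2[OF c(1) a]) auto
  show "(\<lambda>z. Dx w (pt \<sigma> z) t $ j) \<in> borel_measurable borel"
    by (intro borel_measurable_continuous_onI continuous_intros continuous_on_compose2[OF c(2) a]) auto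
  have 3: "(\<lambda>z. Dx (Dx w) (pt \<sigma> z) t $ j $ k) \<in> borel_measurable borel" for j k
    by (intro borel_measurable_continuous_onI continuous_intros continuous_on_compose2[OF c(3) a]) auto
  then show "(\<lambda>z. Dx (Dx w) (pt \<sigma> z) t $ j $ k) \<in> borel_measurable borel" .
  show "(\<lambda>z. Dt w (pt \<sigma> z) t) \<in> borel_measurable borel"
    by (intro borel_measurable_continuous_onI continuous_on_compose2[OF c(4) a]) auto
  show "(\<lambda>z. laplacian w (pt \<sigma> z) t) \<in> borel_measurable borel"
    unfolding laplacian_def divergence_def trace_def by (intro borel_measurable_sum 3)
qed

text \<open>
  In the variable \<open>z\<close> the weight does not depend on \<open>\<sigma>\<close>, so the derivative falls on \<open>w\<close> alone and is
  dominated by a polynomial in \<open>z\<close>.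
\<close>

lemma weighted_average_derivative:
  assumes Pm: "P \<in> borel_measurable borel" and P: "\<And>z::real^'d. \<bar>P z\<bar> \<le> 1 + norm z"
    and \<sigma>: "\<bar>\<sigma>\<bar> < \<sigma>M"
  shows "((\<lambda>\<sigma>. \<integral>z. gauss z * (P z * w (pt \<sigma> z) (ct \<sigma>)) \<partial>lborel) has_real_derivative
    (\<integral>z. gauss z * (P z * (drift \<sigma> z)) \<partial>lborel)) (at \<sigma>)"
proof -
  note [measurable] = Pm
  obtain B where B: "B \<ge> 0" "\<And>x t. t \<in> {0..T} \<Longrightarrow> 0 < T \<Longrightarrow> \<bar>w x t\<bar> \<le> B"
    "\<And>x t. t \<in> {0<..<T} \<Longrightarrow> norm (Dx w x t) \<le> B"
    "\<And>x t. t \<in> {0<..<T} \<Longrightarrow> norm (Dx (Dx w) x t) \<le> B"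
    "\<And>x t. t \<in> {0<..<T} \<Longrightarrow> \<bar>Dt w x t\<bar> \<le> B"
    using regular_bounded[OF w] by blast
  let ?C = "B * (1 + \<sigma>M)"
  let ?F' = "\<lambda>\<sigma> z. gauss z * (P z * (drift \<sigma> z))"
  have t: "ct r \<in> {0<..<T}" "ct r \<in> {0..T}" "0 < T" if "-\<sigma>M < r" "r < \<sigma>M" for r
    using clock_interior[OF \<tau> t0, of r] clock_closed[OF \<tau> t0, of r] t0 that by auto
  show ?thesis
  proof (rule has_derivative_under_integral(1)[where a="-\<sigma>M" and b=\<sigma>M and W="\<lambda>z. gauss z * (?C * (1 + norm z)^2)"])
    show "-\<sigma>M < \<sigma>" "\<sigma> < \<sigma>M" using \<sigma> by auto
    show "integrable lborel (\<lambda>z. gauss z * (P z * w (pt r z) (ct r)))" if r: "-\<sigma>M < r" "r < \<sigma>M" for r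
    proof (rule integrable_gauss_cmult_bounded[of _ B])
      show "(\<lambda>z. P z * w (pt r z) (ct r)) \<in> borel_measurable borel"
        using measurable_slices(1)[OF t(1)[OF r]] by measurable
      show "\<bar>P z * w (pt r z) (ct r)\<bar> \<le> B * (1 + norm z)" for z
        unfolding abs_mult mult.commute[of B] using P B(2)[OF t(2,3)[OF r]] by (intro mult_mono) auto
    qed (rule B)
    show "integrable lborel (\<lambda>z::real^'d. gauss z * (?C * (1 + norm z)^2))"
    proof (rule integrable_gauss_weight[of _ ?C])
      show "\<bar>?C * (1 + norm z)\<^sup>2\<bar> \<le> ?C * (1 + norm z) ^ 3" for z :: "real^'d"
        using B(1) final_width_pos[OF \<tau> t0] by (auto simp: abs_mult intro!: mult_left_mono power_increasing)
    qed measurable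
    fix r z assume r: "-\<sigma>M < r" "r < \<sigma>M"
    then have r': "\<bar>r\<bar> < \<sigma>M" by auto
    show "((\<lambda>\<sigma>. gauss z * (P z * w (pt \<sigma> z) (ct \<sigma>))) has_real_derivative ?F' r z) (at r)"
      by (intro DERIV_cmult DERIV_along_clock r')
    show "\<bar>?F' r z\<bar> \<le> gauss z * (?C * (1 + norm z)^2)"
    proof -
      have "\<bar>z \<bullet> Dx w (pt r z) (ct r)\<bar> \<le> norm z * B"
        by (intro order_trans[OF Cauchy_Schwarz_ineq2] mult_left_mono B(3) t r) auto
      moreover have "\<bar>\<tau> * r * Dt w (pt r z) (ct r)\<bar> \<le> \<sigma>M * B"
        unfolding abs_mult using \<tau> r' by (intro mult_mono B(5) t r) auto
      ultimately have "\<bar>drift r z\<bar> \<le> norm z * B + \<sigma>M * B"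
        by linarith
      also have "\<dots> \<le> ?C * (1 + norm z)"
        using B(1) final_width_pos[OF \<tau> t0] by (simp add: algebra_simps)
      finally have "\<bar>P z * (drift r z)\<bar>
          \<le> (1 + norm z) * (?C * (1 + norm z))"
        unfolding abs_mult by (intro mult_mono P) auto
      then show ?thesis
        using gauss_pos[of z] by (simp add: abs_mult power2_eq_square mult_ac)
    qed
  qed
qed

text \<open>
  The factor \<open>z_j\<close> of the drift is absorbed by the Gaussian at the price of a derivative, which either
  hits \<open>Dw\<close> and yields \<open>\<sigma>\<close> times the Laplacian, or hits the weight \<open>P\<close>.
\<close>

lemma weighted_integration_by_parts:
  fixes P :: "real^'d \<Rightarrow> real" and P' :: "'d \<Rightarrow> real^'d \<Rightarrow> real"
  assumes Pm: "P \<in> borel_measurable borel" "\<And>j. P' j \<in> borel_measurable borel"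
    and P: "\<And>z. \<bar>P z\<bar> \<le> 1 + norm z" and P': "\<And>j z. \<bar>P' j z\<bar> \<le> 1"
    and dP: "\<And>j x. ((\<lambda>s. P (x + s *\<^sub>R axis j 1)) has_real_derivative P' j x) (at 0)"
    and \<sigma>: "\<bar>\<sigma>\<bar> < \<sigma>M"
  shows "(\<integral>z. gauss z * (P z * (drift \<sigma> z)) \<partial>lborel)
    = (\<Sum>j\<in>UNIV. \<integral>z. gauss z * (P' j z * Dx w (pt \<sigma> z) (ct \<sigma>) $ j) \<partial>lborel)
     - \<sigma> * (\<integral>z. gauss z * (P z * (heat \<sigma> z)) \<partial>lborel)"
proof -
  note [measurable] = Pm
  have t: "ct \<sigma> \<in> {0<..<T}" by (rule clock_interior[OF \<tau> t0 \<sigma>])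
  note [measurable] = measurable_slices[OF t] 
  obtain B where B: "B \<ge> 0" "\<And>x t. t \<in> {0<..<T} \<Longrightarrow> norm (Dx w x t) \<le> B"
    "\<And>x t. t \<in> {0<..<T} \<Longrightarrow> norm (Dx (Dx w) x t) \<le> B"
    "\<And>x t. t \<in> {0<..<T} \<Longrightarrow> \<bar>Dt w x t\<bar> \<le> B"
    by (rule regular_bounded[OF w]) simp
   have b1: "\<bar>Dx w x (ct \<sigma>) $ j\<bar> \<le> B" for x j
    using order_trans[OF component_le_norm_cart B(2)[OF t, of x]] by blast
   have b2: "\<bar>Dx (Dx w) x (ct \<sigma>) $ j $ j\<bar> \<le> B" for x j
    using order_trans[OF component_le_norm_cart[of "Dx (Dx w) x (ct \<sigma>) $ j" j] Finite_Cartesian_Product.norm_nth_le[of "Dx (Dx w) x (ct \<sigma>)" j]] B(3)[OF t, of x] by simp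
   have b2': "\<bar>\<sigma> * Dx (Dx w) x (ct \<sigma>) $ j $ j\<bar> \<le> \<bar>\<sigma>\<bar> * B" for x j
    unfolding abs_mult by (intro mult_left_mono b2) auto
  let ?g = "\<lambda>j z. Dx w (pt \<sigma> z) (ct \<sigma>) $ j" and ?h = "\<lambda>j z. Dx (Dx w) (pt \<sigma> z) (ct \<sigma>) $ j $ j"
  have dg: "((\<lambda>s. ?g j (z + s *\<^sub>R axis j 1)) has_real_derivative \<sigma> * ?h j z) (at 0)" for j z
    by (rule DERIV_axis_scaled[where f="\<lambda>y. Dx w y (ct \<sigma>) $ j", OF regular_DERIV_x(2)[OF w t]])
  have ibp: "integrable lborel (\<lambda>z. gauss z * (P z * (\<sigma> * ?h j z)))"
    "(\<integral>z. gauss z * (P z * z $ j * ?g j z) \<partial>lborel) =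
       (\<integral>z. gauss z * (P' j z * ?g j z) \<partial>lborel) + (\<integral>z. gauss z * (P z * (\<sigma> * ?h j z)) \<partial>lborel)" for j
  proof -
    have bb: "\<bar>?g j x\<bar> \<le> max B (\<bar>\<sigma>\<bar> * B)" "\<bar>\<sigma> * ?h j x\<bar> \<le> max B (\<bar>\<sigma>\<bar> * B)" for x
      using b1[of "x0 + \<sigma> *\<^sub>R x" j] b2'[of "x0 + \<sigma> *\<^sub>R x" j] by linarith+
    note I = gauss_integration_by_parts[of "?g j" P "P' j" "max B (\<bar>\<sigma>\<bar> * B)" "\<lambda>z. \<sigma> * ?h j z" j,
       OF measurable_slices(2)[OF t] Pm(1) Pm(2) bb P P' dg dP]
    show "integrable lborel (\<lambda>z. gauss z * (P z * (\<sigma> * ?h j z)))"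
      by (rule I(1))
    show "(\<integral>z. gauss z * (P z * z $ j * ?g j z) \<partial>lborel) =
       (\<integral>z. gauss z * (P' j z * ?g j z) \<partial>lborel) + (\<integral>z. gauss z * (P z * (\<sigma> * ?h j z)) \<partial>lborel)"
      by (rule I(2))
  qed
  have [measurable]: "(\<lambda>z::real^'d. z $ j) \<in> borel_measurable borel" for j
    by (intro borel_measurable_continuous_onI continuous_intros)
  have i1: "integrable lborel (\<lambda>z. gauss z * (P z * z $ j * ?g j z))" for j
  proof (rule integrable_gauss_weight[of _ B])
    fix z
    have "\<bar>P z * z $ j * ?g j z\<bar> \<le> (1 + norm z) * (1 + norm z) * B"
      unfolding abs_mult using P[of z] component_le_norm_cart[of z j] b1
      by (intro mult_mono) auto
    also have "\<dots> = B * (1 + norm z)^2" by (simp add: power2_eq_square)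
    also have "\<dots> \<le> B * (1 + norm z)^3" using B(1) by (intro mult_left_mono power_increasing) auto
    finally show "\<bar>P z * z $ j * ?g j z\<bar> \<le> B * (1 + norm z)^3" .
  qed measurable
  have i2: "integrable lborel (\<lambda>z. gauss z * (P z * (\<tau> * \<sigma> * Dt w (pt \<sigma> z) (ct \<sigma>))))"
  proof (rule integrable_gauss_cmult_bounded[of _ "\<bar>\<sigma>\<bar> * B"])
    fix z
    have "\<bar>\<tau> * \<sigma> * Dt w (pt \<sigma> z) (ct \<sigma>)\<bar> \<le> \<bar>\<sigma>\<bar> * B"
    proof -
      have "\<bar>\<tau>\<bar> = 1" using \<tau> by auto
      moreover have "\<bar>\<sigma>\<bar> * \<bar>Dt w (pt \<sigma> z) (ct \<sigma>)\<bar> \<le> \<bar>\<sigma>\<bar> * B"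
        by (intro mult_left_mono B(4)[OF t]) auto
      ultimately show ?thesis by (simp add: abs_mult)
    qed
    then show "\<bar>P z * (\<tau> * \<sigma> * Dt w (pt \<sigma> z) (ct \<sigma>))\<bar> \<le> \<bar>\<sigma>\<bar> * B * (1 + norm z)"
      unfolding abs_mult[of "P z"] mult.commute[of _ "1 + norm z"] using P by (intro mult_mono) auto
  qed (use B in auto)
  have "(\<integral>z. gauss z * (P z * (drift \<sigma> z)) \<partial>lborel)
     = (\<integral>z. (\<Sum>j\<in>UNIV. gauss z * (P z * z $ j * ?g j z)) - gauss z * (P z * (\<tau> * \<sigma> * Dt w (pt \<sigma> z) (ct \<sigma>))) \<partial>lborel)"
  proof (intro Bochner_Integration.integral_cong refl)
    fix z
    have "(\<Sum>j\<in>UNIV. gauss z * (P z * z $ j * ?g j z)) = gauss z * (P z * (z \<bullet> Dx w (pt \<sigma> z) (ct \<sigma>)))"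
      by (simp add: inner_vec_def sum_distrib_left mult.assoc)
    then show "gauss z * (P z * (drift \<sigma> z)) =
      (\<Sum>j\<in>UNIV. gauss z * (P z * z $ j * ?g j z)) - gauss z * (P z * (\<tau> * \<sigma> * Dt w (pt \<sigma> z) (ct \<sigma>)))"
      by (simp only: right_diff_distrib)
  qed
  also have "\<dots> = (\<Sum>j\<in>UNIV. \<integral>z. gauss z * (P z * z $ j * ?g j z) \<partial>lborel)
      - (\<integral>z. gauss z * (P z * (\<tau> * \<sigma> * Dt w (pt \<sigma> z) (ct \<sigma>))) \<partial>lborel)"
    using i1 i2 by (simp add: Bochner_Integration.integral_diff Bochner_Integration.integral_sum)
  also have "(\<Sum>j\<in>UNIV. \<integral>z. gauss z * (P z * z $ j * ?g j z) \<partial>lborel) =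
     (\<Sum>j\<in>UNIV. \<integral>z. gauss z * (P' j z * ?g j z) \<partial>lborel) + (\<Sum>j\<in>UNIV. \<integral>z. gauss z * (P z * (\<sigma> * ?h j z)) \<partial>lborel)"
    by (simp add: ibp(2) sum.distrib)
  also have "(\<Sum>j\<in>UNIV. \<integral>z. gauss z * (P z * (\<sigma> * ?h j z)) \<partial>lborel) =
      (\<integral>z. (\<Sum>j\<in>UNIV. gauss z * (P z * (\<sigma> * ?h j z))) \<partial>lborel)"
    by (rule Bochner_Integration.integral_sum[symmetric]) (rule ibp)
  finally have eq: "(\<integral>z. gauss z * (P z * (drift \<sigma> z)) \<partial>lborel)
    = (\<Sum>j\<in>UNIV. \<integral>z. gauss z * (P' j z * ?g j z) \<partial>lborel) +
     ((\<integral>z. (\<Sum>j\<in>UNIV. gauss z * (P z * (\<sigma> * ?h j z))) \<partial>lborel)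
      - (\<integral>z. gauss z * (P z * (\<tau> * \<sigma> * Dt w (pt \<sigma> z) (ct \<sigma>))) \<partial>lborel))" by simp
  have "(\<integral>z. (\<Sum>j\<in>UNIV. gauss z * (P z * (\<sigma> * ?h j z))) \<partial>lborel)
      - (\<integral>z. gauss z * (P z * (\<tau> * \<sigma> * Dt w (pt \<sigma> z) (ct \<sigma>))) \<partial>lborel)
     = (\<integral>z. (\<Sum>j\<in>UNIV. gauss z * (P z * (\<sigma> * ?h j z))) - gauss z * (P z * (\<tau> * \<sigma> * Dt w (pt \<sigma> z) (ct \<sigma>))) \<partial>lborel)"
    by (rule Bochner_Integration.integral_diff[symmetric, OF Bochner_Integration.integrable_sum[OF ibp(1)] i2])
  also have "\<dots> = (\<integral>z. (- \<sigma>) * (gauss z * (P z * (heat \<sigma> z))) \<partial>lborel)"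
  proof (intro Bochner_Integration.integral_cong refl)
    fix z
    have "(\<Sum>j\<in>UNIV. gauss z * (P z * (\<sigma> * ?h j z))) = gauss z * (P z * (\<sigma> * laplacian w (pt \<sigma> z) (ct \<sigma>)))"
      by (simp add: laplacian_def divergence_def trace_def sum_distrib_left)
    then show "(\<Sum>j\<in>UNIV. gauss z * (P z * (\<sigma> * ?h j z))) - gauss z * (P z * (\<tau> * \<sigma> * Dt w (pt \<sigma> z) (ct \<sigma>))) =
       (- \<sigma>) * (gauss z * (P z * (heat \<sigma> z)))"
      by (simp only:) (simp add: algebra_simps)
  qed
  also have "\<dots> = - \<sigma> * (\<integral>z. gauss z * (P z * (heat \<sigma> z)) \<partial>lborel)"
    by (rule integral_mult_right_zero)
  finally show ?thesis unfolding eq by simp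
qed

context
  assumes w0: "\<And>x. w x (end_time T \<tau>) = 0"
begin

private lemmas facts = final_width_pos[OF \<tau> t0] clock_interior[OF \<tau> t0] clock_closed[OF \<tau> t0] clock_final[OF \<tau> t0]

lemma clock_0: "ct 0 = t0" by (simp add: clock_def)

lemma weighted_average_continuous:
  assumes Pm: "P \<in> borel_measurable borel" and P: "\<And>z::real^'d. \<bar>P z\<bar> \<le> 1 + norm z"
  shows "continuous_on {0..\<sigma>M} (\<lambda>\<sigma>. \<integral>z. gauss z * (P z * w (pt \<sigma> z) (ct \<sigma>)) \<partial>lborel)"
proof -
  note [measurable] = Pm
  obtain B where B: "B \<ge> 0" "\<And>x t. t \<in> {0..T} \<Longrightarrow> 0 < T \<Longrightarrow> \<bar>w x t\<bar> \<le> B"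
    using regular_bounded[OF w] by metis
  have t: "ct r \<in> {0..T}" "0 < T" if "r \<in> {0..\<sigma>M}" for r
    using facts(3)[of r] t0 that by auto
  show ?thesis
  proof (rule continuous_on_integral_dominated[where W="\<lambda>z. gauss z * (B * (1 + norm z))"])
    show "(\<lambda>z. gauss z * (P z * w (pt s z) (ct s))) \<in> borel_measurable lborel" if s: "s \<in> {0..\<sigma>M}" for s
    proof -
      have "continuous_on UNIV (\<lambda>z. w (pt s z) (ct s))"
        by (rule continuous_on_compose2[OF regular_continuous_slice(1)[OF w t(1)[OF s]]]) (auto intro!: continuous_intros)
      from borel_measurable_continuous_onI[OF this] show ?thesis by measurable
    qed
    show "integrable lborel (\<lambda>z::real^'d. gauss z * (B * (1 + norm z)))"
      by (rule integrable_gauss_cmult_bounded[of _ B]) (use B in \<open>auto simp: abs_mult\<close>)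
    show "\<bar>gauss z * (P z * w (pt s z) (ct s))\<bar> \<le> gauss z * (B * (1 + norm z))" if s: "s \<in> {0..\<sigma>M}" for s z
    proof -
      have "\<bar>P z * w (pt s z) (ct s)\<bar> \<le> (1 + norm z) * B"
        unfolding abs_mult using P B(2)[OF t[OF s]] by (intro mult_mono) auto
      then show ?thesis using gauss_pos[of z] by (simp add: abs_mult mult.commute[of B])
    qed
    show "continuous_on {0..\<sigma>M} (\<lambda>s. gauss z * (P z * w (pt s z) (ct s)))" for z
    proof (intro continuous_intros)
      have "continuous_on {0..\<sigma>M} (\<lambda>s. (x0 + s *\<^sub>R z, ct s))"
        unfolding clock_def by (intro continuous_intros) auto
      moreover have "(\<lambda>s. (x0 + s *\<^sub>R z, ct s)) ` {0..\<sigma>M} \<subseteq> UNIV \<times> {0..T}" using t(1) by auto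
      ultimately show "continuous_on {0..\<sigma>M} (\<lambda>s. w (pt s z) (ct s))"
        using continuous_on_compose2[OF regular_continuous_on(1)[OF w]] by fastforce
    qed
  qed
qed

text \<open>
  The constant weight: the average changes only as far as \<open>w\<close> fails to solve the heat equation, and at the
  final width it averages the end values of \<open>w\<close>.
\<close>

lemma heat_value:
  obtains \<Phi> where "continuous_on {0..\<sigma>M} \<Phi>" "\<Phi> 0 = gauss_mass TYPE('d) * w x0 t0" "\<Phi> \<sigma>M = 0"
    "\<And>\<sigma>. 0 < \<sigma> \<Longrightarrow> \<sigma> < \<sigma>M \<Longrightarrow> (\<Phi> has_real_derivative
       - \<sigma> * (\<integral>z. gauss z * (heat \<sigma> z) \<partial>lborel)) (at \<sigma>)"
proof
  let ?\<Phi> = "\<lambda>\<sigma>. \<integral>z. gauss z * (1 * w (pt \<sigma> z) (ct \<sigma>)) \<partial>lborel"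
  show "continuous_on {0..\<sigma>M} ?\<Phi>" by (rule weighted_average_continuous) auto
  show "?\<Phi> 0 = gauss_mass TYPE('d) * w x0 t0"
    by (simp add: clock_0 gauss_mass_def)
  show "?\<Phi> \<sigma>M = 0" by (simp add: facts(4) w0)
  fix \<sigma> assume "0 < \<sigma>" "\<sigma> < \<sigma>M"
  then have \<sigma>: "\<bar>\<sigma>\<bar> < \<sigma>M" by simp
  show "(?\<Phi> has_real_derivative
       - \<sigma> * (\<integral>z. gauss z * (heat \<sigma> z) \<partial>lborel)) (at \<sigma>)"
    using weighted_average_derivative[OF _ _ \<sigma>, of "\<lambda>_. 1"]
      weighted_integration_by_parts[OF _ _ _ _ _ \<sigma>, of "\<lambda>_. 1" "\<lambda>_ _. 0"] by simp
qed

text \<open>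
  The weight \<open>z_i / \<sigma>\<close>: the resulting average is that of \<open>\<partial>_i w\<close>, which gives the limit at width zero. The
  extra term from the derivative of the weight cancels against the derivative of \<open>1 / \<sigma>\<close>, and the factor
  \<open>\<sigma>\<close> in front of the heat operator cancels against \<open>1 / \<sigma>\<close>.
\<close>

lemma heat_gradient:
  obtains \<Phi> where "continuous_on {0..\<sigma>M} \<Phi>" "\<Phi> 0 = gauss_mass TYPE('d) * Dx w x0 t0 $ i" "\<Phi> \<sigma>M = 0"
    "\<And>\<sigma>. 0 < \<sigma> \<Longrightarrow> \<sigma> < \<sigma>M \<Longrightarrow> (\<Phi> has_real_derivative
       - (\<integral>z. gauss z * (z $ i * (heat \<sigma> z)) \<partial>lborel)) (at \<sigma>)"
proof
  let ?\<Theta> = "\<lambda>\<sigma>. \<integral>z. gauss z * (z $ i * w (pt \<sigma> z) (ct \<sigma>)) \<partial>lborel"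
  let ?D = "\<lambda>\<sigma>. \<integral>z. gauss z * Dx w (pt \<sigma> z) (ct \<sigma>) $ i \<partial>lborel"
  let ?\<Phi> = "\<lambda>\<sigma>. if \<sigma> = 0 then ?D 0 else ?\<Theta> \<sigma> / \<sigma>"
  let ?H = "\<lambda>\<sigma>. \<integral>z. gauss z * (z $ i * (heat \<sigma> z)) \<partial>lborel"
  have zi: "\<bar>z $ i\<bar> \<le> 1 + norm z" for z :: "real^'d"
    using component_le_norm_cart[of z i] by linarith
  have dzi: "((\<lambda>s. (x + s *\<^sub>R axis j 1) $ i) has_real_derivative (if j = i then 1 else 0)) (at 0)" for x :: "real^'d" and j
    by (auto simp: axis_def intro!: derivative_eq_intros)
  obtain B where B: "B \<ge> 0" "\<And>x t. t \<in> {0..T} \<Longrightarrow> 0 < T \<Longrightarrow> \<bar>w x t\<bar> \<le> B"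
    "\<And>x t. t \<in> {0<..<T} \<Longrightarrow> norm (Dx w x t) \<le> B"
    "\<And>x t. t \<in> {0<..<T} \<Longrightarrow> norm (Dx (Dx w) x t) \<le> B"
    "\<And>x t. t \<in> {0<..<T} \<Longrightarrow> \<bar>Dt w x t\<bar> \<le> B"
    using regular_bounded[OF w] by blast
  have b1: "\<bar>Dx w x t $ i\<bar> \<le> B" if "t \<in> {0<..<T}" for x t
    using order_trans[OF component_le_norm_cart B(3)[OF that, of x]] by blast
  have \<Theta>D: "?\<Theta> \<sigma> = \<sigma> * ?D \<sigma>" if "0 \<le> \<sigma>" "\<sigma> < \<sigma>M" for \<sigma>
  proof -
    have t: "ct \<sigma> \<in> {0<..<T}" "ct \<sigma> \<in> {0..T}" "0 < T" using facts(2,3)[of \<sigma>] that t0 by auto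
    have dw: "((\<lambda>s. w (x0 + \<sigma> *\<^sub>R (z + s *\<^sub>R axis i 1)) (ct \<sigma>)) has_real_derivative \<sigma> * Dx w (pt \<sigma> z) (ct \<sigma>) $ i) (at 0)" for z
      by (rule DERIV_axis_scaled[where f="\<lambda>y. w y (ct \<sigma>)", OF regular_DERIV_x(1)[OF w t(1)]])
    have bw: "\<bar>w (pt \<sigma> z) (ct \<sigma>)\<bar> \<le> max B (\<bar>\<sigma>\<bar> * B)" for z
      using B(2)[OF t(2,3), of "pt \<sigma> z"] by linarith
    have bdw: "\<bar>\<sigma> * Dx w (pt \<sigma> z) (ct \<sigma>) $ i\<bar> \<le> max B (\<bar>\<sigma>\<bar> * B)" for z
      using mult_left_mono[OF b1[OF t(1), of "pt \<sigma> z"], of "\<bar>\<sigma>\<bar>"] by (simp add: abs_mult)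
    note I = gauss_integration_by_parts(2)[of "\<lambda>z. w (pt \<sigma> z) (ct \<sigma>)" "\<lambda>_. 1" "\<lambda>_. 0" "max B (\<bar>\<sigma>\<bar> * B)"
        "\<lambda>z. \<sigma> * Dx w (pt \<sigma> z) (ct \<sigma>) $ i" i, OF measurable_slices(1)[OF t(1)] _ _ bw bdw _ _ dw]
    have "?\<Theta> \<sigma> = (\<integral>z. \<sigma> * (gauss z * Dx w (pt \<sigma> z) (ct \<sigma>) $ i) \<partial>lborel)"
      using I by (simp add: mult.left_commute)
    then show ?thesis by simp
  qed
  have contD: "continuous_on {0..<\<sigma>M} ?D"
  proof (rule continuous_on_integral_dominated[where W="\<lambda>z. gauss z * (B * (1 + norm z))"])
    show "integrable lborel (\<lambda>z::real^'d. gauss z * (B * (1 + norm z)))"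
      by (rule integrable_gauss_cmult_bounded[of _ B]) (use B in \<open>auto simp: abs_mult\<close>)
    fix s and z :: "real^'d" assume s: "s \<in> {0..<\<sigma>M}"
    then have t: "ct s \<in> {0<..<T}" using facts(2)[of s] by auto
    show "(\<lambda>z. gauss z * Dx w (pt s z) (ct s) $ i) \<in> borel_measurable lborel"
      using measurable_slices(2)[OF t] by measurable
    have "B * 1 \<le> B * (1 + norm z)" using B(1) by (intro mult_left_mono) auto
    with b1[OF t, of "x0 + s *\<^sub>R z"] have "\<bar>Dx w (pt s z) (ct s) $ i\<bar> \<le> B * (1 + norm z)" by simp
    then show "\<bar>gauss z * Dx w (pt s z) (ct s) $ i\<bar> \<le> gauss z * (B * (1 + norm z))"
      using gauss_pos[of z] by (simp add: abs_mult)
  next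
    fix z :: "real^'d"
    show "continuous_on {0..<\<sigma>M} (\<lambda>s. gauss z * Dx w (pt s z) (ct s) $ i)"
    proof (intro continuous_intros)
      have c: "continuous_on {0..<\<sigma>M} (\<lambda>s. (x0 + s *\<^sub>R z, ct s))"
        unfolding clock_def by (intro continuous_intros) auto
      have "(\<lambda>s. (x0 + s *\<^sub>R z, ct s)) ` {0..<\<sigma>M} \<subseteq> UNIV \<times> {0<..<T}" using facts(2) by auto
      from continuous_on_compose2[OF regular_continuous_on(2)[OF w] c this]
      show "continuous_on {0..<\<sigma>M} (\<lambda>s. Dx w (pt s z) (ct s))" by simp
    qed
  qed
  have cont\<Theta>: "continuous_on {0..\<sigma>M} ?\<Theta>"
    by (rule weighted_average_continuous) (auto intro: zi)
  \<comment> \<open>Near width zero \<open>?\<Phi>\<close> is the average \<open>?D\<close>, near the final width it is the quotient; neither formula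
    covers both ends.\<close>
  have "continuous_on {0<..\<sigma>M} ?\<Phi>"
  proof -
    have "continuous_on {0<..\<sigma>M} (\<lambda>\<sigma>. ?\<Theta> \<sigma> / \<sigma>)"
      by (intro continuous_on_divide continuous_on_subset[OF cont\<Theta>] continuous_intros) auto
    then show ?thesis by (rule continuous_on_eq) auto
  qed
  moreover have "continuous_on {0..<\<sigma>M} ?\<Phi>"
    by (rule continuous_on_eq[OF contD]) (auto simp: \<Theta>D)
  ultimately have "continuous_on ({0..<\<sigma>M} \<union> {0<..\<sigma>M}) ?\<Phi>"
  proof (intro continuous_on_Un_local_open)
    show "openin (top_of_set ({0..<\<sigma>M} \<union> {0<..\<sigma>M})) {0..<\<sigma>M}"
      unfolding openin_open by (intro exI[of _ "{..<\<sigma>M}"]) (auto simp: facts(1))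
    show "openin (top_of_set ({0..<\<sigma>M} \<union> {0<..\<sigma>M})) {0<..\<sigma>M}"
      unfolding openin_open by (intro exI[of _ "{0<..}"]) (auto simp: facts(1))
  qed
  moreover have "{0..<\<sigma>M} \<union> {0<..\<sigma>M} = {0..\<sigma>M}" using facts(1) by auto
  ultimately show "continuous_on {0..\<sigma>M} ?\<Phi>" by simp
  show "?\<Phi> 0 = gauss_mass TYPE('d) * Dx w x0 t0 $ i" by (simp add: clock_0 gauss_mass_def)
  show "?\<Phi> \<sigma>M = 0" using facts(1) by (simp add: facts(4) w0)
  fix \<sigma> assume s: "0 < \<sigma>" "\<sigma> < \<sigma>M"
  then have \<sigma>: "\<bar>\<sigma>\<bar> < \<sigma>M" by simp
  have "(\<Sum>j\<in>UNIV. \<integral>z. gauss z * ((if j = i then 1 else 0) * Dx w (pt \<sigma> z) (ct \<sigma>) $ j) \<partial>lborel)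
     = (\<Sum>j\<in>UNIV. if j = i then ?D \<sigma> else 0)"
    by (intro sum.cong) auto
  then have sum: "(\<Sum>j\<in>UNIV. \<integral>z. gauss z * ((if j = i then 1 else 0) * Dx w (pt \<sigma> z) (ct \<sigma>) $ j) \<partial>lborel) = ?D \<sigma>"
    by simp
  have "(?\<Theta> has_real_derivative ?D \<sigma> - \<sigma> * ?H \<sigma>) (at \<sigma>)"
    using weighted_average_derivative[OF borel_measurable_component zi \<sigma>]
    by (subst (asm) weighted_integration_by_parts[OF borel_measurable_component _ zi _ dzi \<sigma>]) (auto simp: sum)
  then have "((\<lambda>\<sigma>. ?\<Theta> \<sigma> / \<sigma>) has_real_derivative ((?D \<sigma> - \<sigma> * ?H \<sigma>) * \<sigma> - ?\<Theta> \<sigma> * 1) / (\<sigma> * \<sigma>)) (at \<sigma>)"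
    using s by (intro DERIV_divide DERIV_ident) auto
  also have "((?D \<sigma> - \<sigma> * ?H \<sigma>) * \<sigma> - ?\<Theta> \<sigma> * 1) / (\<sigma> * \<sigma>) = - ?H \<sigma>"
    using s by (simp add: \<Theta>D field_simps)
  finally show "(?\<Phi> has_real_derivative - ?H \<sigma>) (at \<sigma>)"
    by (rule has_field_derivative_transform_within[where d=\<sigma>]) (use s in \<open>auto simp: dist_real_def\<close>)
qed

private lemma integrable_norm_h:
  fixes h :: "real^'d \<Rightarrow> real \<Rightarrow> real"
  assumes hm: "(\<lambda>x. h x t) \<in> borel_measurable borel" and hb: "\<And>x. \<bar>h x t\<bar> \<le> Bh"
  shows "integrable lborel (\<lambda>z. gauss z * (norm z * h (pt \<sigma> z) t))"
proof (rule integrable_gauss_cmult_bounded[of _ Bh])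
  note [measurable] = measurable_compose[OF _ hm]
  show "(\<lambda>z. norm z * h (pt \<sigma> z) t) \<in> borel_measurable borel" by measurable
  show "Bh \<ge> 0" using order_trans[OF abs_ge_zero hb] .
  show "\<bar>norm z * h (pt \<sigma> z) t\<bar> \<le> Bh * (1 + norm z)" for z
    unfolding abs_mult mult.commute[of Bh] using hb by (intro mult_mono) auto
qed

lemma dominated_path_gradient:
  assumes h: "\<And>x t. t \<in> {0<..<T} \<Longrightarrow> \<bar>\<tau> * Dt w x t - laplacian w x t\<bar> \<le> h x t"
    and hm: "\<And>t. t \<in> {0<..<T} \<Longrightarrow> (\<lambda>x. h x t) \<in> borel_measurable borel"
    and hb: "\<And>x t. t \<in> {0<..<T} \<Longrightarrow> \<bar>h x t\<bar> \<le> Bh"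
  shows "dominated_path T \<tau> t0 x0 h (Dx w x0 t0 $ i)"
proof -
  let ?H = "\<lambda>\<sigma>. \<integral>z. gauss z * (z $ i * (heat \<sigma> z)) \<partial>lborel"
  obtain \<Phi> where \<Phi>: "continuous_on {0..\<sigma>M} \<Phi>" "\<Phi> 0 = gauss_mass TYPE('d) * Dx w x0 t0 $ i" "\<Phi> \<sigma>M = 0"
    "\<And>\<sigma>. 0 < \<sigma> \<Longrightarrow> \<sigma> < \<sigma>M \<Longrightarrow> (\<Phi> has_real_derivative - ?H \<sigma>) (at \<sigma>)"
    by (rule heat_gradient[of i]) (rule that)
  have "\<bar>- ?H \<sigma>\<bar> \<le> (\<integral>z. gauss z * (norm z * h (pt \<sigma> z) (ct \<sigma>)) \<partial>lborel)"
    if "0 < \<sigma>" "\<sigma> < \<sigma>M" for \<sigma>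
  proof -
    have t: "ct \<sigma> \<in> {0<..<T}" using facts(2)[of \<sigma>] that by simp
    have "norm (?H \<sigma>) \<le> (\<integral>z. gauss z * (norm z * h (pt \<sigma> z) (ct \<sigma>)) \<partial>lborel)"
    proof (rule Bochner_Integration.integral_norm_bound_integral[OF _ integrable_norm_h[where Bh=Bh]])
      fix z :: "real^'d"
      show "norm (gauss z * (z $ i * (heat \<sigma> z)))
         \<le> gauss z * (norm z * h (pt \<sigma> z) (ct \<sigma>))"
        using h[OF t, of "pt \<sigma> z"] component_le_norm_cart[of z i] gauss_pos[of z]
        by (auto simp: abs_mult intro!: mult_left_mono mult_mono)
    next
      have "(\<lambda>z. heat \<sigma> z) \<in> borel_measurable borel"
        using measurable_slices(4,5)[OF t] by measurable
      then show "integrable lborel (\<lambda>z. gauss z * (z $ i * (heat \<sigma> z)))"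
      proof (intro integrable_gauss_cmult_bounded[of _ Bh] borel_measurable_times borel_measurable_component)
        show "Bh \<ge> 0" using order_trans[OF abs_ge_zero hb[OF t]] .
        show "\<bar>z $ i * (heat \<sigma> z)\<bar> \<le> Bh * (1 + norm z)" for z
          unfolding abs_mult mult.commute[of Bh]
          using h[OF t, of "pt \<sigma> z"] hb[OF t, of "pt \<sigma> z"] component_le_norm_cart[of z i]
          by (intro mult_mono) auto
      qed
    qed (auto intro: hm hb t)
    then show ?thesis by simp
  qed
  with \<Phi> show ?thesis unfolding dominated_path_def
    by (intro exI[of _ \<Phi>] exI[of _ "\<lambda>\<sigma>. - ?H \<sigma>"]) simp
qed

text \<open>
  A further integration by parts moves the divergence onto the Gaussian; its cost \<open>1 / \<sigma>\<close> cancels the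
  factor \<open>\<sigma>\<close> from \<open>heat_value\<close>.
\<close>

lemma dominated_path_divergence:
  assumes F: "flux T F"
    and eq: "\<And>x t. t \<in> {0<..<T} \<Longrightarrow> \<tau> * Dt w x t - laplacian w x t = divergence F x t"
    and h: "\<And>x t. t \<in> {0<..<T} \<Longrightarrow> norm (F x t) \<le> h x t"
    and hm: "\<And>t. t \<in> {0<..<T} \<Longrightarrow> (\<lambda>x. h x t) \<in> borel_measurable borel"
    and hb: "\<And>x t. t \<in> {0<..<T} \<Longrightarrow> \<bar>h x t\<bar> \<le> Bh"
  shows "dominated_path T \<tau> t0 x0 h (w x0 t0)"
proof -
  let ?H = "\<lambda>\<sigma>. \<integral>z. gauss z * (heat \<sigma> z) \<partial>lborel"
  obtain \<Phi> where \<Phi>: "continuous_on {0..\<sigma>M} \<Phi>" "\<Phi> 0 = gauss_mass TYPE('d) * w x0 t0" "\<Phi> \<sigma>M = 0"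
    "\<And>\<sigma>. 0 < \<sigma> \<Longrightarrow> \<sigma> < \<sigma>M \<Longrightarrow> (\<Phi> has_real_derivative - \<sigma> * ?H \<sigma>) (at \<sigma>)"
    by (rule heat_value) (rule that)
  have "\<bar>- \<sigma> * ?H \<sigma>\<bar> \<le> (\<integral>z. gauss z * (norm z * h (pt \<sigma> z) (ct \<sigma>)) \<partial>lborel)"
    if s: "0 < \<sigma>" "\<sigma> < \<sigma>M" for \<sigma>
  proof -
    have t: "ct \<sigma> \<in> {0<..<T}" using facts(2)[of \<sigma>] that by simp
    obtain B where B: "\<And>x. norm (F x (ct \<sigma>)) \<le> B" "\<And>x j. \<bar>Dx F x (ct \<sigma>) $ j $ j\<bar> \<le> B"
      using F t unfolding flux_def by blast
    let ?f = "\<lambda>j z. F (pt \<sigma> z) (ct \<sigma>) $ j"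
    have fm: "(\<lambda>z. F (pt \<sigma> z) (ct \<sigma>)) \<in> borel_measurable borel"
      by (rule measurable_compose[OF _ flux_measurable[OF F t]]) measurable
    have fjm: "?f j \<in> borel_measurable borel" for j
      by (rule measurable_compose[OF fm borel_measurable_component])
    have B0: "B \<ge> 0" by (rule order_trans[OF norm_ge_zero B(1)])
    have b1: "\<bar>?f j z\<bar> \<le> max B (\<bar>\<sigma>\<bar> * B)" for j z
      using order_trans[OF component_le_norm_cart B(1), of "pt \<sigma> z" j] by linarith
    have b2: "\<bar>\<sigma> * Dx F (pt \<sigma> z) (ct \<sigma>) $ j $ j\<bar> \<le> max B (\<bar>\<sigma>\<bar> * B)" for j z
      using mult_left_mono[OF B(2)[of "pt \<sigma> z" j], of "\<bar>\<sigma>\<bar>"] by (simp add: abs_mult)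
    have I: "integrable lborel (\<lambda>z. gauss z * (1 * (\<sigma> * Dx F (pt \<sigma> z) (ct \<sigma>) $ j $ j)))"
      "(\<integral>z. gauss z * (1 * z $ j * ?f j z) \<partial>lborel) = (\<integral>z. gauss z * (0 * ?f j z) \<partial>lborel) +
         (\<integral>z. gauss z * (1 * (\<sigma> * Dx F (pt \<sigma> z) (ct \<sigma>) $ j $ j)) \<partial>lborel)" for j
    proof -
      have der: "((\<lambda>s. ?f j (z + s *\<^sub>R axis j 1)) has_real_derivative \<sigma> * Dx F (pt \<sigma> z) (ct \<sigma>) $ j $ j) (at 0)" for z
        by (rule DERIV_axis_scaled[where f="\<lambda>y. F y (ct \<sigma>) $ j", OF flux_DERIV[OF F t]])
      note A = gauss_integration_by_parts[of "?f j" "\<lambda>_. 1" "\<lambda>_. 0" "max B (\<bar>\<sigma>\<bar> * B)"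
        "\<lambda>z. \<sigma> * Dx F (pt \<sigma> z) (ct \<sigma>) $ j $ j" j, OF fjm _ _ b1 b2 _ _ der]
      show "integrable lborel (\<lambda>z. gauss z * (1 * (\<sigma> * Dx F (pt \<sigma> z) (ct \<sigma>) $ j $ j)))"
        by (rule A(1)) auto
      show "(\<integral>z. gauss z * (1 * z $ j * ?f j z) \<partial>lborel) = (\<integral>z. gauss z * (0 * ?f j z) \<partial>lborel) +
         (\<integral>z. gauss z * (1 * (\<sigma> * Dx F (pt \<sigma> z) (ct \<sigma>) $ j $ j)) \<partial>lborel)"
        by (rule A(2)) auto
    qed
    have i1: "integrable lborel (\<lambda>z. gauss z * (\<sigma> * Dx F (pt \<sigma> z) (ct \<sigma>) $ j $ j))" for j
      using I(1)[of j] by simp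
    have i2: "integrable lborel (\<lambda>z. gauss z * (z $ j * ?f j z))" for j
    proof (intro integrable_gauss_cmult_bounded[of _ B] borel_measurable_times borel_measurable_component fjm B0)
      show "\<bar>z $ j * ?f j z\<bar> \<le> B * (1 + norm z)" for z
        unfolding abs_mult mult.commute[of B]
        using component_le_norm_cart[of z j] order_trans[OF component_le_norm_cart B(1), of "pt \<sigma> z" j]
        by (intro mult_mono) auto
    qed
    have "\<sigma> * ?H \<sigma> = (\<integral>z. \<sigma> * (gauss z * (heat \<sigma> z)) \<partial>lborel)"
      by simp
    also have "\<dots> = (\<integral>z. (\<Sum>j\<in>UNIV. gauss z * (\<sigma> * Dx F (pt \<sigma> z) (ct \<sigma>) $ j $ j)) \<partial>lborel)"
      by (intro Bochner_Integration.integral_cong refl)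
        (simp add: eq[OF t] divergence_def trace_def sum_distrib_left mult.left_commute)
    also have "\<dots> = (\<Sum>j\<in>UNIV. \<integral>z. gauss z * (\<sigma> * Dx F (pt \<sigma> z) (ct \<sigma>) $ j $ j) \<partial>lborel)"
      by (rule Bochner_Integration.integral_sum) (rule i1)
    also have "\<dots> = (\<Sum>j\<in>UNIV. \<integral>z. gauss z * (z $ j * ?f j z) \<partial>lborel)"
      using I(2) by simp
    also have "\<dots> = (\<integral>z. (\<Sum>j\<in>UNIV. gauss z * (z $ j * ?f j z)) \<partial>lborel)"
      by (rule Bochner_Integration.integral_sum[symmetric]) (rule i2)
    also have "\<dots> = (\<integral>z. gauss z * (z \<bullet> F (pt \<sigma> z) (ct \<sigma>)) \<partial>lborel)"
      by (simp add: inner_vec_def sum_distrib_left)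
    finally have *: "\<sigma> * ?H \<sigma> = (\<integral>z. gauss z * (z \<bullet> F (pt \<sigma> z) (ct \<sigma>)) \<partial>lborel)" .
    have "norm (\<integral>z. gauss z * (z \<bullet> F (pt \<sigma> z) (ct \<sigma>)) \<partial>lborel) \<le> (\<integral>z. gauss z * (norm z * h (pt \<sigma> z) (ct \<sigma>)) \<partial>lborel)"
    proof (rule Bochner_Integration.integral_norm_bound_integral[OF _ integrable_norm_h[where Bh=Bh]])
      show "integrable lborel (\<lambda>z. gauss z * (z \<bullet> F (pt \<sigma> z) (ct \<sigma>)))"
        using Bochner_Integration.integrable_sum[OF i2, of "\<lambda>j. j" UNIV] by (simp add: inner_vec_def sum_distrib_left)
      fix z :: "real^'d"
      have "\<bar>z \<bullet> F (pt \<sigma> z) (ct \<sigma>)\<bar> \<le> norm z * h (pt \<sigma> z) (ct \<sigma>)"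
        by (intro order_trans[OF Cauchy_Schwarz_ineq2] mult_left_mono h t) auto
      then show "norm (gauss z * (z \<bullet> F (pt \<sigma> z) (ct \<sigma>))) \<le> gauss z * (norm z * h (pt \<sigma> z) (ct \<sigma>))"
        using gauss_pos[of z] by (simp add: abs_mult)
    qed (auto intro: hm hb t)
    then show ?thesis unfolding * [symmetric] by simp
  qed
  with \<Phi> show ?thesis unfolding dominated_path_def
    by (intro exI[of _ \<Phi>] exI[of _ "\<lambda>\<sigma>. - \<sigma> * ?H \<sigma>"]) simp
qed

text \<open>
  The path of \<open>heat_value\<close> has speed at most \<open>\<sigma>\<close> times the mass times \<open>G\<close>, and half the square of the final width is at
  most \<open>T\<close>.
\<close>

lemma heat_sup_bound:
  assumes G: "\<And>x t. t \<in> {0<..<T} \<Longrightarrow> \<bar>\<tau> * Dt w x t - laplacian w x t\<bar> \<le> G"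
  shows "\<bar>w x0 t0\<bar> \<le> T * G"
proof -
  let ?Z = "gauss_mass TYPE('d)"
  let ?H = "\<lambda>\<sigma>. \<integral>z. gauss z * (heat \<sigma> z) \<partial>lborel"
  obtain \<Phi> where \<Phi>: "continuous_on {0..\<sigma>M} \<Phi>" "\<Phi> 0 = ?Z * w x0 t0" "\<Phi> \<sigma>M = 0"
    "\<And>\<sigma>. 0 < \<sigma> \<Longrightarrow> \<sigma> < \<sigma>M \<Longrightarrow> (\<Phi> has_real_derivative - \<sigma> * ?H \<sigma>) (at \<sigma>)"
    by (rule heat_value) (rule that)
  have G0: "G \<ge> 0" using order_trans[OF abs_ge_zero G[OF t0]] .
  have bd: "\<bar>?H \<sigma>\<bar> \<le> ?Z * G" if s: "0 < \<sigma>" "\<sigma> < \<sigma>M" for \<sigma>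
  proof -
    have t: "ct \<sigma> \<in> {0<..<T}" using facts(2)[of \<sigma>] that by simp
    have "norm (?H \<sigma>) \<le> (\<integral>z. gauss z * G \<partial>(lborel :: (real^'d) measure))"
    proof (rule Bochner_Integration.integral_norm_bound_integral)
      have "(\<lambda>z. heat \<sigma> z) \<in> borel_measurable borel"
        using measurable_slices(4,5)[OF t] by measurable
      then show "integrable lborel (\<lambda>z. gauss z * (heat \<sigma> z))"
      proof (rule integrable_gauss_cmult_bounded[of _ G])
        have "G * 1 \<le> G * (1 + norm z)" for z :: "real^'d" using G0 by (intro mult_left_mono) auto
        then show "\<bar>heat \<sigma> z\<bar> \<le> G * (1 + norm z)" for z
          using G[OF t, of "pt \<sigma> z"] by (intro order_trans[OF G[OF t]]) simp
      qed (rule G0)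
      show "integrable lborel (\<lambda>z::real^'d. gauss z * G)" using gauss_integrable[where 'd='d] by simp
      show "norm (gauss z * (heat \<sigma> z)) \<le> gauss z * G" for z
        using gauss_pos[of z] G[OF t] by (simp add: abs_mult)
    qed
    then show ?thesis by (simp add: gauss_mass_def)
  qed
  have "norm (\<Phi> \<sigma>M - \<Phi> 0) \<le> ?Z * G * \<sigma>M\<^sup>2 / 2 - ?Z * G * 0\<^sup>2 / 2"
  proof (rule differentiable_bound_general[where f'="\<lambda>\<sigma>. - \<sigma> * ?H \<sigma>" and \<phi>="\<lambda>\<sigma>. ?Z * G * \<sigma>\<^sup>2 / 2" and \<phi>'="\<lambda>\<sigma>. \<sigma> * (?Z * G)"])
    show "0 < \<sigma>M" by (rule facts)
    show "continuous_on {0..\<sigma>M} (\<lambda>\<sigma>. ?Z * G * \<sigma>\<^sup>2 / 2)" by (intro continuous_intros) auto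
    show "((\<lambda>\<sigma>. ?Z * G * \<sigma>\<^sup>2 / 2) has_vector_derivative x * (?Z * G)) (at x)" for x
      unfolding has_real_derivative_iff_has_vector_derivative[symmetric] by (auto intro!: derivative_eq_intros)
    show "(\<Phi> has_vector_derivative - x * ?H x) (at x)" if "0 < x" "x < \<sigma>M" for x
      using \<Phi>(4)[OF that] by (simp add: has_real_derivative_iff_has_vector_derivative)
    show "norm (- x * ?H x) \<le> x * (?Z * G)" if "0 < x" "x < \<sigma>M" for x
      using mult_left_mono[OF bd[OF that], of x] that by (simp add: abs_mult)
  qed (rule \<Phi>)
  then have "?Z * \<bar>w x0 t0\<bar> \<le> ?Z * G * \<sigma>M\<^sup>2 / 2"
    using gauss_mass_pos[where 'd='d] by (simp add: \<Phi> abs_mult)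
  also have "\<dots> \<le> ?Z * (T * G)"
  proof -
    have "\<sigma>M\<^sup>2 \<le> 2 * T" using t0 by (simp add: final_width_def)
    from mult_left_mono[OF this, of "?Z * G"] show ?thesis using G0 gauss_mass_pos[where 'd='d] by (simp add: mult_ac)
  qed
  finally show ?thesis using gauss_mass_pos[where 'd='d] by simp
qed

end

end

section \<open>Sup bounds from bounds on cell integrals\<close>

text \<open>
  Up to the width \<open>\<epsilon>\<close> the speed of the path is bounded by a multiple of \<open>L S + D\<close>. From then on \<open>gauss_far_part\<close> bounds
  it by a small multiple of \<open>S\<close> plus the cell integral of \<open>W\<close>, which is at most \<open>N'\<close>. Along the clock the
  derivative of \<open>- \<tau> N\<close> in \<open>\<sigma>\<close> is \<open>\<sigma> N' \<ge> \<epsilon> N'\<close>; so the total contribution is at most a multiple of the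
  increase of \<open>N\<close> over the whole time interval. The constant \<open>C\<close> deteriorates as \<open>\<kappa>\<close> decreases.
\<close>

lemma dominated_path_bound:
  fixes T L \<kappa> :: real
  assumes T: "T > 0" and L: "L \<ge> 0" and \<kappa>: "\<kappa> > 0"
  shows "\<exists>C\<ge>0. \<forall>\<tau> t0 a W D S N N'. \<forall>x0::real^'d.
    (\<tau> = 1 \<or> \<tau> = -1) \<longrightarrow> t0 \<in> {0<..<T} \<longrightarrow> dominated_path T \<tau> t0 x0 (\<lambda>x t. L * W x t + D) a \<longrightarrow> D \<ge> 0 \<longrightarrow>
    (\<forall>t\<in>{0<..<T}. (\<lambda>x. W x t) \<in> borel_measurable borel \<and> periodic (\<lambda>x. W x t) \<and> (\<forall>x. 0 \<le> W x t \<and> W x t \<le> S)) \<longrightarrow>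
    continuous_on {0..T} N \<longrightarrow> (\<forall>t\<in>{0<..<T}. (N has_real_derivative N' t) (at t) \<and> (\<integral>x. W x t \<partial>cell_measure) \<le> N' t) \<longrightarrow>
    \<bar>a\<bar> \<le> \<kappa> * S + C * (D + (N T - N 0))"
proof -
  let ?Z = "gauss_mass TYPE('d)"
  define m1 where "m1 = (\<integral>z. gauss z * norm z \<partial>(lborel :: (real^'d) measure))"
  have Z: "?Z > 0" by (rule gauss_mass_pos)
  have im1: "integrable lborel (\<lambda>z::real^'d. gauss z * norm z)"
    by (rule integrable_gauss_cmult_bounded[of _ 1]) auto
  have m1: "m1 \<ge> 0" unfolding m1_def by (rule Bochner_Integration.integral_nonneg) (simp add: gauss_def)
  \<comment> \<open>Small widths and Gaussian tails each get half of the allowed multiple of \<open>S\<close>; the summand \<open>1\<close>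
    covers \<open>L = 0\<close>.\<close>
  define \<epsilon> where "\<epsilon> = \<kappa> * ?Z / (2 * (m1 * L + 1))"
  define R where "R = sqrt (2 * T)"
  have R: "R \<ge> 0" using T by (simp add: R_def)
  define \<delta> where "\<delta> = \<kappa> * ?Z / (2 * (R * L + 1))"
  have p1: "m1 * L + 1 > 0" "R * L + 1 > 0" using m1 L R by (auto intro!: add_nonneg_pos mult_nonneg_nonneg)
  have \<epsilon>: "\<epsilon> > 0" using \<kappa> Z p1 by (simp add: \<epsilon>_def)
  have \<delta>: "\<delta> > 0" using \<kappa> Z p1 by (simp add: \<delta>_def)
  have \<epsilon>2: "\<epsilon> * (m1 * L) \<le> \<kappa> * ?Z / 2"
  proof -
    have "\<epsilon> * (m1 * L) \<le> \<epsilon> * (m1 * L + 1)" using \<epsilon> by simp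
    also have "\<dots> = \<kappa> * ?Z / 2" using p1 by (simp add: \<epsilon>_def field_simps)
    finally show ?thesis .
  qed
  have \<delta>2: "\<delta> * (R * L) \<le> \<kappa> * ?Z / 2"
  proof -
    have "\<delta> * (R * L) \<le> \<delta> * (R * L + 1)" using \<delta> by simp
    also have "\<dots> = \<kappa> * ?Z / 2" using p1 by (simp add: \<delta>_def field_simps)
    finally show ?thesis .
  qed
  obtain K where K: "K \<ge> 0" "\<And>\<sigma> g S. \<And>x0::real^'d. \<epsilon> \<le> \<sigma> \<Longrightarrow> \<sigma> \<le> R \<Longrightarrow> g \<in> borel_measurable borel \<Longrightarrow> periodic g \<Longrightarrow>
    (\<And>x. 0 \<le> g x \<and> g x \<le> (S::real)) \<Longrightarrow>
    (\<integral>z. gauss z * (norm z * g (x0 + \<sigma> *\<^sub>R z)) \<partial>lborel) \<le> \<delta> * S + K * (\<integral>x. g x \<partial>cell_measure)"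
    using gauss_far_part[OF \<delta> \<epsilon>, where \<sigma>M=R and 'd='d] by blast
  define C where "C = (\<epsilon> * m1 + R * m1 + L * K / \<epsilon>) / ?Z"
  have C: "C \<ge> 0" using \<epsilon> m1 R L K Z by (simp add: C_def)
  have "\<bar>a\<bar> \<le> \<kappa> * S + C * (D + (N T - N 0))"
    if \<tau>: "\<tau> = 1 \<or> \<tau> = -1" and t0: "t0 \<in> {0<..<T}" and path: "dominated_path T \<tau> t0 x0 (\<lambda>x t. L * W x t + D) a"
      and D: "D \<ge> 0" and W: "\<And>t. t \<in> {0<..<T} \<Longrightarrow> (\<lambda>x. W x t) \<in> borel_measurable borel"
        "\<And>t. t \<in> {0<..<T} \<Longrightarrow> periodic (\<lambda>x. W x t)" "\<And>t x. t \<in> {0<..<T} \<Longrightarrow> 0 \<le> W x t \<and> W x t \<le> S"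
      and Nc: "continuous_on {0..T} N" and N: "\<And>t. t \<in> {0<..<T} \<Longrightarrow> (N has_real_derivative N' t) (at t)"
       "\<And>t. t \<in> {0<..<T} \<Longrightarrow> (\<integral>x. W x t \<partial>cell_measure) \<le> N' t"
     for \<tau> t0 a W D S N N' and x0 :: "real^'d"
  proof -
    let ?s = "final_width T \<tau> t0" and ?ct = "clock \<tau> t0"
    have S: "S \<ge> 0" using W(3)[OF t0, of 0] by linarith
    have s0: "0 < ?s" using t0 by (simp add: final_width_def)
    have sR: "?s \<le> R" using t0 by (simp add: final_width_def R_def)
    note ctI = clock_interior[OF \<tau> t0] and ctC = clock_closed[OF \<tau> t0]
    have N'0: "0 \<le> N' t" if "t \<in> {0<..<T}" for t
      by (rule order_trans[OF _ N(2)[OF that]]) (use W(3)[OF that] in \<open>auto intro!: Bochner_Integration.integral_nonneg\<close>)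
    have Nmono: "N r \<le> N t" if "0 \<le> r" "r \<le> t" "t \<le> T" for r t
    proof (cases "r = t")
      case False
      show ?thesis
      proof (rule DERIV_nonneg_imp_increasing_open[of r t N])
        show "r \<le> t" by fact
        show "\<exists>y. (N has_real_derivative y) (at x) \<and> 0 \<le> y" if "r < x" "x < t" for x
          using N(1)[of x] N'0[of x] that \<open>0 \<le> r\<close> \<open>t \<le> T\<close> by auto
        show "continuous_on {r..t} N" by (rule continuous_on_subset[OF Nc]) (use that in auto)
      qed
    qed simp
    obtain \<Phi> \<Phi>' where \<Phi>: "continuous_on {0..?s} \<Phi>" "\<Phi> 0 = ?Z * a" "\<Phi> ?s = 0"
       "\<And>\<sigma>. 0 < \<sigma> \<Longrightarrow> \<sigma> < ?s \<Longrightarrow> (\<Phi> has_real_derivative \<Phi>' \<sigma>) (at \<sigma>)"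
       "\<And>\<sigma>. 0 < \<sigma> \<Longrightarrow> \<sigma> < ?s \<Longrightarrow> \<bar>\<Phi>' \<sigma>\<bar> \<le> (\<integral>z. gauss z * (norm z * (L * W (x0 + \<sigma> *\<^sub>R z) (?ct \<sigma>) + D)) \<partial>lborel)"
      using path unfolding dominated_path_def by blast
    have split: "(\<integral>z. gauss z * (norm z * (L * W (x0 + \<sigma> *\<^sub>R z) (?ct \<sigma>) + D)) \<partial>lborel)
        = L * (\<integral>z. gauss z * (norm z * W (x0 + \<sigma> *\<^sub>R z) (?ct \<sigma>)) \<partial>lborel) + D * m1"
      and Wle: "(\<integral>z. gauss z * (norm z * W (x0 + \<sigma> *\<^sub>R z) (?ct \<sigma>)) \<partial>lborel) \<le> S * m1"
      if "0 < \<sigma>" "\<sigma> < ?s" for \<sigma>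
    proof -
      have t: "?ct \<sigma> \<in> {0<..<T}" using ctI[of \<sigma>] that by simp
      note [measurable] = measurable_compose[OF _ W(1)[OF t]]
      have i: "integrable lborel (\<lambda>z. gauss z * (norm z * W (x0 + \<sigma> *\<^sub>R z) (?ct \<sigma>)))"
      proof (rule integrable_gauss_cmult_bounded[of _ S])
        show "\<bar>norm z * W (x0 + \<sigma> *\<^sub>R z) (?ct \<sigma>)\<bar> \<le> S * (1 + norm z)" for z
          unfolding abs_mult mult.commute[of S] using W(3)[OF t] by (intro mult_mono) auto
      qed (use S in auto)
      have "(\<integral>z. gauss z * (norm z * (L * W (x0 + \<sigma> *\<^sub>R z) (?ct \<sigma>) + D)) \<partial>lborel)
        = (\<integral>z. L * (gauss z * (norm z * W (x0 + \<sigma> *\<^sub>R z) (?ct \<sigma>))) + D * (gauss z * norm z) \<partial>lborel)"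
        by (intro Bochner_Integration.integral_cong refl) (simp add: algebra_simps)
      also have "\<dots> = L * (\<integral>z. gauss z * (norm z * W (x0 + \<sigma> *\<^sub>R z) (?ct \<sigma>)) \<partial>lborel) + D * m1"
        using i im1 by (simp add: m1_def)
      finally show "(\<integral>z. gauss z * (norm z * (L * W (x0 + \<sigma> *\<^sub>R z) (?ct \<sigma>) + D)) \<partial>lborel)
        = L * (\<integral>z. gauss z * (norm z * W (x0 + \<sigma> *\<^sub>R z) (?ct \<sigma>)) \<partial>lborel) + D * m1" .
      have "(\<integral>z. gauss z * (norm z * W (x0 + \<sigma> *\<^sub>R z) (?ct \<sigma>)) \<partial>lborel) \<le> (\<integral>z. S * (gauss z * norm z) \<partial>(lborel :: (real^'d) measure))"
      proof (rule integral_mono[OF i])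
        show "integrable lborel (\<lambda>z::real^'d. S * (gauss z * norm z))" using im1 by simp
        show "gauss z * (norm z * W (x0 + \<sigma> *\<^sub>R z) (?ct \<sigma>)) \<le> S * (gauss z * norm z)" for z
        proof -
          have "gauss z * norm z * W (x0 + \<sigma> *\<^sub>R z) (?ct \<sigma>) \<le> gauss z * norm z * S"
            using W(3)[OF t] gauss_pos[of z] by (intro mult_left_mono) auto
          then show ?thesis by (simp add: mult_ac)
        qed
      qed
      then show "(\<integral>z. gauss z * (norm z * W (x0 + \<sigma> *\<^sub>R z) (?ct \<sigma>)) \<partial>lborel) \<le> S * m1" by (simp add: m1_def)
    qed
    let ?r = "min \<epsilon> ?s"
    have near: "\<bar>\<Phi> ?r - \<Phi> 0\<bar> \<le> ?r * (L * (S * m1) + D * m1)"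
    proof -
      have "norm (\<Phi> ?r - \<Phi> 0) \<le> ?r * (L * (S * m1) + D * m1) - 0 * (L * (S * m1) + D * m1)"
      proof (rule differentiable_bound_general[where f'=\<Phi>' and \<phi>="\<lambda>\<sigma>. \<sigma> * (L * (S * m1) + D * m1)" and \<phi>'="\<lambda>_. L * (S * m1) + D * m1"])
        show "0 < ?r" using \<epsilon> s0 by simp
        show "continuous_on {0..?r} \<Phi>" by (rule continuous_on_subset[OF \<Phi>(1)]) auto
        show "continuous_on {0..?r} (\<lambda>\<sigma>. \<sigma> * (L * (S * m1) + D * m1))" by (intro continuous_intros)
        fix x assume x: "0 < x" "x < ?r"
        then have x': "0 < x" "x < ?s" by auto
        show "(\<Phi> has_vector_derivative \<Phi>' x) (at x)"
          using \<Phi>(4)[OF x'] by (simp add: has_real_derivative_iff_has_vector_derivative)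
        show "((\<lambda>\<sigma>. \<sigma> * (L * (S * m1) + D * m1)) has_vector_derivative L * (S * m1) + D * m1) (at x)"
          unfolding has_real_derivative_iff_has_vector_derivative[symmetric] by (auto intro!: derivative_eq_intros)
        show "norm (\<Phi>' x) \<le> L * (S * m1) + D * m1"
          using \<Phi>(5)[OF x'] split[OF x'] mult_left_mono[OF Wle[OF x'] L] by simp
      qed
      then show ?thesis by simp
    qed
    let ?A = "L * (\<delta> * S) + D * m1" and ?q = "L * K / \<epsilon>"
    have q: "?q \<ge> 0" using L K \<epsilon> by simp
    have far: "\<bar>\<Phi> ?s - \<Phi> ?r\<bar> \<le> R * ?A + ?q * (N T - N 0)"
    proof (cases "\<epsilon> < ?s")
      case True
      let ?\<phi> = "\<lambda>\<sigma>. \<sigma> * ?A + ?q * (- \<tau> * N (?ct \<sigma>))"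
      have "norm (\<Phi> ?s - \<Phi> \<epsilon>) \<le> ?\<phi> ?s - ?\<phi> \<epsilon>"
      proof (rule differentiable_bound_general[where f'=\<Phi>' and \<phi>'="\<lambda>\<sigma>. ?A + ?q * (\<sigma> * N' (?ct \<sigma>))"])
        show "\<epsilon> < ?s" by fact
        show "continuous_on {\<epsilon>..?s} \<Phi>" by (rule continuous_on_subset[OF \<Phi>(1)]) (use \<epsilon> in auto)
        have "?ct ` {\<epsilon>..?s} \<subseteq> {0..T}" using ctC \<epsilon> by force
        then have "continuous_on {\<epsilon>..?s} (\<lambda>\<sigma>. N (?ct \<sigma>))"
          by (intro continuous_on_compose2[OF Nc]) (auto simp: clock_def intro!: continuous_intros)
        then show "continuous_on {\<epsilon>..?s} ?\<phi>" by (intro continuous_intros)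
        fix x assume x: "\<epsilon> < x" "x < ?s"
        then have x': "0 < x" "x < ?s" using \<epsilon> by auto
        have t: "?ct x \<in> {0<..<T}" using ctI[of x] x' by simp
        show "(\<Phi> has_vector_derivative \<Phi>' x) (at x)"
          using \<Phi>(4)[OF x'] by (simp add: has_real_derivative_iff_has_vector_derivative)
        have "((\<lambda>\<sigma>. N (?ct \<sigma>)) has_real_derivative N' (?ct x) * (- \<tau> * x)) (at x)"
          by (rule DERIV_chain2[OF N(1)[OF t] DERIV_clock[OF \<tau> t0]])
        then have "(?\<phi> has_real_derivative 1 * ?A + ?q * (- \<tau> * (N' (?ct x) * (- \<tau> * x)))) (at x)"
          by (intro DERIV_add DERIV_cmult DERIV_cmult_right DERIV_ident)
        also have "1 * ?A + ?q * (- \<tau> * (N' (?ct x) * (- \<tau> * x))) = ?A + ?q * (x * N' (?ct x))"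
          using \<tau> by auto
        finally show "(?\<phi> has_vector_derivative ?A + ?q * (x * N' (?ct x))) (at x)"
          by (simp add: has_real_derivative_iff_has_vector_derivative)
        have "(\<integral>z. gauss z * (norm z * W (x0 + x *\<^sub>R z) (?ct x)) \<partial>lborel) \<le> \<delta> * S + K * (\<integral>y. W y (?ct x) \<partial>cell_measure)"
          by (rule K(2)) (use x x' sR W(1,2,3)[OF t] in auto)
        also have "\<dots> \<le> \<delta> * S + K * N' (?ct x)"
          using N(2)[OF t] K(1) by (simp add: mult_left_mono)
        also have "\<dots> \<le> \<delta> * S + K * (x / \<epsilon> * N' (?ct x))"
        proof -
          have "1 * N' (?ct x) \<le> x / \<epsilon> * N' (?ct x)"
            using x \<epsilon> N'0[OF t] by (intro mult_right_mono) auto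
          then show ?thesis using mult_left_mono[OF _ K(1)] by fastforce
        qed
        finally have "L * (\<integral>z. gauss z * (norm z * W (x0 + x *\<^sub>R z) (?ct x)) \<partial>lborel) \<le> L * (\<delta> * S + K * (x / \<epsilon> * N' (?ct x)))"
          using L by (rule mult_left_mono)
        then show "norm (\<Phi>' x) \<le> ?A + ?q * (x * N' (?ct x))"
          using \<Phi>(5)[OF x'] split[OF x'] by (simp add: algebra_simps)
      qed
      also have "\<dots> \<le> R * ?A + ?q * (N T - N 0)"
      proof -
        have A0: "?A \<ge> 0" using L \<delta> S D m1 by simp
        have r: "?ct ?s \<in> {0..T}" "?ct \<epsilon> \<in> {0..T}" using ctC[of ?s] ctC[of \<epsilon>] True \<epsilon> s0 by auto
        have "- \<tau> * N (?ct ?s) - (- \<tau> * N (?ct \<epsilon>)) \<le> N T - N 0"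
          using \<tau> Nmono[of 0 "?ct ?s"] Nmono[of "?ct ?s" T] Nmono[of 0 "?ct \<epsilon>"] Nmono[of "?ct \<epsilon>" T] r by auto
        from mult_left_mono[OF this q] have "?q * (- \<tau> * N (?ct ?s)) - ?q * (- \<tau> * N (?ct \<epsilon>)) \<le> ?q * (N T - N 0)"
          by (simp add: right_diff_distrib)
        moreover have "?s * ?A - \<epsilon> * ?A \<le> R * ?A"
          using mult_right_mono[OF sR A0] mult_nonneg_nonneg[OF less_imp_le[OF \<epsilon>] A0] by linarith
        ultimately show ?thesis by linarith
      qed
      finally show ?thesis using True by simp
    next
      case False
      have "0 \<le> R * ?A + ?q * (N T - N 0)"
        using R L \<delta> S D m1 q Nmono[of 0 T] T by (intro add_nonneg_nonneg mult_nonneg_nonneg) auto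
      moreover have "?r = ?s" using False by simp
      ultimately show ?thesis by (simp only: diff_self abs_zero)
    qed
    have "?Z * \<bar>a\<bar> \<le> ?r * (L * (S * m1) + D * m1) + (R * ?A + ?q * (N T - N 0))"
      using near far Z by (simp add: \<Phi> abs_mult)
    also have "?r * (L * (S * m1) + D * m1) \<le> \<epsilon> * (L * (S * m1) + D * m1)"
      using L S m1 D by (intro mult_right_mono add_nonneg_nonneg mult_nonneg_nonneg) auto
    also have "\<epsilon> * (L * (S * m1) + D * m1) + (R * ?A + ?q * (N T - N 0)) =
       (\<epsilon> * (m1 * L)) * S + (\<delta> * (R * L)) * S + ((\<epsilon> * m1 + R * m1) * D + ?q * (N T - N 0))"
      by (simp add: algebra_simps)
    also have "\<dots> \<le> \<kappa> * ?Z / 2 * S + \<kappa> * ?Z / 2 * S + (\<epsilon> * m1 + R * m1 + ?q) * (D + (N T - N 0))"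
    proof (intro add_mono mult_right_mono \<epsilon>2 \<delta>2 S)
      have NN: "0 \<le> N T - N 0" using Nmono[of 0 T] T by simp
      have "0 \<le> (\<epsilon> * m1 + R * m1) * (N T - N 0)" "0 \<le> ?q * D"
        using NN \<epsilon> m1 R D q by (auto intro!: mult_nonneg_nonneg add_nonneg_nonneg simp del: times_divide_eq_left)
      then show "(\<epsilon> * m1 + R * m1) * D + ?q * (N T - N 0) \<le> (\<epsilon> * m1 + R * m1 + ?q) * (D + (N T - N 0))"
        unfolding distrib_left distrib_right by linarith
    qed
    also have "\<dots> = ?Z * (\<kappa> * S + C * (D + (N T - N 0)))"
      using Z by (simp add: C_def field_simps)
    finally show ?thesis using Z by simp
  qed
  with C show ?thesis by (intro exI[of _ C]) blast
qed

section \<open>Energy and stability of the linearised system\<close>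

lemma regular_slice_measurable:
  assumes w: "regular T w" and t: "t \<in> {0<..<T}"
  shows "(\<lambda>x. w x t) \<in> borel_measurable borel" "(\<lambda>x. Dx w x t) \<in> borel_measurable borel"
    "(\<lambda>x. Dt w x t) \<in> borel_measurable borel" "(\<lambda>x. Dx w x t $ i) \<in> borel_measurable borel"
proof -
  have t': "t \<in> {0..T}" using t by auto
  show "(\<lambda>x. w x t) \<in> borel_measurable borel"
    by (rule borel_measurable_continuous_onI[OF regular_continuous_slice(1)[OF w t']])
  show "(\<lambda>x. Dt w x t) \<in> borel_measurable borel"
    by (rule borel_measurable_continuous_onI[OF regular_continuous_slice(4)[OF w t]])
  show D: "(\<lambda>x. Dx w x t) \<in> borel_measurable borel"
    by (rule borel_measurable_continuous_onI[OF regular_continuous_slice(2)[OF w t]])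
  show "(\<lambda>x. Dx w x t $ i) \<in> borel_measurable borel"
    by (rule measurable_compose[OF D borel_measurable_component])
qed

lemma periodic_Dx:
  assumes w: "regular T w" and t: "t \<in> {0<..<T}"
  shows "periodic (\<lambda>x. Dx w x t)"
  unfolding periodic_def
proof (intro allI ballI)
  fix x k :: "real^'a" assume k: "k \<in> int_lattice"
  have eq: "(\<lambda>y. w (y + k) t) = (\<lambda>y. w y t)"
    using regular_periodic[OF w, of t] t k by (auto simp: periodic_def)
  have 1: "((\<lambda>y. w y t) has_derivative frechet_derivative (\<lambda>y. w y t) (at (x + k))) (at (x + k))"
    using regular_differentiable(1)[OF w t] by (simp add: frechet_derivative_works)
  have 2: "((\<lambda>y. y + k) has_derivative (\<lambda>h. h)) (at x)"
    using has_derivative_add_const[OF has_derivative_ident, of k "at x"] by simp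
  have "((\<lambda>y. w (y + k) t) has_derivative frechet_derivative (\<lambda>y. w y t) (at (x + k))) (at x)"
    by (rule has_derivative_compose[OF 2 1])
  then have "((\<lambda>y. w y t) has_derivative frechet_derivative (\<lambda>y. w y t) (at (x + k))) (at x)"
    unfolding eq .
  from frechet_derivative_at[OF this]
  show "Dx w (x + k) t = Dx w x t" by (simp only: Dx_def nabla_def)
qed

text \<open>
  The partial derivatives of \<open>v \<partial>_i \<rho> - \<rho> \<partial>_i v + v F_i\<close> in direction \<open>i\<close> integrate to zero over the cell.
  Subtracting them from the derivative of the energy leaves \<open>X\<close>, which no longer contains derivatives of
  the flux or of \<open>\<rho>\<close>.
\<close>

lemma energy_identity:
  fixes v \<rho> :: "real^'d \<Rightarrow> real \<Rightarrow> real" and F :: "real^'d \<Rightarrow> real \<Rightarrow> real^'d"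
  assumes v: "regular T v" and \<rho>: "regular T \<rho>" and F: "flux T F"
    and eq: "\<And>x t. t \<in> {0<..<T} \<Longrightarrow> Dt \<rho> x t - laplacian \<rho> x t = divergence F x t"
    and t: "t \<in> {0<..<T}"
  defines "X \<equiv> \<lambda>x. Dx v x t \<bullet> F x t + \<rho> x t * (- Dt v x t - laplacian v x t)"
  shows "((\<lambda>t. \<integral>x. \<rho> x t * v x t \<partial>cell_measure) has_real_derivative - (\<integral>x. X x \<partial>cell_measure)) (at t)"
    and "integrable cell_measure X"
proof -
  have t': "t \<in> {0..T}" and T: "0 < T" using t by auto
  obtain B1 where B1: "B1 \<ge> 0" "\<And>x t. t \<in> {0..T} \<Longrightarrow> 0 < T \<Longrightarrow> \<bar>v x t\<bar> \<le> B1"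
    "\<And>x t. t \<in> {0<..<T} \<Longrightarrow> norm (Dx v x t) \<le> B1"
    "\<And>x t. t \<in> {0<..<T} \<Longrightarrow> norm (Dx (Dx v) x t) \<le> B1"
    "\<And>x t. t \<in> {0<..<T} \<Longrightarrow> \<bar>Dt v x t\<bar> \<le> B1"
    by (rule regular_bounded[OF v]) (rule that)
  obtain B2 where B2: "B2 \<ge> 0" "\<And>x t. t \<in> {0..T} \<Longrightarrow> 0 < T \<Longrightarrow> \<bar>\<rho> x t\<bar> \<le> B2"
    "\<And>x t. t \<in> {0<..<T} \<Longrightarrow> norm (Dx \<rho> x t) \<le> B2"
    "\<And>x t. t \<in> {0<..<T} \<Longrightarrow> norm (Dx (Dx \<rho>) x t) \<le> B2"
    "\<And>x t. t \<in> {0<..<T} \<Longrightarrow> \<bar>Dt \<rho> x t\<bar> \<le> B2"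
    by (rule regular_bounded[OF \<rho>]) (rule that)
  obtain B3 where B3: "\<And>x. norm (F x t) \<le> B3" "\<And>x j. \<bar>Dx F x t $ j $ j\<bar> \<le> B3"
    using F t unfolding flux_def by blast
  define B where "B = max B1 (max B2 B3)"
  have B0: "B \<ge> 0" using B1(1) by (simp add: B_def)
  have bd: "\<bar>v x t\<bar> \<le> B" "\<bar>\<rho> x t\<bar> \<le> B" "\<bar>Dx v x t $ i\<bar> \<le> B" "\<bar>Dx \<rho> x t $ i\<bar> \<le> B" "\<bar>F x t $ i\<bar> \<le> B"
    "\<bar>Dx (Dx v) x t $ i $ i\<bar> \<le> B" "\<bar>Dx (Dx \<rho>) x t $ i $ i\<bar> \<le> B" "\<bar>Dx F x t $ i $ i\<bar> \<le> B" for x i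
  proof -
    have B: "B1 \<le> B" "B2 \<le> B" "B3 \<le> B" by (auto simp: B_def)
    show "\<bar>v x t\<bar> \<le> B" by (rule order_trans[OF B1(2)[OF t' T] B(1)])
    show "\<bar>\<rho> x t\<bar> \<le> B" by (rule order_trans[OF B2(2)[OF t' T] B(2)])
    show "\<bar>Dx v x t $ i\<bar> \<le> B"
      using component_le_norm_cart[of "Dx v x t" i] B1(3)[OF t, of x] B(1) by linarith
    show "\<bar>Dx \<rho> x t $ i\<bar> \<le> B"
      using component_le_norm_cart[of "Dx \<rho> x t" i] B2(3)[OF t, of x] B(2) by linarith
    show "\<bar>F x t $ i\<bar> \<le> B"
      using component_le_norm_cart[of "F x t" i] B3(1)[of x] B(3) by linarith
    show "\<bar>Dx (Dx v) x t $ i $ i\<bar> \<le> B"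
      using component_le_norm_cart[of "Dx (Dx v) x t $ i" i] Finite_Cartesian_Product.norm_nth_le[of "Dx (Dx v) x t" i] B1(4)[OF t, of x] B(1) by linarith
    show "\<bar>Dx (Dx \<rho>) x t $ i $ i\<bar> \<le> B"
      using component_le_norm_cart[of "Dx (Dx \<rho>) x t $ i" i] Finite_Cartesian_Product.norm_nth_le[of "Dx (Dx \<rho>) x t" i] B2(4)[OF t, of x] B(2) by linarith
    show "\<bar>Dx F x t $ i $ i\<bar> \<le> B"
      using B3(2)[of x i] B(3) by linarith
  qed
  let ?P = "\<lambda>s x. Dt \<rho> x s * v x s + Dt v x s * \<rho> x s"
  have D: "((\<lambda>s. \<integral>x. \<rho> x s * v x s \<partial>cell_measure) has_real_derivative (\<integral>x. ?P t x \<partial>cell_measure)) (at t)"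
      "integrable cell_measure (?P t)"
  proof -
    have 1: "integrable cell_measure (\<lambda>x. \<rho> x r * v x r)" if "0 < r" "r < T" for r
    proof (rule integrable_cell[of _ "B2 * B1"])
      show "(\<lambda>x. \<rho> x r * v x r) \<in> borel_measurable borel"
        using regular_slice_measurable(1)[OF v, of r] regular_slice_measurable(1)[OF \<rho>, of r] that by (intro borel_measurable_times) auto
      show "\<bar>\<rho> x r * v x r\<bar> \<le> B2 * B1" for x
        unfolding abs_mult using B2(1,2) B1(1,2) that by (intro mult_mono) auto
    qed
    have 2: "((\<lambda>r. \<rho> x r * v x r) has_real_derivative ?P r x) (at r)" if "0 < r" "r < T" for r x
      using that by (intro DERIV_mult regular_DERIV_t[OF v] regular_DERIV_t[OF \<rho>]) auto
    have 3: "\<bar>?P r x\<bar> \<le> B2 * B1 + B1 * B2" if "0 < r" "r < T" for r x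
    proof -
      have r: "r \<in> {0<..<T}" "r \<in> {0..T}" using that by auto
      have "\<bar>Dt \<rho> x r * v x r\<bar> \<le> B2 * B1" "\<bar>Dt v x r * \<rho> x r\<bar> \<le> B1 * B2"
        unfolding abs_mult
        by (intro mult_mono B2(5)[OF r(1)] B1(2)[OF r(2) T] B1(5)[OF r(1)] B2(2)[OF r(2) T] B1(1) B2(1) abs_ge_zero)+
      then show ?thesis by linarith
    qed
    have 4: "integrable cell_measure (\<lambda>x::real^'d. B2 * B1 + B1 * B2)"
      by (rule integrable_cell[of _ "\<bar>B2 * B1 + B1 * B2\<bar>"]) auto
    note U = has_derivative_under_integral[of 0 t T cell_measure "\<lambda>r x. \<rho> x r * v x r" ?P "\<lambda>_. B2 * B1 + B1 * B2", OF _ _ 1 2 3 4]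
    show "((\<lambda>s. \<integral>x. \<rho> x s * v x s \<partial>cell_measure) has_real_derivative (\<integral>x. ?P t x \<partial>cell_measure)) (at t)"
      using U(1) t by simp
    show "integrable cell_measure (?P t)" using U(2) t by simp
  qed
  let ?h = "\<lambda>i x. v x t * Dx \<rho> x t $ i - \<rho> x t * Dx v x t $ i + v x t * F x t $ i"
  let ?h' = "\<lambda>i x. v x t * Dx (Dx \<rho>) x t $ i $ i - \<rho> x t * Dx (Dx v) x t $ i $ i + (Dx v x t $ i * F x t $ i + v x t * Dx F x t $ i $ i)"
  have H: "integrable cell_measure (?h' i)" "(\<integral>x. ?h' i x \<partial>cell_measure) = 0" for i
  proof -
    have m: "?h i \<in> borel_measurable borel"
      using regular_slice_measurable(1,4)[OF v t] regular_slice_measurable(1,4)[OF \<rho> t]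
        measurable_compose[OF flux_measurable[OF F t] borel_measurable_component] by measurable
    have bb: "\<bar>a * b\<bar> \<le> B * B" if "\<bar>a\<bar> \<le> B" "\<bar>b\<bar> \<le> B" for a b
      unfolding abs_mult using that B0 by (intro mult_mono) auto
    have b1: "\<bar>?h i x\<bar> \<le> 3 * (B * B)" for x
      using bb[OF bd(1,4), of x x i] bb[OF bd(2,3), of x x i] bb[OF bd(1,5), of x x i] by linarith
    have b2: "\<bar>?h' i x\<bar> \<le> 4 * (B * B)" for x
      using bb[OF bd(1,7), of x x i] bb[OF bd(2,6), of x x i] bb[OF bd(3,5), of x i x i] bb[OF bd(1,8), of x x i] by linarith
    have dh: "((\<lambda>s. ?h i (x + s *\<^sub>R axis i 1)) has_real_derivative ?h' i x) (at 0)" for x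
      by (rule derivative_eq_intros regular_DERIV_x[OF v t] regular_DERIV_x[OF \<rho> t] flux_DERIV[OF F t] refl)+ simp
    have per: "periodic (?h i)"
      using regular_periodic[OF v t'] regular_periodic[OF \<rho> t'] periodic_Dx[OF v t] periodic_Dx[OF \<rho> t] F t
      by (simp add: periodic_def flux_def)
    show "integrable cell_measure (?h' i)" "(\<integral>x. ?h' i x \<partial>cell_measure) = 0"
      using integral_cell_partial_eq_0[OF m b1 b2 dh per] by auto
  qed
  have id: "?P t x = (\<Sum>i\<in>UNIV. ?h' i x) - X x" for x
  proof -
    have a: "Dt \<rho> x t = laplacian \<rho> x t + divergence F x t" using eq[OF t, of x] by simp
    have "(\<Sum>i\<in>UNIV. ?h' i x) = v x t * laplacian \<rho> x t - \<rho> x t * laplacian v x t + (Dx v x t \<bullet> F x t + v x t * divergence F x t)"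
      by (simp add: laplacian_def divergence_def trace_def inner_vec_def sum.distrib sum_subtractf sum_distrib_left)
    then show ?thesis unfolding X_def a by (simp add: algebra_simps)
  qed
  have iS: "integrable cell_measure (\<lambda>x. \<Sum>i\<in>UNIV. ?h' i x)"
    by (rule Bochner_Integration.integrable_sum) (rule H)
  have X: "X = (\<lambda>x. (\<Sum>i\<in>UNIV. ?h' i x) - ?P t x)" using id by auto
  show iX: "integrable cell_measure X"
    unfolding X by (rule Bochner_Integration.integrable_diff[OF iS D(2)])
  have "(\<integral>x. ?P t x \<partial>cell_measure) = (\<integral>x. (\<Sum>i\<in>UNIV. ?h' i x) \<partial>cell_measure) - (\<integral>x. X x \<partial>cell_measure)"
    unfolding id by (rule Bochner_Integration.integral_diff[OF iS iX])
  also have "(\<integral>x. (\<Sum>i\<in>UNIV. ?h' i x) \<partial>cell_measure) = 0"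
    by (subst Bochner_Integration.integral_sum) (auto simp: H)
  finally show "((\<lambda>t. \<integral>x. \<rho> x t * v x t \<partial>cell_measure) has_real_derivative - (\<integral>x. X x \<partial>cell_measure)) (at t)"
    using D(1) by simp
qed

lemma energy_continuous:
  fixes v \<rho> :: "real^'d \<Rightarrow> real \<Rightarrow> real"
  assumes v: "regular T v" and \<rho>: "regular T \<rho>" and T: "0 < T"
  shows "continuous_on {0..T} (\<lambda>t. \<integral>x. \<rho> x t * v x t \<partial>cell_measure)"
proof -
  obtain B1 where B1: "B1 \<ge> 0" "\<And>x t. t \<in> {0..T} \<Longrightarrow> 0 < T \<Longrightarrow> \<bar>v x t\<bar> \<le> B1"
    by (rule regular_bounded[OF v]) (rule that)
  obtain B2 where B2: "B2 \<ge> 0" "\<And>x t. t \<in> {0..T} \<Longrightarrow> 0 < T \<Longrightarrow> \<bar>\<rho> x t\<bar> \<le> B2"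
    by (rule regular_bounded[OF \<rho>]) (rule that)
  have c: "continuous_on {0..T} (\<lambda>t. w x t)" if "regular T w" for w and x :: "real^'d"
    by (rule continuous_on_compose2[OF regular_continuous_on(1)[OF that], of _ "\<lambda>t. (x, t)", simplified])
      (auto intro!: continuous_intros)
  show ?thesis
  proof (rule continuous_on_integral_dominated[where W="\<lambda>_. B2 * B1"])
    show "(\<lambda>x. \<rho> x t * v x t) \<in> borel_measurable cell_measure" if "t \<in> {0..T}" for t
      using regular_continuous_slice(1)[OF v that] regular_continuous_slice(1)[OF \<rho> that]
      by (intro measurable_restrict_space1 borel_measurable_times borel_measurable_continuous_onI) (auto dest: borel_measurable_continuous_onI)
    show "integrable cell_measure (\<lambda>_::real^'d. B2 * B1)"
      by (rule integrable_cell[of _ "\<bar>B2 * B1\<bar>"]) auto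
    show "\<bar>\<rho> x t * v x t\<bar> \<le> B2 * B1" if "t \<in> {0..T}" for x t
      unfolding abs_mult using B1 B2 T that by (intro mult_mono) auto
    show "continuous_on {0..T} (\<lambda>t. \<rho> x t * v x t)" for x
      by (intro continuous_on_mult c v \<rho>)
  qed
qed

text \<open>
  The linearised system with its data hidden in inequalities. The fluxes and sources are bounded by the
  unknowns with constant \<open>L\<close> and by the size \<open>D\<close> of the data; the last condition is coercivity of the
  monotonicity form with constant \<open>c\<close>, again up to the data.
\<close>

definition linear_problem ::
  "real \<Rightarrow> real \<Rightarrow> real \<Rightarrow> real \<Rightarrow> (real^'d \<Rightarrow> real \<Rightarrow> real) \<Rightarrow> (real^'d \<Rightarrow> real \<Rightarrow> real) \<Rightarrow>
     (real^'d \<Rightarrow> real \<Rightarrow> real^'d) \<Rightarrow> bool" where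
  "linear_problem T L c D v \<rho> F \<longleftrightarrow>
     regular T v \<and> regular T \<rho> \<and> flux T F \<and> (\<forall>x. v x T = 0 \<and> \<rho> x 0 = 0) \<and>
     (\<forall>x. \<forall>t\<in>{0<..<T}.
        Dt \<rho> x t - laplacian \<rho> x t = divergence F x t \<and>
        norm (F x t) \<le> L * (\<bar>\<rho> x t\<bar> + norm (Dx v x t)) + D \<and>
        \<bar>- Dt v x t - laplacian v x t\<bar> \<le> L * (\<bar>\<rho> x t\<bar> + norm (Dx v x t)) + D) \<and>
     (\<forall>x\<in>cell. \<forall>t\<in>{0<..<T}.
        c * ((\<rho> x t)\<^sup>2 + (norm (Dx v x t))\<^sup>2) - D * (\<bar>\<rho> x t\<bar> + norm (Dx v x t))
          \<le> Dx v x t \<bullet> F x t + \<rho> x t * (- Dt v x t - laplacian v x t))"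

text \<open>
  Put \<open>W = |\<rho>| + |Dv|\<close> and let \<open>E\<close> be the cell integral of \<open>\<rho> v\<close>. Completing the square in the coercivity
  condition bounds the cell integral of \<open>W\<close> by the derivative of \<open>N = - E / D + 2 D t / c\<close>, and \<open>N\<close> increases
  by \<open>2 D T / c\<close> in total since \<open>E\<close> vanishes at both ends. Then \<open>dominated_path_bound\<close> for \<open>\<rho>\<close> and the \<open>d\<close>
  components of \<open>Dv\<close> with \<open>\<kappa> = 1 / (2 (1 + d))\<close> gives \<open>S \<le> S / 2 + C D\<close> for the supremum \<open>S\<close> of \<open>W\<close>.
\<close>

lemma linear_problem_stability:
  fixes T L c :: real
  assumes T: "T > 0" and L: "L \<ge> 0" and c: "c > 0"
  shows "\<exists>C>0. \<forall>D v \<rho> F. D > 0 \<longrightarrow> linear_problem T L c D v \<rho> F \<longrightarrow>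
    (\<forall>x::real^'d. \<forall>t\<in>{0<..<T}. \<bar>v x t\<bar> \<le> C * D \<and> norm (Dx v x t) \<le> C * D \<and> \<bar>\<rho> x t\<bar> \<le> C * D)"
proof -
  define d where "d = real CARD('d)"
  have d: "d \<ge> 1" unfolding d_def by (simp add: Suc_le_eq)
  define \<kappa> where "\<kappa> = 1 / (2 * (1 + d))"
  have \<kappa>: "\<kappa> > 0" using d by (simp add: \<kappa>_def)
  obtain C0 where C0: "C0 \<ge> 0" "\<And>\<tau> t0 a W D S N N'. \<And>x0::real^'d.
    (\<tau> = 1 \<or> \<tau> = -1) \<Longrightarrow> t0 \<in> {0<..<T} \<Longrightarrow> dominated_path T \<tau> t0 x0 (\<lambda>x t. L * W x t + D) a \<Longrightarrow> D \<ge> 0 \<Longrightarrow>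
    (\<forall>t\<in>{0<..<T}. (\<lambda>x. W x t) \<in> borel_measurable borel \<and> periodic (\<lambda>x. W x t) \<and> (\<forall>x. 0 \<le> W x t \<and> W x t \<le> S)) \<Longrightarrow>
    continuous_on {0..T} N \<Longrightarrow> (\<forall>t\<in>{0<..<T}. (N has_real_derivative N' t) (at t) \<and> (\<integral>x. W x t \<partial>cell_measure) \<le> N' t) \<Longrightarrow>
    \<bar>a\<bar> \<le> \<kappa> * S + C0 * (D + (N T - N 0))"
    using dominated_path_bound[OF T L \<kappa>, where 'd='d] by blast
  define C1 where "C1 = 2 * ((1 + d) * (C0 * (1 + 2 / c * T)))"
  have C1: "C1 \<ge> 0" using d C0(1) c T by (simp add: C1_def)
  define C where "C = C1 + T * (L * C1 + 1)"
  have C: "C > 0" "C1 \<le> C" "T * (L * C1 + 1) \<le> C" using C1 T L by (auto simp: C_def add_nonneg_pos)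
  have main: "\<bar>v x0 t0\<bar> \<le> C * D \<and> norm (Dx v x0 t0) \<le> C * D \<and> \<bar>\<rho> x0 t0\<bar> \<le> C * D"
    if t0: "t0 \<in> {0<..<T}" and v: "regular T v" and \<rho>: "regular T \<rho>" and F: "flux T F"
      and vT: "\<And>x. v x T = 0" and \<rho>0: "\<And>x. \<rho> x 0 = 0" and D: "D > 0"
      and eq: "\<And>x t. t \<in> {0<..<T} \<Longrightarrow> Dt \<rho> x t - laplacian \<rho> x t = divergence F x t"
      and FL: "\<And>x t. t \<in> {0<..<T} \<Longrightarrow> norm (F x t) \<le> L * (\<bar>\<rho> x t\<bar> + norm (Dx v x t)) + D"
      and gL: "\<And>x t. t \<in> {0<..<T} \<Longrightarrow> \<bar>- Dt v x t - laplacian v x t\<bar> \<le> L * (\<bar>\<rho> x t\<bar> + norm (Dx v x t)) + D"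
      and coer: "\<And>x t. x \<in> cell \<Longrightarrow> t \<in> {0<..<T} \<Longrightarrow> c * ((\<rho> x t)\<^sup>2 + (norm (Dx v x t))\<^sup>2) - D * (\<bar>\<rho> x t\<bar> + norm (Dx v x t))
        \<le> Dx v x t \<bullet> F x t + \<rho> x t * (- Dt v x t - laplacian v x t)"
    for v \<rho> F D and x0 :: "real^'d" and t0
  proof -
    let ?W = "\<lambda>x t. \<bar>\<rho> x t\<bar> + norm (Dx v x t)"
    obtain B1 where B1: "B1 \<ge> 0" "\<And>x t. t \<in> {0<..<T} \<Longrightarrow> norm (Dx v x t) \<le> B1"
      by (rule regular_bounded[OF v]) (rule that)
    obtain B2 where B2: "B2 \<ge> 0" "\<And>x t. t \<in> {0..T} \<Longrightarrow> 0 < T \<Longrightarrow> \<bar>\<rho> x t\<bar> \<le> B2"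
      by (rule regular_bounded[OF \<rho>]) (rule that)
    define S where "S = (SUP (x, t) \<in> UNIV \<times> {0<..<T}. ?W x t)"
    have Wb: "?W x t \<le> B2 + B1" if "t \<in> {0<..<T}" for x t
      using B1(2)[OF that, of x] B2(2)[of t x] that T by auto
    have bdd: "bdd_above ((\<lambda>(x, t). ?W x t) ` (UNIV \<times> {0<..<T}))"
      by (rule bdd_aboveI2[where M="B2 + B1"]) (use Wb in auto)
    have WS: "?W x t \<le> S" if "t \<in> {0<..<T}" for x t
      unfolding S_def using that by (intro cSUP_upper2[OF bdd, of "(x, t)"]) auto
    have S0: "S \<ge> 0" by (rule order_trans[OF _ WS[OF t0, of x0]]) simp
    have Wm: "(\<lambda>x. ?W x t) \<in> borel_measurable borel" if "t \<in> {0<..<T}" for t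
      using regular_slice_measurable(1)[OF \<rho> that] regular_slice_measurable(2)[OF v that] by measurable
    have Wp: "periodic (\<lambda>x. ?W x t)" if "t \<in> {0<..<T}" for t
      using regular_periodic[OF \<rho>, of t] periodic_Dx[OF v that] that by (auto simp: periodic_def)
    let ?h = "\<lambda>x t. L * ?W x t + D"
    have hm: "(\<lambda>x. ?h x t) \<in> borel_measurable borel" if "t \<in> {0<..<T}" for t
      using Wm[OF that] by measurable
    have h0: "0 \<le> ?h x t" for x t using L D by (intro add_nonneg_nonneg mult_nonneg_nonneg) auto
    have hb: "\<bar>?h x t\<bar> \<le> L * S + D" if "t \<in> {0<..<T}" for x t
      using h0[of x t] mult_left_mono[OF WS[OF that, of x] L] by simp
    let ?E = "\<lambda>t. \<integral>x. \<rho> x t * v x t \<partial>cell_measure"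
    let ?X = "\<lambda>t x. Dx v x t \<bullet> F x t + \<rho> x t * (- Dt v x t - laplacian v x t)"
    let ?N = "\<lambda>t. - ?E t / D + 2 / c * D * t"
    let ?N' = "\<lambda>t. (\<integral>x. ?X t x \<partial>cell_measure) / D + 2 / c * D"
    have Ncont: "continuous_on {0..T} ?N"
      by (intro continuous_intros energy_continuous[OF v \<rho> T]) (use D in auto)
    have NT: "?N T - ?N 0 = 2 / c * D * T" by (simp add: vT \<rho>0)
    have ND: "(?N has_real_derivative ?N' t) (at t)" if t: "t \<in> {0<..<T}" for t
    proof -
      have "((\<lambda>t. - ?E t / D + 2 / c * D * t) has_real_derivative - (- (\<integral>x. ?X t x \<partial>cell_measure)) / D + 2 / c * D * 1) (at t)"
        by (intro DERIV_add DERIV_cdivide DERIV_minus DERIV_cmult DERIV_ident energy_identity(1)[OF v \<rho> F eq t])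
      then show ?thesis by simp
    qed
    have NW: "(\<integral>x. ?W x t \<partial>cell_measure) \<le> ?N' t" if t: "t \<in> {0<..<T}" for t
    proof -
      have iX: "integrable cell_measure (?X t)" by (rule energy_identity(2)[OF v \<rho> F eq t])
      have iW: "integrable cell_measure (\<lambda>x. ?W x t)"
        by (rule integrable_cell[OF Wm[OF t], of S]) (use WS[OF t] in auto)
      have i1: "integrable cell_measure (\<lambda>x::real^'d. 2 / c * D)"
        by (rule integrable_cell[of _ "2 / c * D"]) (use c D in auto)
      have "(\<integral>x. ?W x t \<partial>cell_measure) \<le> (\<integral>x. ?X t x / D + 2 / c * D \<partial>cell_measure)"
      proof (rule integral_mono[OF iW])
        show "integrable cell_measure (\<lambda>x. ?X t x / D + 2 / c * D)"
          by (intro Bochner_Integration.integrable_add i1 integrable_divide iX) 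
        fix x assume "x \<in> space (cell_measure :: (real^'d) measure)"
        then have x: "x \<in> cell" by simp
        let ?a = "\<bar>\<rho> x t\<bar>" and ?b = "norm (Dx v x t)"
        have "0 \<le> (?a - ?b)\<^sup>2" by simp
        then have "(?W x t)\<^sup>2 \<le> 2 * ((\<rho> x t)\<^sup>2 + ?b\<^sup>2)" by (simp add: power2_eq_square algebra_simps)
        then have "c / 2 * (?W x t)\<^sup>2 \<le> c / 2 * (2 * ((\<rho> x t)\<^sup>2 + ?b\<^sup>2))"
          using c by (intro mult_left_mono) auto
        also have "\<dots> = c * ((\<rho> x t)\<^sup>2 + ?b\<^sup>2)" by simp
        finally have 1: "c / 2 * (?W x t)\<^sup>2 - D * ?W x t \<le> ?X t x" using coer[OF x t] by linarith
        \<comment> \<open>the square is completed so that the left-hand side becomes linear in \<open>W\<close>\<close>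
        have "0 \<le> c / 2 * (?W x t - 2 * D / c)\<^sup>2" using c by simp
        also have "c / 2 * (?W x t - 2 * D / c)\<^sup>2 = c / 2 * (?W x t)\<^sup>2 - 2 * D * ?W x t + 2 / c * D * D"
          using c by (simp add: power2_eq_square field_simps)
        finally have "D * ?W x t \<le> ?X t x + 2 / c * D * D" using 1 by linarith
        then show "?W x t \<le> ?X t x / D + 2 / c * D" using D by (simp add: field_simps)
      qed
      also have "\<dots> = (\<integral>x. ?X t x \<partial>cell_measure) / D + (\<integral>x. 2 / c * D \<partial>(cell_measure :: (real^'d) measure))"
      proof -
        have "integrable cell_measure (\<lambda>x. ?X t x / D)" by (intro integrable_divide iX)
        from Bochner_Integration.integral_add[OF this i1] show ?thesis by (simp only: integral_divide_zero)
      qed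
      also have "(\<integral>x. 2 / c * D \<partial>(cell_measure :: (real^'d) measure)) \<le> 2 / c * D"
        using measure_cell_le[where 'd='d] c D by (simp add: mult_left_le mult_right_le_one_le divide_right_mono)
      finally show ?thesis by simp
    qed
    have path_bound: "\<bar>a\<bar> \<le> \<kappa> * S + C0 * (1 + 2 / c * T) * D"
      if "\<tau> = 1 \<or> \<tau> = -1" "t \<in> {0<..<T}" "dominated_path T \<tau> t x ?h a" for \<tau> t a and x :: "real^'d"
    proof -
      have "\<bar>a\<bar> \<le> \<kappa> * S + C0 * (D + (?N T - ?N 0))"
        by (rule C0(2)[OF that, where N'="?N'"]) (use D Wm Wp WS Ncont ND NW in auto)
      then show ?thesis unfolding NT by (simp add: algebra_simps)
    qed
    have r: "\<bar>\<rho> x t\<bar> \<le> \<kappa> * S + C0 * (1 + 2 / c * T) * D" if t: "t \<in> {0<..<T}" for x t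
      by (rule path_bound[of 1, OF _ t], simp, rule dominated_path_divergence[OF \<rho> _ t _ F, where Bh="L * S + D"])
        (use \<rho>0 eq FL hm hb in \<open>auto simp: end_time_def\<close>)
    have g: "norm (Dx v x t) \<le> d * (\<kappa> * S + C0 * (1 + 2 / c * T) * D)" if t: "t \<in> {0<..<T}" for x t
    proof -
      have "\<bar>Dx v x t $ i\<bar> \<le> \<kappa> * S + C0 * (1 + 2 / c * T) * D" for i
        by (rule path_bound[of "-1", OF _ t], simp, rule dominated_path_gradient[OF v _ t, where Bh="L * S + D"])
          (use vT gL hm hb in \<open>auto simp: end_time_def\<close>)
      then have "(\<Sum>i\<in>UNIV. \<bar>Dx v x t $ i\<bar>) \<le> (\<Sum>i\<in>(UNIV::'d set). \<kappa> * S + C0 * (1 + 2 / c * T) * D)"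
        by (intro sum_mono)
      then show ?thesis using norm_le_l1_cart[of "Dx v x t"] by (simp add: d_def)
    qed
    have W': "?W x t \<le> S / 2 + C1 / 2 * D" if t: "t \<in> {0<..<T}" for x t
    proof -
      have "?W x t \<le> (1 + d) * (\<kappa> * S + C0 * (1 + 2 / c * T) * D)"
        using r[OF t, of x] g[OF t, of x] unfolding distrib_right[of 1 d] mult_1 by linarith
      also have "\<dots> = (1 + d) * \<kappa> * S + C1 / 2 * D" by (simp add: C1_def algebra_simps)
      also have "(1 + d) * \<kappa> = 1 / 2" using d by (simp add: \<kappa>_def field_simps)
      finally show ?thesis by simp
    qed
    have "S \<le> S / 2 + C1 / 2 * D"
    proof -
      have "(SUP (x, t) \<in> UNIV \<times> {0<..<T}. ?W x t) \<le> S / 2 + C1 / 2 * D"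
        by (rule cSUP_least) (use t0 W' in auto)
      then show ?thesis unfolding S_def[symmetric] .
    qed
    then have S: "S \<le> C1 * D" by simp
    have "\<bar>v x0 t0\<bar> \<le> T * (L * S + D)"
    proof (rule heat_sup_bound[OF v _ t0, of "-1"])
      show "\<bar>-1 * Dt v x t - laplacian v x t\<bar> \<le> L * S + D" if "t \<in> {0<..<T}" for x t
        using gL[OF that, of x] mult_left_mono[OF WS[OF that, of x] L] by simp
    qed (auto simp: end_time_def vT)
    also have "\<dots> \<le> T * (L * (C1 * D) + D)"
      using T L S by (intro mult_left_mono add_mono) auto
    also have "\<dots> = T * (L * C1 + 1) * D" by (simp add: algebra_simps)
    also have "\<dots> \<le> C * D" using C(3) D by (intro mult_right_mono) auto
    finally have 1: "\<bar>v x0 t0\<bar> \<le> C * D" .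
    have "S \<le> C * D" by (rule order_trans[OF S mult_right_mono[OF C(2)]]) (use D in simp)
    then show ?thesis using 1 WS[OF t0, of x0] norm_ge_zero[of "Dx v x0 t0"] abs_ge_zero[of "\<rho> x0 t0"] by linarith
  qed
  show ?thesis
  proof (intro exI[of _ C] conjI C(1) allI impI ballI)
    fix D t and v \<rho> :: "real^'d \<Rightarrow> real \<Rightarrow> real" and F and x :: "real^'d"
    assume "D > 0" "linear_problem T L c D v \<rho> F" "t \<in> {0<..<T}"
    then show "\<bar>v x t\<bar> \<le> C * D" "norm (Dx v x t) \<le> C * D" "\<bar>\<rho> x t\<bar> \<le> C * D"
      using main[of t v \<rho> F D x] unfolding linear_problem_def by blast+
  qed
qed

section \<open>Periodicity and Lipschitz bounds on the phase space\<close>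

lemma phase_iff: "z \<in> phase \<longleftrightarrow> 0 \<le> fst (snd z)"
  by (cases z) (auto simp: phase_def)

lemma phase_basis:
  assumes z: "z \<in> (phase :: ((real^'d) \<times> real \<times> (real^'d)) set)" and i: "i \<in> Basis" and e: "e > 0"
  shows "\<exists>d. 0 < \<bar>d\<bar> \<and> \<bar>d\<bar> < e \<and> z + d *\<^sub>R i \<in> phase"
proof (intro exI conjI)
  have "0 \<le> fst (snd i)"
    using i by (auto simp: Basis_prod_def)
  then show "z + (e / 2) *\<^sub>R i \<in> phase"
    using z e by (simp add: phase_iff)
qed (use e in auto)

text \<open>
  From every point of the phase space a segment in each coordinate direction stays inside, so derivatives
  within it are unique, also where the density vanishes.
\<close>

lemma frechet_derivative_phase:
  fixes F :: "(real^'d) \<times> real \<times> (real^'d) \<Rightarrow> 'b::real_normed_vector"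
  assumes "(F has_derivative F') (at z within phase)" "z \<in> phase"
  shows "frechet_derivative F (at z within phase) = F'"
proof (rule frechet_derivative_unique_within)
  show "(F has_derivative frechet_derivative F (at z within phase)) (at z within phase)"
    using assms(1) by (auto simp: frechet_derivative_works[symmetric] differentiable_def)
  show "(F has_derivative F') (at z within phase)" by fact
  show "\<exists>d. 0 < \<bar>d\<bar> \<and> \<bar>d\<bar> < e \<and> z + d *\<^sub>R i \<in> phase" if "i \<in> Basis" "0 < e" for i e
    by (rule phase_basis[OF assms(2) that])
qed

definition x_periodic :: "((real^'d) \<times> real \<times> (real^'d) \<Rightarrow> 'b) \<Rightarrow> bool" where
  "x_periodic F \<longleftrightarrow> (\<forall>z\<in>phase. \<forall>k\<in>int_lattice. F (z + (k, 0, 0)) = F z)"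

text \<open>
  Periodicity in \<open>x\<close> passes to derivatives of all orders; this makes their bounds on the compact period
  cell uniform in \<open>x\<close>.
\<close>

lemma x_periodic_frechet_derivative:
  fixes F :: "(real^'d) \<times> real \<times> (real^'d) \<Rightarrow> 'b::real_normed_vector"
  assumes per: "x_periodic F" and F: "F differentiable_on phase"
  shows "x_periodic (\<lambda>z. frechet_derivative F (at z within phase))"
  unfolding x_periodic_def
proof (intro ballI)
  fix z k assume z: "z \<in> (phase :: ((real^'d) \<times> real \<times> (real^'d)) set)" and k: "k \<in> (int_lattice :: (real^'d) set)"
  let ?k = "(k, 0, 0) :: (real^'d) \<times> real \<times> (real^'d)"
  have zk: "z + ?k \<in> phase" using z by (simp add: phase_iff)
  have 1: "(F has_derivative frechet_derivative F (at (z + ?k) within phase)) (at (z + ?k) within phase)"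
    using F zk by (auto simp: differentiable_on_def frechet_derivative_works[symmetric])
  have img: "(\<lambda>y. y + ?k) ` phase \<subseteq> phase" by (auto simp: phase_iff)
  have 2: "((\<lambda>y. y + ?k) has_derivative (\<lambda>h. h)) (at z within phase)"
    using has_derivative_add_const[OF has_derivative_ident, of ?k "at z within phase"] by simp
  have "((\<lambda>y. F (y + ?k)) has_derivative frechet_derivative F (at (z + ?k) within phase)) (at z within phase)"
    by (rule has_derivative_in_compose[OF 2 has_derivative_subset[OF 1 img], simplified])
  then have "(F has_derivative frechet_derivative F (at (z + ?k) within phase)) (at z within phase)"
    by (rule has_derivative_transform[OF z, rotated]) (use per k in \<open>auto simp: x_periodic_def\<close>)
  from frechet_derivative_phase[OF this z]
  show "frechet_derivative F (at (z + ?k) within phase) = frechet_derivative F (at z within phase)" by simp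
qed

lemma Ck_on_Suc_imp: "Ck_on (Suc k) S F \<Longrightarrow> Ck_on k S F"
proof (induction k arbitrary: F)
  case 0
  then show ?case by (simp add: differentiable_imp_continuous_on)
next
  case (Suc k)
  then show ?case by (simp only: Ck_on.simps(2)) blast
qed

lemma Ck_on_le: "Ck_on n S F \<Longrightarrow> k \<le> n \<Longrightarrow> Ck_on k S F"
  by (induction n) (auto simp: le_Suc_eq dest: Ck_on_Suc_imp simp del: Ck_on.simps)

definition slab :: "real \<Rightarrow> ((real^'d) \<times> real \<times> (real^'d)) set" where
  "slab A = UNIV \<times> {0..A} \<times> cball 0 A"

lemma slab_phase: "slab A \<subseteq> phase" by (auto simp: slab_def phase_def)

lemma convex_slab: "convex (slab A)"
  unfolding slab_def by (intro convex_Times) auto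

lemma lattice_reduce:
  fixes x :: "real^'d"
  obtains k where "k \<in> int_lattice" "x + k \<in> cell"
proof
  let ?k = "- (\<chi> i. of_int \<lfloor>x $ i\<rfloor>) :: real^'d"
  show "?k \<in> int_lattice" by (auto simp: int_lattice_def)
  show "x + ?k \<in> cell" by (auto simp: cell_def) (linarith+)
qed

lemma cell_subset_cbox: "cell \<subseteq> cbox (0::real^'d) (\<chi> i. 1)"
  by (auto simp: cell_def mem_box_cart less_imp_le)

lemma x_periodic_bounded:
  fixes F :: "(real^'d) \<times> real \<times> (real^'d) \<Rightarrow> 'b::real_normed_vector"
  assumes per: "x_periodic F" and c: "continuous_on phase F"
  shows "\<exists>B. \<forall>z\<in>slab A. norm (F z) \<le> B"
proof -
  let ?K = "cbox (0::real^'d) (\<chi> i. 1) \<times> {0..A} \<times> cball (0::real^'d) A"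
  have "compact (F ` ?K)"
    by (intro compact_continuous_image continuous_on_subset[OF c] compact_Times) (auto simp: phase_def)
  then have "bounded (F ` ?K)" by (rule compact_imp_bounded)
  then obtain B where B: "\<And>y. y \<in> F ` ?K \<Longrightarrow> norm y \<le> B" by (auto simp: bounded_iff)
  have "norm (F z) \<le> B" if z: "z \<in> slab A" for z
  proof -
    obtain k where k: "k \<in> int_lattice" "fst z + k \<in> cell" by (rule lattice_reduce)
    have "F z = F (z + (k, 0, 0))" using per k z slab_phase[of A] by (auto simp: x_periodic_def)
    moreover have "z + (k, 0, 0) \<in> ?K"
      using subsetD[OF cell_subset_cbox k(2)] z by (auto simp: slab_def)
    ultimately show ?thesis using B by auto
  qed
  then show ?thesis by blast
qed

abbreviation pderiv_phase where
  "pderiv_phase b F \<equiv> (\<lambda>z. frechet_derivative F (at z within phase) b)"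

lemma x_periodic_pderiv:
  assumes "Ck_on (Suc k) phase F" "x_periodic F"
  shows "x_periodic (pderiv_phase b F)"
  using x_periodic_frechet_derivative[OF assms(2)] assms(1) by (simp add: x_periodic_def)

lemma has_derivative_phase:
  assumes "Ck_on (Suc k) phase F" "z \<in> phase"
  shows "(F has_derivative frechet_derivative F (at z within phase)) (at z within phase)"
  using assms by (auto simp: differentiable_on_def frechet_derivative_works[symmetric])

lemma norm_linear_le_sum:
  fixes f :: "'a::euclidean_space \<Rightarrow> real"
  assumes "bounded_linear f" "\<And>b. b \<in> Basis \<Longrightarrow> \<bar>f b\<bar> \<le> B"
  shows "onorm f \<le> real DIM('a) * B"
proof (rule onorm_le)
  interpret bounded_linear f by fact
  fix x
  have "f x = (\<Sum>b\<in>Basis. (x \<bullet> b) * f b)"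
    by (subst euclidean_representation[of x, symmetric]) (simp add: sum scaleR)
  then have "norm (f x) \<le> (\<Sum>b\<in>Basis. \<bar>(x \<bullet> b) * f b\<bar>)" by simp
  also have "\<dots> \<le> (\<Sum>b\<in>(Basis::'a set). norm x * B)"
    unfolding abs_mult by (intro sum_mono mult_mono assms Basis_le_norm) auto
  finally show "norm (f x) \<le> real DIM('a) * B * norm x" by (simp add: mult_ac)
qed

lemma slab_bounded:
  assumes "Ck_on k phase F" "x_periodic F"
  shows "\<exists>B\<ge>0. \<forall>z\<in>slab A. \<bar>F z\<bar> \<le> B"
proof -
  have "continuous_on phase F" using Ck_on_le[OF assms(1), of 0] by simp
  from x_periodic_bounded[OF assms(2) this, of A] obtain B where "\<forall>z\<in>slab A. \<bar>F z\<bar> \<le> B" by auto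
  then show ?thesis by (intro exI[of _ "max B 0"]) auto
qed

lemma slab_lipschitz:
  fixes F :: "(real^'d) \<times> real \<times> (real^'d) \<Rightarrow> real"
  assumes F: "Ck_on (Suc k) phase F" and per: "x_periodic F"
  shows "\<exists>B\<ge>0. \<forall>z\<in>slab A. \<forall>z'\<in>slab A. \<bar>F z - F z'\<bar> \<le> B * norm (z - z')"
proof -
  have "\<forall>b. \<exists>B. b \<in> Basis \<longrightarrow> (B \<ge> 0 \<and> (\<forall>z\<in>slab A. \<bar>pderiv_phase b F z\<bar> \<le> B))"
    using slab_bounded[OF _ x_periodic_pderiv[OF F per], of k] F by auto
  then obtain B where B: "\<And>b. b \<in> Basis \<Longrightarrow> B b \<ge> 0" "\<And>b z. b \<in> Basis \<Longrightarrow> z \<in> slab A \<Longrightarrow> \<bar>pderiv_phase b F z\<bar> \<le> B b"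
    by metis
  let ?B = "\<Sum>b\<in>Basis. B b" and ?d = "real DIM((real^'d) \<times> real \<times> (real^'d))"
  have B': "\<bar>pderiv_phase b F z\<bar> \<le> ?B" if "b \<in> Basis" "z \<in> slab A" for b z
    using B(2)[OF that] member_le_sum[OF that(1), of B] B(1) by fastforce
  have "norm (F z - F z') \<le> ?d * ?B * norm (z - z')" if "z \<in> slab A" "z' \<in> slab A" for z z'
  proof (rule differentiable_bound[OF convex_slab _ _ that])
    fix y assume y: "y \<in> (slab A :: ((real^'d) \<times> real \<times> (real^'d)) set)"
    have D: "(F has_derivative frechet_derivative F (at y within phase)) (at y within phase)"
      by (rule has_derivative_phase[OF F]) (use y slab_phase in auto)
    show "(F has_derivative frechet_derivative F (at y within phase)) (at y within slab A)"
      by (rule has_derivative_subset[OF D slab_phase])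
    show "onorm (frechet_derivative F (at y within phase)) \<le> ?d * ?B"
      by (rule norm_linear_le_sum[OF has_derivative_bounded_linear[OF D]]) (use B' y in auto)
  qed
  moreover have "?d * ?B \<ge> 0" using B(1) by (auto intro!: sum_nonneg mult_nonneg_nonneg)
  ultimately show ?thesis by (intro exI[of _ "?d * ?B"]) auto
qed

lemma slab_taylor:
  fixes F :: "(real^'d) \<times> real \<times> (real^'d) \<Rightarrow> real"
  assumes F: "Ck_on (Suc (Suc k)) phase F" and per: "x_periodic F"
  shows "\<exists>B\<ge>0. \<forall>z\<in>slab A. \<forall>z'\<in>slab A.
    \<bar>F z - F z' - frechet_derivative F (at z' within phase) (z - z')\<bar> \<le> B * (norm (z - z'))\<^sup>2"
proof -
  have "\<forall>b. \<exists>B. b \<in> Basis \<longrightarrow> (B \<ge> 0 \<and> (\<forall>z\<in>slab A. \<forall>z'\<in>slab A. \<bar>pderiv_phase b F z - pderiv_phase b F z'\<bar> \<le> B * norm (z - z')))"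
    using slab_lipschitz[OF _ x_periodic_pderiv[OF F per], of k _ A] F by auto
  then obtain B where B: "\<And>b. b \<in> Basis \<Longrightarrow> B b \<ge> 0" "\<And>b z z'. b \<in> Basis \<Longrightarrow> z \<in> slab A \<Longrightarrow> z' \<in> slab A \<Longrightarrow>
      \<bar>pderiv_phase b F z - pderiv_phase b F z'\<bar> \<le> B b * norm (z - z')"
    by metis
  let ?B = "\<Sum>b\<in>Basis. B b" and ?d = "real DIM((real^'d) \<times> real \<times> (real^'d))"
  have B0: "?B \<ge> 0" using B(1) by (auto intro!: sum_nonneg)
  have "norm (F z - F z' - frechet_derivative F (at z' within phase) (z - z')) \<le> norm (z - z') * (?d * (?B * norm (z - z')))"
    if z: "z \<in> slab A" "z' \<in> slab A" for z z'
  proof -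
    have seg: "closed_segment z' z \<subseteq> slab A"
      by (rule closed_segment_subset[OF z(2,1) convex_slab])
    show ?thesis
    proof (rule differentiable_bound_linearization[where S="closed_segment z' z" and f'="\<lambda>y. frechet_derivative F (at y within phase)"])
      show "z' + t *\<^sub>R (z - z') \<in> closed_segment z' z" if "t \<in> {0..1}" for t
        using that by (auto simp: in_segment algebra_simps intro!: exI[of _ t])
      fix y assume y: "y \<in> closed_segment z' z"
      then have ys: "y \<in> slab A" using seg by auto
      have D: "(F has_derivative frechet_derivative F (at y within phase)) (at y within phase)" if "y \<in> slab A" for y
        by (rule has_derivative_phase[OF F]) (use that slab_phase in auto)
      show "(F has_derivative frechet_derivative F (at y within phase)) (at y within closed_segment z' z)"
        by (rule has_derivative_subset[OF D[OF ys]]) (use seg slab_phase in blast)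
      show "onorm (frechet_derivative F (at y within phase) - frechet_derivative F (at z' within phase)) \<le> ?d * (?B * norm (z - z'))"
      proof (rule norm_linear_le_sum)
        show "bounded_linear (frechet_derivative F (at y within phase) - frechet_derivative F (at z' within phase))"
          unfolding fun_diff_def by (intro bounded_linear_sub has_derivative_bounded_linear[OF D] ys z)
        fix b :: "(real^'d) \<times> real \<times> (real^'d)" assume b: "b \<in> Basis"
        have "\<bar>pderiv_phase b F y - pderiv_phase b F z'\<bar> \<le> B b * norm (y - z')" by (rule B(2)[OF b ys z(2)])
        also have "\<dots> \<le> ?B * norm (z - z')"
        proof (intro mult_mono)
          show "B b \<le> ?B" using member_le_sum[OF b, of B] B(1) by fastforce
          show "norm (y - z') \<le> norm (z - z')"
            using segment_bound(1)[OF y] by (simp add: norm_minus_commute)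
        qed (use B0 in auto)
        finally show "\<bar>(frechet_derivative F (at y within phase) - frechet_derivative F (at z' within phase)) b\<bar> \<le> ?B * norm (z - z')"
          by simp
      qed
    qed simp
  qed
  moreover have "?d * ?B \<ge> 0" using B0 by simp
  ultimately show ?thesis by (intro exI[of _ "?d * ?B"]) (auto simp: power2_eq_square mult_ac)
qed

section \<open>The derivatives of the Hamiltonian\<close>

lemma has_derivative_vec_componentwise:
  fixes G :: "'a::euclidean_space \<Rightarrow> real^'n"
  assumes "\<And>j. ((\<lambda>z. G z $ j) has_derivative G' j) (at z within S)"
  shows "(G has_derivative (\<lambda>h. \<chi> j. G' j h)) (at z within S)"
  by (subst has_derivative_componentwise_within)
    (auto simp: Basis_vec_def inner_axis assms)

lemma Suc_numerals: "Suc 1 = 2" "Suc 2 = 3" "Suc 3 = 4" by simp_all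

abbreviation "e_m \<equiv> (0, 1, 0) :: (real^'d) \<times> real \<times> (real^'d)"
abbreviation "e_p j \<equiv> (0, 0, axis j 1) :: (real^'d) \<times> real \<times> (real^'d)"

lemma e_Basis: "e_m \<in> (Basis :: ((real^'d) \<times> real \<times> (real^'d)) set)" "e_p (j::'d) \<in> Basis"
proof -
  have r: "(1::real, 0::real^'d) \<in> Basis" "(0::real, axis j 1 :: real^'d) \<in> Basis"
    by (auto simp: Basis_prod_def Basis_vec_def)
  show "e_m \<in> (Basis :: ((real^'d) \<times> real \<times> (real^'d)) set)" "e_p j \<in> Basis"
    unfolding Basis_prod_def[where 'a="real^'d" and 'b="real \<times> (real^'d)"] using r by auto
qed

lemma norm_vec_le:
  fixes x :: "real^'n"
  assumes "\<And>i. \<bar>x $ i\<bar> \<le> c"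
  shows "norm x \<le> real CARD('n) * c"
proof -
  have "norm x \<le> (\<Sum>i\<in>UNIV. \<bar>x $ i\<bar>)" by (rule norm_le_l1_cart)
  also have "\<dots> \<le> (\<Sum>i\<in>(UNIV::'n set). c)" by (intro sum_mono assms)
  finally show ?thesis by simp
qed

lemma norm_matrix_vector_le:
  fixes M :: "real^'n^'n"
  assumes "\<And>i j. \<bar>M $ i $ j\<bar> \<le> c"
  shows "norm (M *v q) \<le> real CARD('n) * (real CARD('n) * c) * norm q"
proof -
  have "\<bar>(M *v q) $ i\<bar> \<le> real CARD('n) * c * norm q" for i
  proof -
    have "\<bar>(M *v q) $ i\<bar> \<le> (\<Sum>j\<in>UNIV. \<bar>M $ i $ j * q $ j\<bar>)"
      unfolding matrix_vector_mult_def by simp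
    also have "\<dots> \<le> (\<Sum>j\<in>(UNIV::'n set). c * norm q)"
    proof (rule sum_mono)
      fix j
      have "0 \<le> c" using assms[of i j] by linarith
      then show "\<bar>M $ i $ j * q $ j\<bar> \<le> c * norm q"
        unfolding abs_mult by (intro mult_mono assms component_le_norm_cart) auto
    qed
    finally show ?thesis by simp
  qed
  from norm_vec_le[OF this] show ?thesis by (simp add: mult_ac)
qed

lemma linear_phase_expand:
  fixes f :: "(real^'d) \<times> real \<times> (real^'d) \<Rightarrow> real"
  assumes "bounded_linear f"
  shows "f (0, s, q) = s * f e_m + (\<Sum>i\<in>UNIV. q $ i * f (e_p i))"
proof -
  interpret bounded_linear f by fact
  have lin: "linear f" by (rule bounded_linear.linear[OF assms])
  have snd: "(0, 0, q) = (\<Sum>i\<in>UNIV. (q $ i) *\<^sub>R e_p i)"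
  proof -
    have "linear (\<lambda>q::real^'d. (0::real^'d, 0::real, q))" by (rule linearI) auto
    from linear_sum[OF this, of "\<lambda>i. q $ i *\<^sub>R axis i 1" UNIV]
    have "(0, 0, \<Sum>i\<in>UNIV. q $ i *\<^sub>R axis i 1) = (\<Sum>i\<in>UNIV. (0::real^'d, 0::real, q $ i *\<^sub>R axis i (1::real)))" .
    then show ?thesis using basis_expansion[of q] by (simp add: scalar_mult_eq_scaleR)
  qed
  have "(0, s, q) = s *\<^sub>R e_m + (0, 0, q)" by simp
  then have "f (0, s, q) = s * f e_m + f (0, 0, q)" by (simp only: add scaleR real_scaleR_def)
  also have "f (0, 0, q) = (\<Sum>i\<in>UNIV. q $ i * f (e_p i))" unfolding snd by (simp add: sum scaleR del: scaleR_Pair)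
  finally show ?thesis .
qed

lemma slab_family_bounds:
  fixes G :: "'i::finite \<Rightarrow> (real^'d) \<times> real \<times> (real^'d) \<Rightarrow> real"
  assumes G: "\<And>i. Ck_on (Suc k) phase (G i)" "\<And>i. x_periodic (G i)"
  shows "\<exists>B\<ge>0. \<forall>i. (\<forall>z\<in>slab A. \<bar>G i z\<bar> \<le> B) \<and> (\<forall>z\<in>slab A. \<forall>z'\<in>slab A. \<bar>G i z - G i z'\<bar> \<le> B * norm (z - z'))"
proof -
  obtain B1 where B1: "\<And>i. B1 i \<ge> 0" "\<And>i z. z \<in> slab A \<Longrightarrow> \<bar>G i z\<bar> \<le> B1 i"
    using slab_bounded[OF G, where A=A] by metis
  obtain B2 where B2: "\<And>i. B2 i \<ge> 0" "\<And>i z z'. z \<in> slab A \<Longrightarrow> z' \<in> slab A \<Longrightarrow> \<bar>G i z - G i z'\<bar> \<le> B2 i * norm (z - z')"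
    using slab_lipschitz[OF G, where A=A] by metis
  let ?B = "(\<Sum>i\<in>UNIV. B1 i) + (\<Sum>i\<in>UNIV. B2 i)"
  have s: "(\<Sum>i\<in>UNIV. B1 i) \<ge> 0" "(\<Sum>i\<in>UNIV. B2 i) \<ge> 0" using B1 B2 by (auto intro!: sum_nonneg)
  have le: "B1 i \<le> ?B" "B2 i \<le> ?B" for i
    using member_le_sum[of i UNIV B1] member_le_sum[of i UNIV B2] B1(1) B2(1) s by auto
  show ?thesis
  proof (intro exI[of _ ?B] conjI allI ballI)
    show "?B \<ge> 0" using s by simp
    show "\<bar>G i z\<bar> \<le> ?B" if "z \<in> slab A" for i z by (rule order_trans[OF B1(2)[OF that] le(1)])
    show "\<bar>G i z - G i z'\<bar> \<le> ?B * norm (z - z')" if "z \<in> slab A" "z' \<in> slab A" for i z z'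
      by (rule order_trans[OF B2(2)[OF that] mult_right_mono[OF le(2)]]) simp
  qed
qed

lemma norm_jet_diff_le: "norm ((x, r, p) - (x, r', p')) \<le> \<bar>r - r'\<bar> + norm (p - p')"
  for x :: "real^'d" and p p' :: "real^'d"
proof -
  have "norm ((0::real^'d, r - r', p - p')) \<le> norm (0::real^'d) + norm (r - r', p - p')" by (rule norm_Pair_le)
  also have "norm (r - r', p - p') \<le> norm (r - r') + norm (p - p')" by (rule norm_Pair_le)
  finally show ?thesis by simp
qed

context
  fixes H :: "(real^'d) \<times> real \<times> (real^'d) \<Rightarrow> real"
  assumes H4: "Ck_on 4 phase H" and Hper: "x_periodic H"
begin

lemma H_regularity:
  "Ck_on 4 phase H"
  "Ck_on 3 phase (pderiv_phase e_m H)" "Ck_on 3 phase (pderiv_phase (e_p j) H)"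
  "Ck_on 2 phase (pderiv_phase (e_p i) (pderiv_phase (e_p j) H))"
  "Ck_on 2 phase (pderiv_phase e_m (pderiv_phase (e_p j) H))"
proof -
  show "Ck_on 4 phase H" by (rule H4)
  have step: "Ck_on (Suc k) phase F \<Longrightarrow> b \<in> Basis \<Longrightarrow> Ck_on k phase (pderiv_phase b F)" for k F and b :: "(real^'d) \<times> real \<times> (real^'d)"
    by simp
  have 4: "Ck_on (Suc 3) phase H" using H4 by (simp only: Suc_numerals)
  have 3: "Ck_on 3 phase (pderiv_phase (e_p j) H)" for j
    by (rule step[OF 4 e_Basis(2)])
  have r3: "Ck_on (Suc 2) phase (pderiv_phase (e_p j) H)" for j
    using 3[of j] by (simp only: Suc_numerals)
  show "Ck_on 3 phase (pderiv_phase e_m H)" by (rule step[OF 4 e_Basis(1)])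
  show "Ck_on 3 phase (pderiv_phase (e_p j) H)" by (rule 3)
  show "Ck_on 2 phase (pderiv_phase (e_p i) (pderiv_phase (e_p j) H))"
    "Ck_on 2 phase (pderiv_phase e_m (pderiv_phase (e_p j) H))"
    by (rule step[OF r3 e_Basis(2)], rule step[OF r3 e_Basis(1)])
qed

lemma H_x_periodic:
  "x_periodic (pderiv_phase b H)" "x_periodic (pderiv_phase b (pderiv_phase (e_p j) H))"
proof -
  have 4: "Ck_on (Suc 3) phase H" using H4 by (simp only: Suc_numerals)
  show 1: "x_periodic (pderiv_phase b H)" for b by (rule x_periodic_pderiv[OF 4 Hper])
  have 3: "Ck_on (Suc 2) phase (pderiv_phase (e_p j) H)"
    using H_regularity(3)[of j] by (simp only: Suc_numerals)
  show "x_periodic (pderiv_phase b (pderiv_phase (e_p j) H))"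
    by (rule x_periodic_pderiv[OF 3 1])
qed

lemma d_m_H: "d_m H = pderiv_phase e_m H"
  by (simp add: d_m_def fun_eq_iff)

lemma d_p_H: "d_p H z $ j = pderiv_phase (e_p j) H z"
  by (simp add: d_p_def)

lemma d_p_H_has_derivative:
  assumes "z \<in> phase"
  shows "(d_p H has_derivative (\<lambda>h. \<chi> j. frechet_derivative (pderiv_phase (e_p j) H) (at z within phase) h)) (at z within phase)"
proof (rule has_derivative_vec_componentwise)
  fix j
  have 3: "Ck_on (Suc 2) phase (pderiv_phase (e_p j) H)"
    using H_regularity(3)[of j] by (simp only: Suc_numerals)
  show "((\<lambda>z. d_p H z $ j) has_derivative frechet_derivative (pderiv_phase (e_p j) H) (at z within phase)) (at z within phase)"
    unfolding d_p_H by (rule has_derivative_phase[OF 3 assms])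
qed

lemma d_p_d_p_H: "z \<in> phase \<Longrightarrow> d_p (d_p H) z $ i $ j = pderiv_phase (e_p i) (pderiv_phase (e_p j) H) z"
  using frechet_derivative_phase[OF d_p_H_has_derivative] by (simp add: d_p_def[of "d_p H"])

lemma d_m_d_p_H: "z \<in> phase \<Longrightarrow> d_m (d_p H) z $ j = pderiv_phase e_m (pderiv_phase (e_p j) H) z"
  using frechet_derivative_phase[OF d_p_H_has_derivative] by (simp add: d_m_def)

lemma continuous_on_H_derivatives:
  "continuous_on phase (d_m H)" "continuous_on phase (\<lambda>z. d_p H z $ j)"
  "continuous_on phase (\<lambda>z. d_p (d_p H) z $ i $ j)" "continuous_on phase (\<lambda>z. d_m (d_p H) z $ j)"
proof -
  have 0: "Ck_on k phase F \<Longrightarrow> continuous_on phase F" for k and F :: "(real^'d) \<times> real \<times> (real^'d) \<Rightarrow> real"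
    using Ck_on_le[of k phase F 0] by simp
  show "continuous_on phase (d_m H)" unfolding d_m_H by (rule 0[OF H_regularity(2)])
  show "continuous_on phase (\<lambda>z. d_p H z $ j)" unfolding d_p_H by (rule 0[OF H_regularity(3)])
  show "continuous_on phase (\<lambda>z. d_p (d_p H) z $ i $ j)"
    by (rule continuous_on_eq[OF 0[OF H_regularity(4)]]) (simp add: d_p_d_p_H)
  show "continuous_on phase (\<lambda>z. d_m (d_p H) z $ j)"
    by (rule continuous_on_eq[OF 0[OF H_regularity(5)]]) (simp add: d_m_d_p_H)
qed

lemma hamiltonian_bounds:
  "\<exists>B\<ge>0. \<forall>z\<in>slab A. \<forall>z'\<in>slab A.
     norm (d_p H z) \<le> B \<and> \<bar>d_m H z\<bar> \<le> B \<and> norm (d_m (d_p H) z) \<le> B \<and>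
     (\<forall>q. norm (d_p (d_p H) z *v q) \<le> B * norm q) \<and>
     norm (d_p H z - d_p H z') \<le> B * norm (z - z') \<and> \<bar>d_m H z - d_m H z'\<bar> \<le> B * norm (z - z') \<and>
     norm (d_m (d_p H) z - d_m (d_p H) z') \<le> B * norm (z - z') \<and>
     (\<forall>q. norm (d_p (d_p H) z *v q - d_p (d_p H) z' *v q) \<le> B * norm (z - z') * norm q)"
proof -
  have r1: "Ck_on (Suc 2) phase (pderiv_phase e_m H)" "Ck_on (Suc 2) phase (pderiv_phase (e_p j) H)"
    "Ck_on (Suc 1) phase (pderiv_phase (e_p i) (pderiv_phase (e_p j) H))"
    "Ck_on (Suc 1) phase (pderiv_phase e_m (pderiv_phase (e_p j) H))" for i j
    using H_regularity(2) H_regularity(3)[of j] H_regularity(4)[of j i] H_regularity(5)[of j]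
    by (simp_all only: Suc_numerals)
  obtain B1 where B1: "B1 \<ge> 0" "\<And>z. z \<in> slab A \<Longrightarrow> \<bar>d_m H z\<bar> \<le> B1"
      "\<And>z z'. z \<in> slab A \<Longrightarrow> z' \<in> slab A \<Longrightarrow> \<bar>d_m H z - d_m H z'\<bar> \<le> B1 * norm (z - z')"
    using slab_family_bounds[of 2 "\<lambda>_::unit. pderiv_phase e_m H" A, OF r1(1) H_x_periodic(1)] unfolding d_m_H by blast
  obtain B2 where B2: "B2 \<ge> 0" "\<And>z j. z \<in> slab A \<Longrightarrow> \<bar>d_p H z $ j\<bar> \<le> B2"
      "\<And>z z' j. z \<in> slab A \<Longrightarrow> z' \<in> slab A \<Longrightarrow> \<bar>d_p H z $ j - d_p H z' $ j\<bar> \<le> B2 * norm (z - z')"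
    using slab_family_bounds[of 2 "\<lambda>j. pderiv_phase (e_p j) H" A, OF r1(2) H_x_periodic(1)] unfolding d_p_H by blast
  obtain B3 where B3: "B3 \<ge> 0" "\<And>z j. z \<in> slab A \<Longrightarrow> \<bar>d_m (d_p H) z $ j\<bar> \<le> B3"
      "\<And>z z' j. z \<in> slab A \<Longrightarrow> z' \<in> slab A \<Longrightarrow> \<bar>d_m (d_p H) z $ j - d_m (d_p H) z' $ j\<bar> \<le> B3 * norm (z - z')"
  proof -
    obtain B where B: "B \<ge> 0" "\<forall>j. (\<forall>z\<in>slab A. \<bar>pderiv_phase e_m (pderiv_phase (e_p j) H) z\<bar> \<le> B) \<and>
      (\<forall>z\<in>slab A. \<forall>z'\<in>slab A. \<bar>pderiv_phase e_m (pderiv_phase (e_p j) H) z - pderiv_phase e_m (pderiv_phase (e_p j) H) z'\<bar> \<le> B * norm (z - z'))"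
      using slab_family_bounds[of 1 "\<lambda>j. pderiv_phase e_m (pderiv_phase (e_p j) H)" A, OF r1(4) H_x_periodic(2)] by blast
    show ?thesis
      by (rule that[OF B(1)]) (use B(2) in \<open>simp_all add: d_m_d_p_H subsetD[OF slab_phase]\<close>)
  qed
  obtain B4 where B4: "B4 \<ge> 0" "\<And>z i j. z \<in> slab A \<Longrightarrow> \<bar>d_p (d_p H) z $ i $ j\<bar> \<le> B4"
      "\<And>z z' i j. z \<in> slab A \<Longrightarrow> z' \<in> slab A \<Longrightarrow> \<bar>d_p (d_p H) z $ i $ j - d_p (d_p H) z' $ i $ j\<bar> \<le> B4 * norm (z - z')"
  proof -
    let ?G = "\<lambda>ij::'d \<times> 'd. pderiv_phase (e_p (fst ij)) (pderiv_phase (e_p (snd ij)) H)"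
    obtain B where B: "B \<ge> 0" "\<forall>ij. (\<forall>z\<in>slab A. \<bar>?G ij z\<bar> \<le> B) \<and>
      (\<forall>z\<in>slab A. \<forall>z'\<in>slab A. \<bar>?G ij z - ?G ij z'\<bar> \<le> B * norm (z - z'))"
      using slab_family_bounds[of 1 ?G A, OF r1(3) H_x_periodic(2)] by blast
    have B2: "(\<forall>z\<in>slab A. \<bar>?G (i, j) z\<bar> \<le> B)" "(\<forall>z\<in>slab A. \<forall>z'\<in>slab A. \<bar>?G (i, j) z - ?G (i, j) z'\<bar> \<le> B * norm (z - z'))" for i j
      using B(2) by blast+
    show ?thesis
      by (rule that[OF B(1)]) (use B2 in \<open>simp_all add: d_p_d_p_H subsetD[OF slab_phase]\<close>)
  qed
  let ?d = "real CARD('d)"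
  define B where "B = B1 + ?d * B2 + ?d * B3 + ?d * (?d * B4)"
  have nn: "B1 \<ge> 0" "?d * B2 \<ge> 0" "?d * B3 \<ge> 0" "?d * (?d * B4) \<ge> 0" using B1 B2 B3 B4 by auto
  then have le: "B1 \<le> B" "?d * B2 \<le> B" "?d * B3 \<le> B" "?d * (?d * B4) \<le> B" "0 \<le> B" unfolding B_def by linarith+
  show ?thesis
  proof (intro exI[of _ B] conjI le(5) ballI allI)
    fix z z' :: "(real^'d) \<times> real \<times> (real^'d)" and q :: "real^'d"
    assume z: "z \<in> slab A" and z': "z' \<in> slab A"
    have mono: "b * norm (z - z') \<le> B * norm (z - z')" if "b \<le> B" for b
      using that by (rule mult_right_mono) simp
    show "norm (d_p H z) \<le> B" by (rule order_trans[OF norm_vec_le[OF B2(2)[OF z]] le(2)])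
    show "\<bar>d_m H z\<bar> \<le> B" by (rule order_trans[OF B1(2)[OF z] le(1)])
    show "norm (d_m (d_p H) z) \<le> B" by (rule order_trans[OF norm_vec_le[OF B3(2)[OF z]] le(3)])
    show "norm (d_p (d_p H) z *v q) \<le> B * norm q"
      by (rule order_trans[OF norm_matrix_vector_le[OF B4(2)[OF z]] mult_right_mono[OF le(4)]]) simp
    have "norm (d_p H z - d_p H z') \<le> ?d * (B2 * norm (z - z'))"
      by (rule norm_vec_le) (simp add: B2(3)[OF z z'])
    then show "norm (d_p H z - d_p H z') \<le> B * norm (z - z')" using mono[OF le(2)] by (simp add: mult.assoc)
    show "\<bar>d_m H z - d_m H z'\<bar> \<le> B * norm (z - z')" by (rule order_trans[OF B1(3)[OF z z'] mono[OF le(1)]])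
    have "norm (d_m (d_p H) z - d_m (d_p H) z') \<le> ?d * (B3 * norm (z - z'))"
      by (rule norm_vec_le) (simp add: B3(3)[OF z z'])
    then show "norm (d_m (d_p H) z - d_m (d_p H) z') \<le> B * norm (z - z')" using mono[OF le(3)] by (simp add: mult.assoc)
    have "norm ((d_p (d_p H) z - d_p (d_p H) z') *v q) \<le> ?d * (?d * (B4 * norm (z - z'))) * norm q"
      by (rule norm_matrix_vector_le) (simp add: B4(3)[OF z z'])
    also have "\<dots> \<le> B * norm (z - z') * norm q"
      using mult_right_mono[OF mono[OF le(4)], of "norm q"] by (simp add: mult.assoc)
    finally show "norm (d_p (d_p H) z *v q - d_p (d_p H) z' *v q) \<le> B * norm (z - z') * norm q"
      by (simp add: matrix_vector_mult_diff_rdistrib)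
  qed
qed

lemma hamiltonian_taylor:
  "\<exists>B\<ge>0. \<forall>x r p r' p'. (x, r, p) \<in> slab A \<longrightarrow> (x, r', p') \<in> slab A \<longrightarrow>
     \<bar>H (x, r, p) - H (x, r', p') - (d_m H (x, r', p') * (r - r') + d_p H (x, r', p') \<bullet> (p - p'))\<bar>
       \<le> B * (\<bar>r - r'\<bar> + norm (p - p'))\<^sup>2"
proof -
  have 4: "Ck_on (Suc (Suc 2)) phase H" using H4 by (simp only: Suc_numerals)
  obtain B where B: "B \<ge> 0" "\<And>z z'. z \<in> slab A \<Longrightarrow> z' \<in> slab A \<Longrightarrow>
    \<bar>H z - H z' - frechet_derivative H (at z' within phase) (z - z')\<bar> \<le> B * (norm (z - z'))\<^sup>2"
    using slab_taylor[OF 4 Hper, of A] by blast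
  have "\<bar>H (x, r, p) - H (x, r', p') - (d_m H (x, r', p') * (r - r') + d_p H (x, r', p') \<bullet> (p - p'))\<bar>
       \<le> B * (\<bar>r - r'\<bar> + norm (p - p'))\<^sup>2" if z: "(x, r, p) \<in> slab A" "(x, r', p') \<in> slab A" for x r p r' p'
  proof -
    have ph: "(x, r', p') \<in> phase" using z slab_phase by blast
    have bl: "bounded_linear (frechet_derivative H (at (x, r', p') within phase))"
      by (rule has_derivative_bounded_linear[OF has_derivative_phase[OF 4 ph]])
    have "frechet_derivative H (at (x, r', p') within phase) ((x, r, p) - (x, r', p')) =
        d_m H (x, r', p') * (r - r') + d_p H (x, r', p') \<bullet> (p - p')"
      using linear_phase_expand[OF bl, of "r - r'" "p - p'"] by (simp add: d_m_H d_p_H inner_vec_def mult.commute)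
    with B(2)[OF z] have "\<bar>H (x, r, p) - H (x, r', p') - (d_m H (x, r', p') * (r - r') + d_p H (x, r', p') \<bullet> (p - p'))\<bar>
       \<le> B * (norm ((x, r, p) - (x, r', p')))\<^sup>2" by simp
    also have "\<dots> \<le> B * (\<bar>r - r'\<bar> + norm (p - p'))\<^sup>2"
      by (intro mult_left_mono power_mono norm_jet_diff_le B) auto
    finally show ?thesis .
  qed
  with B(1) show ?thesis by blast
qed

text \<open>
  The map \<open>(m, p) \<mapsto> m H_p\<close> is linearised at the previous iterate. The Taylor expansion of the components of
  \<open>H_p\<close> produces the transpose of the matrix in the system. The symmetry that comes with positive
  definiteness is available for positive density, and this suffices as the matrix is multiplied by the
  density.
\<close>

lemma flux_taylor:
  assumes sym: "\<And>x r p i j. r > 0 \<Longrightarrow> d_p (d_p H) (x, r, p) $ i $ j = d_p (d_p H) (x, r, p) $ j $ i"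
    and A: "A \<ge> 0"
  shows "\<exists>B\<ge>0. \<forall>x r p r' p'. (x, r, p) \<in> slab A \<longrightarrow> (x, r', p') \<in> slab A \<longrightarrow>
     norm (r *\<^sub>R d_p H (x, r, p) - r' *\<^sub>R d_p H (x, r', p') - ((r - r') *\<^sub>R d_p H (x, r', p')
        + r' *\<^sub>R (d_p (d_p H) (x, r', p') *v (p - p')) + (r' * (r - r')) *\<^sub>R d_m (d_p H) (x, r', p')))
       \<le> B * (\<bar>r - r'\<bar> + norm (p - p'))\<^sup>2"
proof -
  have 3: "Ck_on (Suc (Suc 1)) phase (pderiv_phase (e_p j) H)" for j
    using H_regularity(3)[of j] by (simp only: Suc_numerals)
  obtain B0 where B0: "\<And>j. B0 j \<ge> 0" "\<And>j z z'. z \<in> slab A \<Longrightarrow> z' \<in> slab A \<Longrightarrow>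
    \<bar>d_p H z $ j - d_p H z' $ j - frechet_derivative (pderiv_phase (e_p j) H) (at z' within phase) (z - z')\<bar> \<le> B0 j * (norm (z - z'))\<^sup>2"
    using slab_taylor[OF 3 H_x_periodic(1), where A=A] unfolding d_p_H by metis
  obtain B1 where B1: "\<And>j. B1 j \<ge> 0" "\<And>j z z'. z \<in> slab A \<Longrightarrow> z' \<in> slab A \<Longrightarrow>
    \<bar>d_p H z $ j - d_p H z' $ j\<bar> \<le> B1 j * norm (z - z')"
    using slab_lipschitz[OF 3 H_x_periodic(1), where A=A] unfolding d_p_H by metis
  let ?B = "(\<Sum>j\<in>UNIV. B1 j) + A * (\<Sum>j\<in>UNIV. B0 j)"
  have s: "(\<Sum>j\<in>UNIV. B0 j) \<ge> 0" "(\<Sum>j\<in>UNIV. B1 j) \<ge> 0" using B0 B1 by (auto intro!: sum_nonneg)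
  have le: "B0 j \<le> (\<Sum>j\<in>UNIV. B0 j)" "B1 j \<le> (\<Sum>j\<in>UNIV. B1 j)" for j
    using member_le_sum[of j UNIV B0] member_le_sum[of j UNIV B1] B0(1) B1(1) by auto
  have "norm (r *\<^sub>R d_p H (x, r, p) - r' *\<^sub>R d_p H (x, r', p') - ((r - r') *\<^sub>R d_p H (x, r', p')
        + r' *\<^sub>R (d_p (d_p H) (x, r', p') *v (p - p')) + (r' * (r - r')) *\<^sub>R d_m (d_p H) (x, r', p')))
       \<le> real CARD('d) * (?B * (\<bar>r - r'\<bar> + norm (p - p'))\<^sup>2)" (is "norm ?V \<le> _")
    if z: "(x, r, p) \<in> slab A" "(x, r', p') \<in> slab A" for x r p r' p'
  proof (rule norm_vec_le)
    fix j
    let ?z = "(x, r, p)" and ?z' = "(x, r', p')" and ?e = "\<bar>r - r'\<bar> + norm (p - p')"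
    have r': "0 \<le> r'" "r' \<le> A" using z(2) by (auto simp: slab_def)
    have ph: "?z' \<in> phase" using z slab_phase by blast
    have bl: "bounded_linear (frechet_derivative (pderiv_phase (e_p j) H) (at ?z' within phase))"
      by (rule has_derivative_bounded_linear[OF has_derivative_phase[OF 3 ph]])
    have D: "frechet_derivative (pderiv_phase (e_p j) H) (at ?z' within phase) (?z - ?z') =
        (r - r') * d_m (d_p H) ?z' $ j + (\<Sum>i\<in>UNIV. (p - p') $ i * d_p (d_p H) ?z' $ i $ j)"
      using linear_phase_expand[OF bl, of "r - r'" "p - p'"] by (simp add: d_m_d_p_H[OF ph] d_p_d_p_H[OF ph])
    have symm: "r' * (\<Sum>i\<in>UNIV. (p - p') $ i * d_p (d_p H) ?z' $ i $ j) = r' * (d_p (d_p H) ?z' *v (p - p')) $ j"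
    proof (cases "r' = 0")
      case False
      then have "r' > 0" using r' by simp
      then show ?thesis using sym[of r' x p' _ j] by (simp add: matrix_vector_mult_def mult.commute)
    qed simp
    define t where "t = d_p H ?z $ j - d_p H ?z' $ j - frechet_derivative (pderiv_phase (e_p j) H) (at ?z' within phase) (?z - ?z')"
    have t: "\<bar>t\<bar> \<le> (\<Sum>j\<in>UNIV. B0 j) * ?e\<^sup>2"
    proof -
      have "\<bar>t\<bar> \<le> B0 j * (norm (?z - ?z'))\<^sup>2" unfolding t_def by (rule B0(2)[OF z])
      also have "\<dots> \<le> (\<Sum>j\<in>UNIV. B0 j) * ?e\<^sup>2"
        by (intro mult_mono power_mono norm_jet_diff_le le) (auto simp: s)
      finally show ?thesis .
    qed
    have l: "\<bar>d_p H ?z $ j - d_p H ?z' $ j\<bar> \<le> (\<Sum>j\<in>UNIV. B1 j) * ?e"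
      by (rule order_trans[OF B1(2)[OF z]]) (intro mult_mono norm_jet_diff_le le; auto simp: s)
    have V: "?V $ j = (r - r') * (d_p H ?z $ j - d_p H ?z' $ j) + r' * t"
    proof -
      have alg: "r * a - r' * a' - ((r - r') * a' + r' * m + r' * (r - r') * h) = (r - r') * (a - a') + r' * (a - a' - ((r - r') * h + S))"
        if "r' * S = r' * m" for a a' m h S :: real
        using that by (simp add: algebra_simps)
      show ?thesis
        unfolding t_def D by (subst alg[OF symm, symmetric]) simp
    qed
    have "\<bar>?V $ j\<bar> \<le> \<bar>(r - r') * (d_p H ?z $ j - d_p H ?z' $ j)\<bar> + \<bar>r' * t\<bar>"
      unfolding V by (rule abs_triangle_ineq)
    also have "\<dots> = \<bar>r - r'\<bar> * \<bar>d_p H ?z $ j - d_p H ?z' $ j\<bar> + r' * \<bar>t\<bar>"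
      using r' by (simp add: abs_mult)
    also have "\<dots> \<le> ?e * ((\<Sum>j\<in>UNIV. B1 j) * ?e) + A * ((\<Sum>j\<in>UNIV. B0 j) * ?e\<^sup>2)"
      using r' A s by (intro add_mono mult_mono l t) auto
    also have "\<dots> = ?B * ?e\<^sup>2" by (simp add: power2_eq_square algebra_simps)
    finally show "\<bar>?V $ j\<bar> \<le> ?B * ?e\<^sup>2" .
  qed
  moreover have "real CARD('d) * ?B \<ge> 0" using s A by simp
  ultimately show ?thesis by (intro exI[of _ "real CARD('d) * ?B"]) (simp add: mult.assoc)
qed

text \<open>
  The form is continuous and positive on a compact set of jets times the unit sphere, and homogeneous of
  degree two.
\<close>

lemma matrix_coercive:
  assumes pd: "\<And>x r p. r > 0 \<Longrightarrow> positive_definite (monotonicity_matrix H (x, r, p))" and \<delta>: "\<delta> > 0"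
  shows "\<exists>c>0. \<forall>x r p s q. x \<in> cell \<longrightarrow> \<delta> \<le> r \<longrightarrow> r \<le> A \<longrightarrow> norm p \<le> A \<longrightarrow>
    c * (s\<^sup>2 + (norm q)\<^sup>2) \<le> - d_m H (x, r, p) * s\<^sup>2 + r * s * (d_m (d_p H) (x, r, p) \<bullet> q)
       + r * (q \<bullet> (d_p (d_p H) (x, r, p) *v q))"
proof -
  define G where "G = (\<lambda>(z :: (real^'d) \<times> real \<times> (real^'d), s :: real, q :: real^'d).
     - d_m H z * s\<^sup>2 + fst (snd z) * s * (\<Sum>j\<in>UNIV. d_m (d_p H) z $ j * q $ j)
       + fst (snd z) * (\<Sum>i\<in>UNIV. q $ i * (\<Sum>j\<in>UNIV. d_p (d_p H) z $ i $ j * q $ j)))"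
  let ?Z = "cbox (0::real^'d) (\<chi> i. 1) \<times> {\<delta>..A} \<times> cball (0::real^'d) A"
  let ?K = "?Z \<times> sphere (0 :: real \<times> (real^'d)) 1"
  have Zph: "?Z \<subseteq> phase" using \<delta> by (auto simp: phase_def)
  have pos: "G (z, s, q) > 0" if z: "0 < fst (snd z)" and sq: "(s, q) \<noteq> 0" for z s q
  proof -
    \<comment> \<open>the index \<open>None\<close> of the matrix belongs to the density\<close>
    define v :: "real^('d option)" where "v = (\<chi> a. case a of None \<Rightarrow> s | Some j \<Rightarrow> q $ j)"
    have v0: "v \<noteq> 0"
    proof
      assume v: "v = 0"
      then have "v $ None = 0" "\<And>j. v $ Some j = 0" by auto
      then have "s = 0" "q = 0" by (auto simp: v_def vec_eq_iff)
      then show False using sq by (simp add: zero_prod_def)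
    qed
    let ?M = "monotonicity_matrix H z"
    have UN: "(\<Sum>a\<in>(UNIV :: 'd option set). h a) = h None + (\<Sum>j\<in>UNIV. h (Some j))" for h :: "'d option \<Rightarrow> real"
      unfolding UNIV_option_conv by (simp add: sum.reindex)
    have "v \<bullet> (?M *v v) > 0" using pd[of "fst (snd z)" "fst z" "snd (snd z)"] v0 z by (simp add: positive_definite_def)
    also have "v \<bullet> (?M *v v) = G (z, s, q)"
      unfolding inner_vec_def matrix_vector_mult_def
      by (simp add: UN v_def monotonicity_matrix_def Let_def G_def sum.distrib sum_distrib_left sum_distrib_right algebra_simps power2_eq_square flip: sum_divide_distrib)
    finally show ?thesis .
  qed
  have contG: "continuous_on ?K G"
  proof -
    have z: "continuous_on ?K (\<lambda>y. fst y)" and img: "fst ` ?K \<subseteq> phase" using Zph by (auto intro!: continuous_intros)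
    note c = continuous_on_compose2[OF continuous_on_H_derivatives(1) z img]
       continuous_on_compose2[OF continuous_on_H_derivatives(3) z img] continuous_on_compose2[OF continuous_on_H_derivatives(4) z img]
    show ?thesis unfolding G_def case_prod_unfold
      by (intro continuous_intros c)
  qed
  have homog: "G (z, a * s, a *\<^sub>R q) = a\<^sup>2 * G (z, s, q)" for z a s q
    by (simp add: G_def sum_distrib_left algebra_simps power2_eq_square)
  have eqG: "G ((x, r, p), s, q) = - d_m H (x, r, p) * s\<^sup>2 + r * s * (d_m (d_p H) (x, r, p) \<bullet> q)
       + r * (q \<bullet> (d_p (d_p H) (x, r, p) *v q))" for x r p s q
    by (simp add: G_def inner_vec_def matrix_vector_mult_def)
  show ?thesis
  proof (cases "?K = {}")
    case True
    have "norm (1::real, 0::real^'d) = 1" by (simp add: norm_Pair)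
    then have "(z, 1, 0) \<in> ?K" if "z \<in> ?Z" for z using that by simp
    with True have Z: "?Z = {}" by blast
    have F: False if "x \<in> cell" "\<delta> \<le> r" "r \<le> A" "norm p \<le> A" for x p :: "real^'d" and r
    proof -
      have "(x, r, p) \<in> ?Z" using that subsetD[OF cell_subset_cbox, of x] by simp
      then show False unfolding Z by (rule emptyE)
    qed
    show ?thesis by (rule exI[of _ 1]) (auto dest: F)
  next
    case False
    have "compact ?K" by (intro compact_Times) auto
    from continuous_attains_inf[OF this False contG] obtain y where y: "y \<in> ?K" "\<And>y'. y' \<in> ?K \<Longrightarrow> G y \<le> G y'" by blast
    obtain z s0 q0 where yz: "y = (z, s0, q0)" by (cases y)
    have "(s0, q0) \<noteq> 0" using y(1) by (auto simp: yz)
    moreover have "0 < fst (snd z)" using y(1) \<delta> by (auto simp: yz)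
    ultimately have c: "G y > 0" using pos by (simp add: yz)
    have "G y * (s\<^sup>2 + (norm q)\<^sup>2) \<le> G ((x, r, p), s, q)"
      if x: "x \<in> cell" "\<delta> \<le> r" "r \<le> A" "norm p \<le> A" for x r p s q
    proof (cases "(s, q) = 0")
      case True
      then show ?thesis by (simp add: G_def zero_prod_def)
    next
      case False
      define a where "a = norm (s, q)"
      have a: "a > 0" using False by (simp add: a_def)
      have a2: "a\<^sup>2 = s\<^sup>2 + (norm q)\<^sup>2" by (simp add: a_def norm_Pair)
      have "norm (s / a, q /\<^sub>R a) = 1"
      proof -
        have "(s / a, q /\<^sub>R a) = (s, q) /\<^sub>R a" by (simp add: divide_inverse_commute)
        moreover have "norm ((s, q) /\<^sub>R a) = 1" using a by (simp add: a_def del: scaleR_Pair)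
        ultimately show ?thesis by simp
      qed
      then have "((x, r, p), (s / a, q /\<^sub>R a)) \<in> ?K" using x subsetD[OF cell_subset_cbox x(1)] by auto
      from y(2)[OF this] have "a\<^sup>2 * G y \<le> a\<^sup>2 * G ((x, r, p), s / a, q /\<^sub>R a)" by (intro mult_left_mono) auto
      also have "\<dots> = G ((x, r, p), s, q)" using homog[of "(x, r, p)" a "s / a" "q /\<^sub>R a"] a by simp
      finally show ?thesis by (simp add: a2 mult.commute)
    qed
    with c show ?thesis unfolding eqG by blast
  qed
qed

end

section \<open>Families of Lipschitz functions of space\<close>

text \<open>
  The bounds are uniform in time. The class contains the components of regular functions and of their
  gradients and is closed under arithmetic and under composition with the derivatives of \<open>H\<close>, so it
  contains the components of all fluxes in the system.
\<close>

definition smooth_family :: "real \<Rightarrow> (real^'d \<Rightarrow> real \<Rightarrow> real) \<Rightarrow> bool" where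
  "smooth_family T g \<longleftrightarrow>
     (\<forall>t\<in>{0<..<T}. periodic (\<lambda>x. g x t) \<and> (\<forall>x. (\<lambda>y. g y t) differentiable (at x))) \<and>
     (\<exists>B\<ge>0. \<forall>t\<in>{0<..<T}. \<forall>x y. \<bar>g x t\<bar> \<le> B \<and> \<bar>g x t - g y t\<bar> \<le> B * norm (x - y))"

lemma smooth_family_add:
  assumes "smooth_family T g" "smooth_family T h"
  shows "smooth_family T (\<lambda>x t. g x t + h x t)"
proof -
  obtain B where B: "B \<ge> 0" "\<forall>t\<in>{0<..<T}. \<forall>x y. \<bar>g x t\<bar> \<le> B \<and> \<bar>g x t - g y t\<bar> \<le> B * norm (x - y)"
    using assms(1) unfolding smooth_family_def by blast
  obtain C where C: "C \<ge> 0" "\<forall>t\<in>{0<..<T}. \<forall>x y. \<bar>h x t\<bar> \<le> C \<and> \<bar>h x t - h y t\<bar> \<le> C * norm (x - y)"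
    using assms(2) unfolding smooth_family_def by blast
  have "\<forall>t\<in>{0<..<T}. \<forall>x y. \<bar>g x t + h x t\<bar> \<le> B + C \<and> \<bar>g x t + h x t - (g y t + h y t)\<bar> \<le> (B + C) * norm (x - y)"
  proof (intro ballI allI)
    fix t x y assume t: "t \<in> {0<..<T}"
    have "\<bar>g x t\<bar> \<le> B" "\<bar>g x t - g y t\<bar> \<le> B * norm (x - y)" "\<bar>h x t\<bar> \<le> C" "\<bar>h x t - h y t\<bar> \<le> C * norm (x - y)"
      using B(2) C(2) t by blast+
    then show "\<bar>g x t + h x t\<bar> \<le> B + C \<and> \<bar>g x t + h x t - (g y t + h y t)\<bar> \<le> (B + C) * norm (x - y)"
      unfolding distrib_right by linarith
  qed
  moreover have "B + C \<ge> 0" using B C by simp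
  ultimately show ?thesis
    using assms unfolding smooth_family_def periodic_def by (intro conjI ballI allI exI[of _ "B + C"]) auto
qed

lemma smooth_family_mult:
  assumes "smooth_family T g" "smooth_family T h"
  shows "smooth_family T (\<lambda>x t. g x t * h x t)"
proof -
  obtain B where B: "B \<ge> 0" "\<forall>t\<in>{0<..<T}. \<forall>x y. \<bar>g x t\<bar> \<le> B \<and> \<bar>g x t - g y t\<bar> \<le> B * norm (x - y)"
    using assms(1) unfolding smooth_family_def by blast
  obtain C where C: "C \<ge> 0" "\<forall>t\<in>{0<..<T}. \<forall>x y. \<bar>h x t\<bar> \<le> C \<and> \<bar>h x t - h y t\<bar> \<le> C * norm (x - y)"
    using assms(2) unfolding smooth_family_def by blast
  have "\<forall>t\<in>{0<..<T}. \<forall>x y. \<bar>g x t * h x t\<bar> \<le> 2 * (B * C) \<and> \<bar>g x t * h x t - g y t * h y t\<bar> \<le> 2 * (B * C) * norm (x - y)"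
  proof (intro ballI allI)
    fix t x y assume t: "t \<in> {0<..<T}"
    have b: "\<bar>g x t\<bar> \<le> B" "\<bar>g x t - g y t\<bar> \<le> B * norm (x - y)" "\<bar>h x t\<bar> \<le> C" "\<bar>h y t\<bar> \<le> C" "\<bar>h x t - h y t\<bar> \<le> C * norm (x - y)"
      using B(2) C(2) t by blast+
    have "\<bar>g x t * h x t\<bar> \<le> B * C" unfolding abs_mult using b B(1) by (intro mult_mono) auto
    moreover have "B * C \<ge> 0" using B C by simp
    moreover have "\<bar>g x t * (h x t - h y t)\<bar> \<le> B * (C * norm (x - y))"
      unfolding abs_mult using b B(1) by (intro mult_mono) auto
    moreover have "\<bar>(g x t - g y t) * h y t\<bar> \<le> (B * norm (x - y)) * C"
      unfolding abs_mult using b B(1) by (intro mult_mono) auto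
    moreover have "g x t * h x t - g y t * h y t = g x t * (h x t - h y t) + (g x t - g y t) * h y t"
      by (simp add: algebra_simps)
    moreover have "B * (C * norm (x - y)) + (B * norm (x - y)) * C = 2 * (B * C) * norm (x - y)" by simp
    ultimately show "\<bar>g x t * h x t\<bar> \<le> 2 * (B * C) \<and> \<bar>g x t * h x t - g y t * h y t\<bar> \<le> 2 * (B * C) * norm (x - y)"
      by linarith
  qed
  moreover have "2 * (B * C) \<ge> 0" using B C by simp
  ultimately show ?thesis
    using assms unfolding smooth_family_def periodic_def by (intro conjI ballI allI exI[of _ "2 * (B * C)"]) auto
qed

lemma smooth_family_const: "smooth_family T (\<lambda>x t. c)"
  unfolding smooth_family_def periodic_def by (auto intro!: exI[of _ "\<bar>c\<bar>"])

lemma smooth_family_sum: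
  assumes "\<And>i. smooth_family T (g i)"
  shows "smooth_family T (\<lambda>x t. \<Sum>i\<in>I. g i x t)"
proof (induction I rule: infinite_finite_induct)
  case (insert i I)
  then show ?case using smooth_family_add[OF assms[of i] insert.IH] by simp
qed (simp_all add: smooth_family_const)

lemma smooth_family_diff:
  assumes "smooth_family T g" "smooth_family T h"
  shows "smooth_family T (\<lambda>x t. g x t - h x t)"
  using smooth_family_add[OF assms(1) smooth_family_mult[OF smooth_family_const[of T "-1"] assms(2)]] by simp

lemma lipschitz_from_Dx_bound:
  fixes g :: "real^'d \<Rightarrow> real"
  assumes d: "\<And>x. g differentiable (at x)" and B: "\<And>x. norm (nabla g x) \<le> B"
  shows "\<bar>g x - g y\<bar> \<le> B * norm (x - y)"
proof -
  have "norm (g x - g y) \<le> B * norm (x - y)"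
  proof (rule differentiable_bound[of UNIV g "\<lambda>x h. h \<bullet> nabla g x"])
    show "(g has_derivative (\<lambda>h. h \<bullet> nabla g x)) (at x within UNIV)" for x
      using has_derivative_nabla[OF d] by simp
    show "onorm (\<lambda>h. h \<bullet> nabla g x) \<le> B" for x
    proof (rule onorm_le)
      fix h
      have "norm (h \<bullet> nabla g x) \<le> norm h * norm (nabla g x)" using Cauchy_Schwarz_ineq2 by simp
      also have "\<dots> \<le> norm h * B" by (intro mult_left_mono B) simp
      finally show "norm (h \<bullet> nabla g x) \<le> B * norm h" by (simp add: mult.commute)
    qed
  qed auto
  then show ?thesis by simp
qed

lemma smooth_family_regular:
  assumes w: "regular T w"
  shows "smooth_family T w" "smooth_family T (\<lambda>x t. Dx w x t $ j)"
proof -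
  obtain B where B: "B \<ge> 0" "\<And>x t. t \<in> {0..T} \<Longrightarrow> 0 < T \<Longrightarrow> \<bar>w x t\<bar> \<le> B"
    "\<And>x t. t \<in> {0<..<T} \<Longrightarrow> norm (Dx w x t) \<le> B"
    "\<And>x t. t \<in> {0<..<T} \<Longrightarrow> norm (Dx (Dx w) x t) \<le> B"
    "\<And>x t. t \<in> {0<..<T} \<Longrightarrow> \<bar>Dt w x t\<bar> \<le> B"
    by (rule regular_bounded[OF w]) (rule that)
  show "smooth_family T w"
    unfolding smooth_family_def
  proof (intro conjI ballI allI exI[of _ B])
    fix t and x y :: "real^'a" assume t: "t \<in> {0<..<T}"
    show "periodic (\<lambda>x. w x t)" using regular_periodic[OF w] t by simp
    show "(\<lambda>y. w y t) differentiable at x" by (rule regular_differentiable[OF w t])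
    show "\<bar>w x t\<bar> \<le> B" using B(2)[of t x] t by simp
    show "\<bar>w x t - w y t\<bar> \<le> B * norm (x - y)"
      by (rule lipschitz_from_Dx_bound[OF regular_differentiable(1)[OF w t]]) (use B(3)[OF t] in \<open>simp add: Dx_def\<close>)
  qed (rule B(1))
  let ?d = "real CARD('a)"
  show "smooth_family T (\<lambda>x t. Dx w x t $ j)"
    unfolding smooth_family_def
  proof (intro conjI ballI allI exI[of _ "?d * B + B"])
    fix t and x y :: "real^'a" assume t: "t \<in> {0<..<T}"
    note d = regular_differentiable(2)[OF w t]
    show "periodic (\<lambda>x. Dx w x t $ j)" using periodic_Dx[OF w t] by (simp add: periodic_def)
    show "(\<lambda>y. Dx w y t $ j) differentiable at x" by (rule nabla_component(1)[OF d])
    have dB: "?d * B \<ge> 0" using B by simp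
    show "\<bar>Dx w x t $ j\<bar> \<le> ?d * B + B"
      using component_le_norm_cart[of "Dx w x t" j] B(3)[OF t, of x] dB by linarith
    have "\<bar>Dx w x t $ j - Dx w y t $ j\<bar> \<le> ?d * B * norm (x - y)"
    proof (rule lipschitz_from_Dx_bound[OF nabla_component(1)[OF d]])
      fix x
      show "norm (nabla (\<lambda>y. Dx w y t $ j) x) \<le> ?d * B"
      proof (rule norm_vec_le)
        fix i
        have "nabla (\<lambda>y. Dx w y t $ j) x $ i = Dx (Dx w) x t $ i $ j"
          using nabla_component(2)[OF d, of j x i] by (simp add: Dx_def)
        then show "\<bar>nabla (\<lambda>y. Dx w y t $ j) x $ i\<bar> \<le> B"
          using component_le_norm_cart[of "Dx (Dx w) x t $ i" j] Finite_Cartesian_Product.norm_nth_le[of "Dx (Dx w) x t" i] B(4)[OF t, of x] by simp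
      qed
    qed
    also have "\<dots> \<le> (?d * B + B) * norm (x - y)" using B(1) by (simp add: distrib_right)
    finally show "\<bar>Dx w x t $ j - Dx w y t $ j\<bar> \<le> (?d * B + B) * norm (x - y)" .
  qed (use B(1) in simp)
qed

lemma jet_in_slab:
  assumes "t \<in> {0<..<T}" "0 \<le> m x t" "\<bar>m x t\<bar> \<le> A" "norm (Dx u x t) \<le> A"
  shows "jet u m x t \<in> slab A"
  using assms by (auto simp: jet_def slab_def)

lemma smooth_family_jet:
  fixes u m :: "real^'d \<Rightarrow> real \<Rightarrow> real"
  assumes u: "regular T u" and m: "regular T m" and m0: "\<And>x t. t \<in> {0<..<T} \<Longrightarrow> 0 \<le> m x t"
    and F: "Ck_on (Suc k) phase F" "x_periodic F"
  shows "smooth_family T (\<lambda>x t. F (jet u m x t))"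
proof -
  obtain B1 where B1: "B1 \<ge> 0" "\<And>x t. t \<in> {0<..<T} \<Longrightarrow> norm (Dx u x t) \<le> B1"
    by (rule regular_bounded[OF u]) (rule that)
  obtain B2 where B2: "B2 \<ge> 0" "\<And>x t. t \<in> {0..T} \<Longrightarrow> 0 < T \<Longrightarrow> \<bar>m x t\<bar> \<le> B2"
    by (rule regular_bounded[OF m]) (rule that)
  define A where "A = max B1 B2"
  have sl: "jet u m x t \<in> slab A" if t: "t \<in> {0<..<T}" for x t
    using B1(2)[OF t, of x] B2(2)[of t x] t
    by (intro jet_in_slab[where T=T] t m0) (auto simp: A_def)
  obtain B where B: "B \<ge> 0" "\<forall>z\<in>slab A. \<bar>F z\<bar> \<le> B" using slab_bounded[OF F] by blast
  obtain C where C: "C \<ge> 0" "\<forall>z\<in>slab A. \<forall>z'\<in>slab A. \<bar>F z - F z'\<bar> \<le> C * norm (z - z')"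
    using slab_lipschitz[OF F] by blast
  obtain Bm where Bm: "Bm \<ge> 0" "\<forall>t\<in>{0<..<T}. \<forall>x y. \<bar>m x t\<bar> \<le> Bm \<and> \<bar>m x t - m y t\<bar> \<le> Bm * norm (x - y)"
    using smooth_family_regular(1)[OF m] unfolding smooth_family_def by blast
  have "\<forall>j. \<exists>Bu\<ge>0. \<forall>t\<in>{0<..<T}. \<forall>x y. \<bar>Dx u x t $ j - Dx u y t $ j\<bar> \<le> Bu * norm (x - y)"
    using smooth_family_regular(2)[OF u] unfolding smooth_family_def by blast
  then obtain Bu where Bu: "\<And>j. Bu j \<ge> 0" "\<And>j t x y. t \<in> {0<..<T} \<Longrightarrow> \<bar>Dx u x t $ j - Dx u y t $ j\<bar> \<le> Bu j * norm (x - y)"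
    by metis
  let ?Bu = "\<Sum>j\<in>UNIV. Bu j"
  have jetL: "norm (jet u m x t - jet u m y t) \<le> (1 + Bm + ?Bu) * norm (x - y)" if t: "t \<in> {0<..<T}" for x y t
  proof -
    have "norm (Dx u x t - Dx u y t) \<le> (\<Sum>j\<in>UNIV. \<bar>(Dx u x t - Dx u y t) $ j\<bar>)" by (rule norm_le_l1_cart)
    also have "\<dots> \<le> (\<Sum>j\<in>UNIV. Bu j * norm (x - y))" using Bu(2)[OF t] by (intro sum_mono) simp
    finally have u: "norm (Dx u x t - Dx u y t) \<le> ?Bu * norm (x - y)" by (simp add: sum_distrib_right)
    have m: "\<bar>m x t - m y t\<bar> \<le> Bm * norm (x - y)" using Bm(2) t by blast
    have "norm (jet u m x t - jet u m y t) \<le> norm (x - y) + norm (m x t - m y t, Dx u x t - Dx u y t)"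
      unfolding jet_def diff_Pair by (rule norm_Pair_le)
    also have "norm (m x t - m y t, Dx u x t - Dx u y t) \<le> norm (m x t - m y t) + norm (Dx u x t - Dx u y t)"
      by (rule norm_Pair_le)
    finally show ?thesis using u m by (simp add: distrib_right)
  qed
  have nn: "1 + Bm + ?Bu \<ge> 0" using Bm(1) Bu(1) by (simp add: sum_nonneg add_nonneg_nonneg)
  let ?C = "B + C * (1 + Bm + ?Bu)"
  show ?thesis
    unfolding smooth_family_def
  proof (intro conjI ballI allI exI[of _ ?C])
    show "?C \<ge> 0" using B C nn by simp
    fix t and x y :: "real^'d" assume t: "t \<in> {0<..<T}"
    show "periodic (\<lambda>x. F (jet u m x t))"
      unfolding periodic_def
    proof (intro allI ballI)
      fix x k :: "real^'d" assume k: "k \<in> int_lattice"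
      have "jet u m (x + k) t = jet u m x t + (k, 0, 0)"
        using regular_periodic[OF m, of t] periodic_Dx[OF u t] t k by (simp add: jet_def periodic_def)
      then show "F (jet u m (x + k) t) = F (jet u m x t)"
        using F(2) k sl[OF t, of x] slab_phase by (auto simp: x_periodic_def)
    qed
    show "(\<lambda>y. F (jet u m y t)) differentiable at x"
    proof -
      have m': "((\<lambda>y. m y t) has_derivative frechet_derivative (\<lambda>y. m y t) (at x)) (at x)"
        and u': "((\<lambda>y. Dx u y t) has_derivative frechet_derivative (\<lambda>y. Dx u y t) (at x)) (at x)"
        using regular_differentiable[OF m t] regular_differentiable[OF u t] by (simp_all add: frechet_derivative_works)
      have j: "((\<lambda>y. jet u m y t) has_derivative (\<lambda>h. (h, frechet_derivative (\<lambda>y. m y t) (at x) h, frechet_derivative (\<lambda>y. Dx u y t) (at x) h))) (at x)"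
        unfolding jet_def by (intro has_derivative_Pair has_derivative_ident m' u')
      have ph: "jet u m x t \<in> phase" and img: "range (\<lambda>y. jet u m y t) \<subseteq> phase"
        using sl[OF t] slab_phase by blast+
      have "((\<lambda>y. F (jet u m y t)) has_derivative
          (\<lambda>h. frechet_derivative F (at (jet u m x t) within phase) (h, frechet_derivative (\<lambda>y. m y t) (at x) h, frechet_derivative (\<lambda>y. Dx u y t) (at x) h))) (at x)"
        by (rule has_derivative_in_compose[OF j has_derivative_subset[OF has_derivative_phase[OF F(1) ph] img]])
      then show ?thesis by (auto simp: differentiable_def)
    qed
    show "\<bar>F (jet u m x t)\<bar> \<le> ?C"
    proof -
      have "\<bar>F (jet u m x t)\<bar> \<le> B" using B(2) sl[OF t] by blast
      moreover have "0 \<le> C * (1 + Bm + ?Bu)" using C nn by simp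
      ultimately show ?thesis by linarith
    qed
    have "\<bar>F (jet u m x t) - F (jet u m y t)\<bar> \<le> C * norm (jet u m x t - jet u m y t)" using C(2) sl[OF t] by blast
    also have "\<dots> \<le> C * ((1 + Bm + ?Bu) * norm (x - y))" by (intro mult_left_mono jetL t C)
    also have "\<dots> \<le> ?C * norm (x - y)" using B(1) by (simp add: distrib_right mult.assoc)
    finally show "\<bar>F (jet u m x t) - F (jet u m y t)\<bar> \<le> ?C * norm (x - y)" .
  qed
qed

lemma smooth_family_nabla_bound:
  assumes "smooth_family T g"
  shows "\<exists>B\<ge>0. \<forall>t\<in>{0<..<T}. \<forall>x j. \<bar>nabla (\<lambda>y. g y t) x $ j\<bar> \<le> B"
proof -
  obtain B where B: "B \<ge> 0" "\<forall>t\<in>{0<..<T}. \<forall>x y. \<bar>g x t\<bar> \<le> B \<and> \<bar>g x t - g y t\<bar> \<le> B * norm (x - y)"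
    using assms unfolding smooth_family_def by blast
  have "\<bar>nabla (\<lambda>y. g y t) x $ j\<bar> \<le> B" if t: "t \<in> {0<..<T}" for t x j
  proof -
    have D: "((\<lambda>s. g (x + s *\<^sub>R axis j 1) t) has_real_derivative nabla (\<lambda>y. g y t) x $ j) (at 0)"
      using DERIV_axis[of "\<lambda>y. g y t" x j] assms t by (auto simp: smooth_family_def)
    then have lim: "((\<lambda>h. \<bar>(g (x + (0 + h) *\<^sub>R axis j 1) t - g (x + 0 *\<^sub>R axis j 1) t) / h\<bar>) \<longlongrightarrow> \<bar>nabla (\<lambda>y. g y t) x $ j\<bar>) (at 0)"
      unfolding DERIV_def by (rule tendsto_rabs)
    show ?thesis
    proof (rule tendsto_upperbound[OF lim])
      have "\<bar>(g (x + (0 + h) *\<^sub>R axis j 1) t - g (x + 0 *\<^sub>R axis j 1) t) / h\<bar> \<le> B" if "h \<noteq> 0" for h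
      proof -
        have "\<bar>g (x + h *\<^sub>R axis j 1) t - g x t\<bar> \<le> B * norm ((x + h *\<^sub>R axis j 1) - x)" using B(2) t by blast
        also have "\<dots> = B * \<bar>h\<bar>" by (simp add: norm_axis_1)
        finally show ?thesis using that by (simp add: field_simps)
      qed
      then show "\<forall>\<^sub>F h in at 0. \<bar>(g (x + (0 + h) *\<^sub>R axis j 1) t - g (x + 0 *\<^sub>R axis j 1) t) / h\<bar> \<le> B"
        by (auto simp: eventually_at_filter)
    qed simp
  qed
  with B(1) show ?thesis by blast
qed

lemma smooth_family_vec_differentiable:
  fixes F :: "real^'d \<Rightarrow> real \<Rightarrow> real^'d"
  assumes "\<And>j. smooth_family T (\<lambda>x t. F x t $ j)" "t \<in> {0<..<T}"
  shows "(\<lambda>y. F y t) differentiable (at x)"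
proof -
  have "((\<lambda>y. F y t $ j) has_derivative frechet_derivative (\<lambda>y. F y t $ j) (at x)) (at x within UNIV)" for j
    using assms by (auto simp: smooth_family_def frechet_derivative_works)
  from has_derivative_vec_componentwise[of "\<lambda>y. F y t", OF this] show ?thesis
    by (auto simp: differentiable_def)
qed

lemma smooth_family_divergence:
  fixes F :: "real^'d \<Rightarrow> real \<Rightarrow> real^'d"
  assumes "\<And>j. smooth_family T (\<lambda>x t. F x t $ j)" "t \<in> {0<..<T}"
  shows "divergence F x t = (\<Sum>j\<in>UNIV. nabla (\<lambda>y. F y t $ j) x $ j)"
  unfolding divergence_def trace_def Dx_def
  by (simp add: nabla_component(2)[OF smooth_family_vec_differentiable[OF assms]])

lemma flux_smooth_family:
  fixes F :: "real^'d \<Rightarrow> real \<Rightarrow> real^'d"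
  assumes F: "\<And>j. smooth_family T (\<lambda>x t. F x t $ j)"
  shows "flux T F"
  unfolding flux_def
proof (intro ballI conjI allI)
  fix t assume t: "t \<in> {0<..<T}"
  show "periodic (\<lambda>x. F x t)" using F t by (auto simp: smooth_family_def periodic_def vec_eq_iff)
  show "(\<lambda>y. F y t) differentiable at x" for x by (rule smooth_family_vec_differentiable[OF F t])
  have "\<forall>j. \<exists>B. \<forall>x. \<bar>F x t $ j\<bar> \<le> B" using F t unfolding smooth_family_def by blast
  then obtain B where B: "\<And>j x. \<bar>F x t $ j\<bar> \<le> B j" by metis
  have "\<forall>j. \<exists>C\<ge>0. \<forall>x. \<bar>Dx F x t $ j $ j\<bar> \<le> C"
  proof
    fix j
    obtain C where C: "C \<ge> 0" "\<forall>t\<in>{0<..<T}. \<forall>x i. \<bar>nabla (\<lambda>y. F y t $ j) x $ i\<bar> \<le> C"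
      using smooth_family_nabla_bound[OF F[of j]] by blast
    have "\<bar>Dx F x t $ j $ j\<bar> \<le> C" for x
    proof -
      have "nabla (\<lambda>y. F y t $ j) x $ j = Dx F x t $ j $ j"
        using nabla_component(2)[OF smooth_family_vec_differentiable[OF F t], of j x j] by (simp add: Dx_def)
      moreover have "\<bar>nabla (\<lambda>y. F y t $ j) x $ j\<bar> \<le> C" using C(2) t by blast
      ultimately show ?thesis by simp
    qed
    then show "\<exists>C\<ge>0. \<forall>x. \<bar>Dx F x t $ j $ j\<bar> \<le> C" using C(1) by blast
  qed
  then obtain C where C: "\<And>j. C j \<ge> 0" "\<And>j x. \<bar>Dx F x t $ j $ j\<bar> \<le> C j" by metis
  have B0: "B j \<ge> 0" for j by (rule order_trans[OF abs_ge_zero B])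
  let ?B = "(\<Sum>j\<in>UNIV. B j)" and ?C = "\<Sum>j\<in>UNIV. C j"
  have s: "?B \<ge> 0" "?C \<ge> 0" using B0 C(1) by (auto intro!: sum_nonneg)
  show "\<exists>B. \<forall>x. norm (F x t) \<le> B \<and> (\<forall>j. \<bar>Dx F x t $ j $ j\<bar> \<le> B)"
  proof (intro exI[of _ "?B + ?C"] allI conjI)
    fix x j
    have "norm (F x t) \<le> (\<Sum>j\<in>UNIV. \<bar>F x t $ j\<bar>)" by (rule norm_le_l1_cart)
    also have "\<dots> \<le> ?B" by (intro sum_mono B)
    finally show "norm (F x t) \<le> ?B + ?C" using s by simp
    have "C j \<le> ?C" by (rule member_le_sum) (use C(1) in auto)
    then show "\<bar>Dx F x t $ j $ j\<bar> \<le> ?B + ?C" using C(2)[of x j] s by simp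
  qed
qed

lemma nabla_arith:
  fixes g h :: "real^'d \<Rightarrow> real"
  assumes g: "g differentiable (at x)" and h: "h differentiable (at x)"
  shows "nabla (\<lambda>y. g y + h y) x = nabla g x + nabla h x"
    and "nabla (\<lambda>y. g y - h y) x = nabla g x - nabla h x"
    and "nabla (\<lambda>y. g y * h y) x = g x *\<^sub>R nabla h x + h x *\<^sub>R nabla g x"
proof -
  have G: "(g has_derivative frechet_derivative g (at x)) (at x)" and H: "(h has_derivative frechet_derivative h (at x)) (at x)"
    using g h by (simp_all add: frechet_derivative_works)
  show "nabla (\<lambda>y. g y + h y) x = nabla g x + nabla h x"
    using frechet_derivative_at[OF has_derivative_add[OF G H]] by (simp add: nabla_def vec_eq_iff fun_eq_iff)
  show "nabla (\<lambda>y. g y - h y) x = nabla g x - nabla h x"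
    using frechet_derivative_at[OF has_derivative_diff[OF G H]] by (simp add: nabla_def vec_eq_iff fun_eq_iff)
  show "nabla (\<lambda>y. g y * h y) x = g x *\<^sub>R nabla h x + h x *\<^sub>R nabla g x"
    unfolding nabla_def frechet_derivative_at[OF has_derivative_mult[OF G H], symmetric] by (simp add: vec_eq_iff)
qed

lemma divergence_arith:
  fixes F G :: "real^'d \<Rightarrow> real \<Rightarrow> real^'d"
  assumes F: "\<And>j. smooth_family T (\<lambda>x t. F x t $ j)" and G: "\<And>j. smooth_family T (\<lambda>x t. G x t $ j)"
    and t: "t \<in> {0<..<T}"
  shows "divergence (\<lambda>x t. F x t + G x t) x t = divergence F x t + divergence G x t"
    and "divergence (\<lambda>x t. F x t - G x t) x t = divergence F x t - divergence G x t"
proof -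
  have a: "smooth_family T (\<lambda>x t. (F x t + G x t) $ j)" "smooth_family T (\<lambda>x t. (F x t - G x t) $ j)" for j
    using smooth_family_add[OF F G] smooth_family_diff[OF F G] by simp_all
  have d: "(\<lambda>y. F y t $ j) differentiable (at x)" "(\<lambda>y. G y t $ j) differentiable (at x)" for j
    using F G t by (auto simp: smooth_family_def)
  show "divergence (\<lambda>x t. F x t + G x t) x t = divergence F x t + divergence G x t"
    unfolding smooth_family_divergence[OF F t] smooth_family_divergence[OF G t] smooth_family_divergence[OF a(1) t]
    by (simp add: nabla_arith(1)[OF d] sum.distrib)
  show "divergence (\<lambda>x t. F x t - G x t) x t = divergence F x t - divergence G x t"
    unfolding smooth_family_divergence[OF F t] smooth_family_divergence[OF G t] smooth_family_divergence[OF a(2) t]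
    by (simp add: nabla_arith(2)[OF d] sum_subtractf)
qed

section \<open>A positive lower bound for the density\<close>

lemma second_derivative_at_min:
  fixes g g1 :: "real \<Rightarrow> real"
  assumes g: "\<And>s. (g has_real_derivative g1 s) (at s)" and g2: "(g1 has_real_derivative d) (at 0)"
    and min: "\<And>s. g 0 \<le> g s"
  shows "g1 0 = 0" "d \<ge> 0"
proof -
  show 0: "g1 0 = 0"
    by (rule DERIV_local_min[OF g zero_less_one]) (use min in auto)
  show "d \<ge> 0"
  proof (rule ccontr)
    assume "\<not> d \<ge> 0"
    then obtain e where e: "e > 0" "\<And>h. h > 0 \<Longrightarrow> h < e \<Longrightarrow> g1 (0 + h) < g1 0"
      using DERIV_neg_dec_right[OF g2] by auto
    obtain z where z: "0 < z" "z < e / 2" "g (e / 2) - g 0 = (e / 2 - 0) * g1 z"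
      using MVT2[of 0 "e / 2" g g1] g e(1) by auto
    have "g1 z < 0" using e(2)[of z] z 0 e(1) by simp
    then have "(e / 2 - 0) * g1 z < 0" using e(1) by (intro mult_pos_neg) auto
    then have "g (e / 2) - g 0 < 0" unfolding z(3) .
    then show False using min[of "e / 2"] by simp
  qed
qed

lemma periodic_cell_reduce:
  fixes g :: "real^'d \<Rightarrow> 'b"
  assumes "periodic g"
  obtains y where "y \<in> cell" "g y = g x"
proof -
  obtain k where k: "k \<in> int_lattice" "x + k \<in> cell" by (rule lattice_reduce)
  then show ?thesis using that[of "x + k"] assms by (simp add: periodic_def)
qed

text \<open>
  At a minimum, at a positive time, of \<open>exp (K t) m + \<epsilon> t\<close> the gradient vanishes, the Laplacian is nonnegative and the
  time derivative is nonpositive, which contradicts the differential inequality because of \<open>\<epsilon>\<close>.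
\<close>

lemma minimum_principle:
  fixes m :: "real^'d \<Rightarrow> real \<Rightarrow> real"
  assumes m: "regular T m" and K: "K \<ge> 0"
    and super: "\<And>x t. t \<in> {0<..<T} \<Longrightarrow> Dx m x t = 0 \<Longrightarrow> - K * m x t \<le> Dt m x t - laplacian m x t"
    and init: "\<And>x. \<theta> \<le> m x 0" and \<theta>: "\<theta> > 0" and t1: "t1 \<in> {0<..<T}"
  shows "\<theta> * exp (- K * T) \<le> m x t1"
proof -
  have T: "0 < T" using t1 by simp
  have main: "\<theta> \<le> exp (K * t1) * m x t1 + \<epsilon> * t1" if \<epsilon>: "\<epsilon> > 0" for \<epsilon>
  proof -
    define \<phi> where "\<phi> = (\<lambda>z. exp (K * snd z) * m (fst z) (snd z) + \<epsilon> * snd z)"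
    let ?K = "cbox (0::real^'d) (\<chi> i. 1) \<times> {0..t1}"
    have "continuous_on (UNIV \<times> {0..t1}) (\<lambda>z. m (fst z) (snd z))"
      by (rule continuous_on_subset[OF regular_continuous_on(1)[OF m]]) (use t1 in auto)
    then have "continuous_on (UNIV \<times> {0..t1}) \<phi>"
      unfolding \<phi>_def by (intro continuous_intros)
    then have "continuous_on ?K \<phi>" by (rule continuous_on_subset) auto
    moreover have "compact ?K" by (intro compact_Times) auto
    moreover have "(0, 0) \<in> ?K" using t1 by (auto simp: mem_box_cart)
    ultimately obtain z where z: "z \<in> ?K" "\<And>y. y \<in> ?K \<Longrightarrow> \<phi> z \<le> \<phi> y"
      using continuous_attains_inf[of ?K \<phi>] by blast
    obtain x0 t0 where zz: "z = (x0, t0)" by (cases z)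
    have t0: "0 \<le> t0" "t0 \<le> t1" using z(1) by (auto simp: zz)
    have glob: "\<phi> (x0, t0) \<le> \<phi> (y, t)" if t: "t \<in> {0..t1}" for y t
    proof -
      have "periodic (\<lambda>x. m x t)" using regular_periodic[OF m] t t1 by simp
      then obtain y' where y': "y' \<in> cell" "m y' t = m y t" by (rule periodic_cell_reduce)
      have "\<phi> (x0, t0) \<le> \<phi> (y', t)" using z(2)[of "(y', t)"] subsetD[OF cell_subset_cbox y'(1)] t by (simp add: zz)
      then show ?thesis by (simp add: \<phi>_def y'(2))
    qed
    show ?thesis
    proof (cases "t0 = 0")
      case True
      have "\<theta> \<le> m x0 0" by (rule init)
      also have "m x0 0 = \<phi> (x0, t0)" by (simp add: \<phi>_def True)
      also have "\<dots> \<le> \<phi> (x, t1)" by (rule glob) (use t1 in simp)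
      finally show ?thesis by (simp add: \<phi>_def)
    next
      case False
      then have tp: "0 < t0" using t0 by simp
      have t: "t0 \<in> {0<..<T}" using tp t0 t1 by simp
      have mmin: "m x0 t0 \<le> m y t0" for y
        using glob[of t0 y] t0 by (simp add: \<phi>_def)
      have sec: "Dx m x0 t0 $ j = 0 \<and> Dx (Dx m) x0 t0 $ j $ j \<ge> 0" for j
      proof -
        note S = second_derivative_at_min[of "\<lambda>s. m (x0 + s *\<^sub>R axis j 1) t0" "\<lambda>s. Dx m (x0 + s *\<^sub>R axis j 1) t0 $ j" "Dx (Dx m) x0 t0 $ j $ j"]
        show ?thesis
          using S[OF DERIV_along[OF regular_DERIV_x(1)[OF m t]] regular_DERIV_x(2)[OF m t]] mmin by simp
      qed
      have "Dx m x0 t0 = 0" using sec by (simp add: vec_eq_iff)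
      from super[OF t this] have 1: "- K * m x0 t0 \<le> Dt m x0 t0 - laplacian m x0 t0" .
      have 2: "0 \<le> laplacian m x0 t0"
        unfolding laplacian_def divergence_def trace_def by (intro sum_nonneg) (use sec in auto)
      let ?D = "exp (K * t0) * (K * m x0 t0 + Dt m x0 t0) + \<epsilon>"
      have D: "((\<lambda>t. \<phi> (x0, t)) has_real_derivative ?D) (at t0)"
        unfolding \<phi>_def by (auto intro!: derivative_eq_intros regular_DERIV_t[OF m t] simp: algebra_simps)
      have "0 \<le> K * m x0 t0 + Dt m x0 t0" using 1 2 by simp
      then have "?D > 0" using \<epsilon> by (intro add_nonneg_pos mult_nonneg_nonneg) auto
      \<comment> \<open>only earlier times are compared, because \<open>t0\<close> may equal \<open>t1\<close>\<close>
      from DERIV_pos_inc_left[OF D this] obtain e where e: "e > 0" "\<And>h. h > 0 \<Longrightarrow> h < e \<Longrightarrow> \<phi> (x0, t0 - h) < \<phi> (x0, t0)" by auto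
      define h where "h = min (e / 2) t0"
      have h: "h > 0" "h < e" "h \<le> t0" using e(1) tp by (auto simp: h_def)
      have "\<phi> (x0, t0) \<le> \<phi> (x0, t0 - h)" by (rule glob) (use h t0 in auto)
      with e(2)[OF h(1,2)] show ?thesis by simp
    qed
  qed
  have "\<theta> \<le> exp (K * t1) * m x t1"
  proof (rule field_le_epsilon)
    fix e :: real assume "e > 0"
    then have "\<theta> \<le> exp (K * t1) * m x t1 + e / t1 * t1" using main[of "e / t1"] t1 by simp
    then show "\<theta> \<le> exp (K * t1) * m x t1 + e" using t1 by simp
  qed
  then have 3: "\<theta> * exp (- K * t1) \<le> m x t1"
    by (simp add: exp_minus field_simps)
  have "K * t1 \<le> K * T" using K t1 by (intro mult_left_mono) auto
  then have "\<theta> * exp (- K * T) \<le> \<theta> * exp (- K * t1)" using \<theta> by simp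
  with 3 show ?thesis by linarith
qed

lemma nonlinearity_estimates:
  fixes f f' f'' :: "real \<Rightarrow> real"
  assumes f: "\<And>r. r \<ge> 0 \<Longrightarrow> (f has_real_derivative f' r) (at r within {0..})"
    and f': "\<And>r. r \<ge> 0 \<Longrightarrow> (f' has_real_derivative f'' r) (at r within {0..})"
    and b: "bounded (f' ` {0..})" "bounded (f'' ` {0..})"
  shows "\<exists>B\<ge>0. \<forall>r\<ge>0. \<forall>r'\<ge>0. \<bar>f' r\<bar> \<le> B \<and> \<bar>f' r - f' r'\<bar> \<le> B * \<bar>r - r'\<bar> \<and>
    \<bar>f r - f r' - f' r' * (r - r')\<bar> \<le> B * \<bar>r - r'\<bar>\<^sup>2"
proof -
  obtain B1 where B1: "\<And>r. r \<ge> 0 \<Longrightarrow> \<bar>f' r\<bar> \<le> B1" using b(1) by (auto simp: bounded_iff)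
  obtain B2 where B2: "\<And>r. r \<ge> 0 \<Longrightarrow> \<bar>f'' r\<bar> \<le> B2" using b(2) by (auto simp: bounded_iff)
  have B20: "B2 \<ge> 0" using order_trans[OF abs_ge_zero B2[of 0]] by simp
  have lip: "\<bar>f' r - f' r'\<bar> \<le> B2 * \<bar>r - r'\<bar>" if "r \<ge> 0" "r' \<ge> 0" for r r'
  proof -
    have "norm (f' r - f' r') \<le> B2 * norm (r - r')"
      by (rule field_differentiable_bound[of "{0..}" f' f'']) (use f' B2 that in auto)
    then show ?thesis by simp
  qed
  have tay: "\<bar>f r - f r' - f' r' * (r - r')\<bar> \<le> B2 * \<bar>r - r'\<bar>\<^sup>2" if r: "r \<ge> 0" "r' \<ge> 0" for r r'
  proof -
    let ?S = "closed_segment r' r"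
    have S: "?S \<subseteq> {0..}" by (rule closed_segment_subset) (use r in auto)
    have "norm ((\<lambda>s. f s - f' r' * s) r - (\<lambda>s. f s - f' r' * s) r') \<le> B2 * \<bar>r - r'\<bar> * norm (r - r')"
    proof (rule field_differentiable_bound[of ?S _ "\<lambda>s. f' s - f' r' * 1"])
      fix s assume s: "s \<in> ?S"
      then have s0: "s \<ge> 0" using S by auto
      show "((\<lambda>s. f s - f' r' * s) has_field_derivative f' s - f' r' * 1) (at s within ?S)"
        by (intro DERIV_diff DERIV_cmult DERIV_ident DERIV_subset[OF f[OF s0] S])
      have "\<bar>f' s - f' r'\<bar> \<le> B2 * \<bar>s - r'\<bar>" by (rule lip[OF s0 r(2)])
      also have "\<dots> \<le> B2 * \<bar>r - r'\<bar>"
        using segment_bound(1)[OF s] by (intro mult_left_mono B20) (simp add: abs_minus_commute)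
      finally show "norm (f' s - f' r' * 1) \<le> B2 * \<bar>r - r'\<bar>" by simp
    qed auto
    then show ?thesis by (simp add: power2_eq_square algebra_simps)
  qed
  show ?thesis
  proof (intro exI[of _ "max B1 B2"] conjI allI impI)
    show "max B1 B2 \<ge> 0" using B20 by simp
    fix r r' :: real assume r: "0 \<le> r" "0 \<le> r'"
    show "\<bar>f' r\<bar> \<le> max B1 B2" using B1[OF r(1)] by simp
    show "\<bar>f' r - f' r'\<bar> \<le> max B1 B2 * \<bar>r - r'\<bar>"
      by (rule order_trans[OF lip[OF r] mult_right_mono]) auto
    show "\<bar>f r - f r' - f' r' * (r - r')\<bar> \<le> max B1 B2 * \<bar>r - r'\<bar>\<^sup>2"
      by (rule order_trans[OF tay[OF r] mult_right_mono]) auto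
  qed
qed

lemma laplacian_diff:
  assumes "regular T v" "regular T w" "t \<in> {0<..<T}"
  shows "laplacian (\<lambda>x t. v x t - w x t) x t = laplacian v x t - laplacian w x t"
  using regular_diff(3)[OF assms] by (simp add: laplacian_def divergence_def trace_def sum_subtractf)

lemma smooth_family_H_derivatives:
  fixes u m :: "real^'d \<Rightarrow> real \<Rightarrow> real"
  assumes H4: "Ck_on 4 phase H" and Hper: "x_periodic H"
    and u: "regular T u" and m: "regular T m" and m0: "\<And>x t. t \<in> {0<..<T} \<Longrightarrow> 0 \<le> m x t"
  shows "smooth_family T (\<lambda>x t. d_p H (jet u m x t) $ j)"
    "smooth_family T (\<lambda>x t. d_p (d_p H) (jet u m x t) $ i $ j)"
    "smooth_family T (\<lambda>x t. d_m (d_p H) (jet u m x t) $ j)"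
proof -
  have r: "Ck_on (Suc 2) phase (pderiv_phase (e_p j) H)"
    "Ck_on (Suc 1) phase (pderiv_phase (e_p i) (pderiv_phase (e_p j) H))"
    "Ck_on (Suc 1) phase (pderiv_phase e_m (pderiv_phase (e_p j) H))"
    using H_regularity(3)[OF H4 Hper, of j] H_regularity(4)[OF H4 Hper, of j i] H_regularity(5)[OF H4 Hper, of j]
    by (simp_all only: Suc_numerals)
  have cong: "smooth_family T g" if "smooth_family T h" "\<And>x t. t \<in> {0<..<T} \<Longrightarrow> g x t = h x t" for g h :: "real^'d \<Rightarrow> real \<Rightarrow> real"
  proof -
    have "(\<lambda>y. g y t) = (\<lambda>y. h y t)" if "t \<in> {0<..<T}" for t using \<open>\<And>x t. t \<in> {0<..<T} \<Longrightarrow> g x t = h x t\<close> that by auto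
    with that show ?thesis by (simp add: smooth_family_def)
  qed
  have ph: "jet u m x t \<in> phase" if "t \<in> {0<..<T}" for x t
    using m0[OF that] by (simp add: jet_def phase_iff)
  note J = smooth_family_jet[OF u m m0]
  show "smooth_family T (\<lambda>x t. d_p H (jet u m x t) $ j)"
    using J[OF _ r(1) H_x_periodic(1)[OF H4 Hper]] by (simp add: d_p_H[OF H4 Hper])
  show "smooth_family T (\<lambda>x t. d_p (d_p H) (jet u m x t) $ i $ j)"
    by (rule cong[OF J[OF _ r(2) H_x_periodic(2)[OF H4 Hper]]]) (simp_all add: d_p_d_p_H[OF H4 Hper ph])
  show "smooth_family T (\<lambda>x t. d_m (d_p H) (jet u m x t) $ j)"
    by (rule cong[OF J[OF _ r(3) H_x_periodic(2)[OF H4 Hper]]]) (simp_all add: d_m_d_p_H[OF H4 Hper ph])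
qed

text \<open>
  Where the gradient of \<open>m\<close> vanishes, the divergence of \<open>m H_p\<close> is \<open>m\<close> times the divergence of \<open>H_p\<close> along
  the solution, and the latter is bounded.
\<close>

lemma density_bounded_below:
  fixes u m :: "real^'d \<Rightarrow> real \<Rightarrow> real"
  assumes H4: "Ck_on 4 phase H" and Hper: "x_periodic H"
    and u: "regular T u" and m: "regular T m" and m0: "\<And>x t. t \<in> {0<..<T} \<Longrightarrow> 0 \<le> m x t"
    and eq: "\<And>x t. t \<in> {0<..<T} \<Longrightarrow> Dt m x t - laplacian m x t - divergence (\<lambda>y s. m y s *\<^sub>R d_p H (jet u m y s)) x t = 0"
    and init: "\<And>x. \<theta> \<le> m x 0" and \<theta>: "\<theta> > 0"
  shows "\<exists>\<delta>>0. \<forall>x. \<forall>t\<in>{0<..<T}. \<delta> \<le> m x t"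
proof -
  let ?c = "\<lambda>j x t. d_p H (jet u m x t) $ j"
  have c: "smooth_family T (?c j)" for j by (rule smooth_family_H_derivatives(1)[OF H4 Hper u m m0])
  obtain B where B: "\<And>j. B j \<ge> 0" "\<And>j t x i. t \<in> {0<..<T} \<Longrightarrow> \<bar>nabla (\<lambda>y. ?c j y t) x $ i\<bar> \<le> B j"
    using smooth_family_nabla_bound[OF c] by metis
  define K where "K = (\<Sum>j\<in>UNIV. B j)"
  have K: "K \<ge> 0" unfolding K_def by (intro sum_nonneg B(1))
  have "\<theta> * exp (- K * T) \<le> m x t" if t: "t \<in> {0<..<T}" for x t
  proof (rule minimum_principle[OF m K _ init \<theta> t])
    fix x t assume t: "t \<in> {0<..<T}" and D0: "Dx m x t = 0"
    have fam: "smooth_family T (\<lambda>x t. (m x t *\<^sub>R d_p H (jet u m x t)) $ j)" for j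
      using smooth_family_mult[OF smooth_family_regular(1)[OF m] c[of j]] by simp
    have d: "(\<lambda>y. ?c j y t) differentiable (at x)" for j using c t by (auto simp: smooth_family_def)
    have n0: "nabla (\<lambda>y. m y t) x = 0" using D0 by (simp add: Dx_def)
    have "nabla (\<lambda>y. (m y t *\<^sub>R d_p H (jet u m y t)) $ j) x $ j = m x t * nabla (\<lambda>y. ?c j y t) x $ j" for j
      using nabla_arith(3)[OF regular_differentiable(1)[OF m t] d, of j] by (simp add: n0)
    then have "divergence (\<lambda>y s. m y s *\<^sub>R d_p H (jet u m y s)) x t = m x t * (\<Sum>j\<in>UNIV. nabla (\<lambda>y. ?c j y t) x $ j)"
      unfolding smooth_family_divergence[OF fam t] by (simp add: sum_distrib_left)
    moreover have "- K \<le> (\<Sum>j\<in>UNIV. nabla (\<lambda>y. ?c j y t) x $ j)"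
      unfolding K_def sum_negf[symmetric]
    proof (rule sum_mono)
      fix j
      show "- B j \<le> nabla (\<lambda>y. ?c j y t) x $ j" using B(2)[OF t, of j x j] by linarith
    qed
    ultimately show "- K * m x t \<le> Dt m x t - laplacian m x t"
      using eq[OF t, of x] mult_left_mono[of "- K" _ "m x t", OF _ m0[OF t, of x]] by (simp add: mult.commute[of _ "m x t"])
  qed
  then show ?thesis using \<theta> by (intro exI[of _ "\<theta> * exp (- K * T)"]) auto
qed

section \<open>One Newton step as a linear problem\<close>

text \<open>
  The flux in the equation for \<open>M - m\<close>: that of the Newton step minus that of the solution.
\<close>

definition newton_flux ::
  "((real ^ 'd) \<times> real \<times> (real ^ 'd) \<Rightarrow> real) \<Rightarrow>
   (real ^ 'd \<Rightarrow> real \<Rightarrow> real) \<Rightarrow> (real ^ 'd \<Rightarrow> real \<Rightarrow> real) \<Rightarrow>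
   (real ^ 'd \<Rightarrow> real \<Rightarrow> real) \<Rightarrow> (real ^ 'd \<Rightarrow> real \<Rightarrow> real) \<Rightarrow>
   (real ^ 'd \<Rightarrow> real \<Rightarrow> real) \<Rightarrow> (real ^ 'd \<Rightarrow> real \<Rightarrow> real) \<Rightarrow> real ^ 'd \<Rightarrow> real \<Rightarrow> real ^ 'd" where
  "newton_flux H u m u' m' U M x t =
     M x t *\<^sub>R d_p H (jet u' m' x t)
     + m' x t *\<^sub>R (d_p (d_p H) (jet u' m' x t) *v (Dx U x t - Dx u' x t))
     + (m' x t * (M x t - m' x t)) *\<^sub>R d_m (d_p H) (jet u' m' x t)
     - m x t *\<^sub>R d_p H (jet u m x t)"

lemma newton_flux_equation:
  fixes u m u' m' U M :: "real^'d \<Rightarrow> real \<Rightarrow> real"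
  assumes H4: "Ck_on 4 phase H" and Hper: "x_periodic H"
    and reg: "regular T u" "regular T m" "regular T u'" "regular T m'" "regular T U" "regular T M"
    and m0: "\<And>x t. t \<in> {0<..<T} \<Longrightarrow> 0 \<le> m x t" and m'0: "\<And>x t. t \<in> {0<..<T} \<Longrightarrow> 0 \<le> m' x t"
    and eqm: "\<And>x t. t \<in> {0<..<T} \<Longrightarrow> Dt m x t - laplacian m x t - divergence (\<lambda>y s. m y s *\<^sub>R d_p H (jet u m y s)) x t = 0"
    and step: "newton_step T H f f' m0' uT u' m' U M"
  shows "flux T (newton_flux H u m u' m' U M)"
    and "t \<in> {0<..<T} \<Longrightarrow> Dt (\<lambda>x t. M x t - m x t) x t - laplacian (\<lambda>x t. M x t - m x t) x t
      = divergence (newton_flux H u m u' m' U M) x t"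
proof -
  note S = smooth_family_H_derivatives[OF H4 Hper reg(1,2) m0]
  note S' = smooth_family_H_derivatives[OF H4 Hper reg(3,4) m'0]
  note R = smooth_family_regular(1)
  let ?F1 = "\<lambda>y s. M y s *\<^sub>R d_p H (jet u' m' y s)"
  let ?F2 = "\<lambda>y s. m' y s *\<^sub>R (d_p (d_p H) (jet u' m' y s) *v (Dx U y s - Dx u' y s))"
  let ?F3 = "\<lambda>y s. (m' y s * (M y s - m' y s)) *\<^sub>R d_m (d_p H) (jet u' m' y s)"
  let ?F4 = "\<lambda>y s. m y s *\<^sub>R d_p H (jet u m y s)"
  have 1: "smooth_family T (\<lambda>x t. ?F1 x t $ j)" for j
    using smooth_family_mult[OF R[OF reg(6)] S'(1)] by simp
  have 2: "smooth_family T (\<lambda>x t. ?F2 x t $ j)" for j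
  proof -
    have "smooth_family T (\<lambda>x t. \<Sum>k\<in>UNIV. d_p (d_p H) (jet u' m' x t) $ j $ k * (Dx U x t $ k - Dx u' x t $ k))"
      by (intro smooth_family_sum smooth_family_mult S'(2) smooth_family_diff smooth_family_regular(2) reg)
    from smooth_family_mult[OF R[OF reg(4)] this] show ?thesis by (simp add: matrix_vector_mult_def)
  qed
  have 3: "smooth_family T (\<lambda>x t. ?F3 x t $ j)" for j
    using smooth_family_mult[OF smooth_family_mult[OF R[OF reg(4)] smooth_family_diff[OF R[OF reg(6)] R[OF reg(4)]]] S'(3)] by simp
  have 4: "smooth_family T (\<lambda>x t. ?F4 x t $ j)" for j
    using smooth_family_mult[OF R[OF reg(2)] S(1)] by simp
  have 12: "smooth_family T (\<lambda>x t. (?F1 x t + ?F2 x t) $ j)" for j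
    unfolding vector_add_component by (rule smooth_family_add[OF 1 2])
  have 123: "smooth_family T (\<lambda>x t. (?F1 x t + ?F2 x t + ?F3 x t) $ j)" for j
    using smooth_family_add[OF 12 3] by (simp only: vector_add_component)
  have N: "newton_flux H u m u' m' U M = (\<lambda>x t. ?F1 x t + ?F2 x t + ?F3 x t - ?F4 x t)"
    by (intro ext) (simp add: newton_flux_def)
  have "smooth_family T (\<lambda>x t. (?F1 x t + ?F2 x t + ?F3 x t - ?F4 x t) $ j)" for j
    using smooth_family_diff[OF 123 4] by (simp only: vector_minus_component)
  then show "flux T (newton_flux H u m u' m' U M)" unfolding N by (rule flux_smooth_family)
  assume t: "t \<in> {0<..<T}"
  have d: "divergence (newton_flux H u m u' m' U M) x t = divergence ?F1 x t + divergence ?F2 x t + divergence ?F3 x t - divergence ?F4 x t"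
    unfolding N divergence_arith(2)[OF 123 4 t] divergence_arith(1)[OF 12 3 t] divergence_arith(1)[OF 1 2 t] ..
  have "Dt M x t - laplacian M x t - divergence ?F1 x t = divergence ?F2 x t + divergence ?F3 x t"
    using step t by (simp add: newton_step_def)
  then show "Dt (\<lambda>x t. M x t - m x t) x t - laplacian (\<lambda>x t. M x t - m x t) x t
      = divergence (newton_flux H u m u' m' U M) x t"
    using eqm[OF t, of x] unfolding d laplacian_diff[OF reg(6,2) t] regular_diff(4)[OF reg(6,2) t] by linarith
qed

text \<open>
  Here \<open>eU\<close> and \<open>eu\<close> stand for the backward heat operator applied to the new iterate and to the solution, primes
  mark the previous iterate, and \<open>\<rho>\<close>, \<open>q\<close> are the new errors of the density and of the gradient. All terms on
  the right except the last three are Taylor remainders or products of two errors.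
\<close>

lemma hjb_remainder:
  fixes Hp Hp' p p' q :: "'v::real_inner"
  assumes U: "eU + Hp' \<bullet> (q + p - p') + Hm' * (\<rho> + r - r') = - H' + f' + df' * (\<rho> + r - r')"
    and u: "eu + H = (f::real)"
  shows "eU - eu = (H - H' - (Hm' * (r - r') + Hp' \<bullet> (p - p'))) - (f - f' - df' * (r - r'))
     + (Hp - Hp') \<bullet> q + (Hm - Hm') * \<rho> - (df - df') * \<rho> - Hp \<bullet> q - Hm * \<rho> + df * \<rho>"
proof -
  have "Hp' \<bullet> (q + p - p') = Hp' \<bullet> q + Hp' \<bullet> (p - p')" by (simp add: inner_add_right inner_diff_right)
  with U have "eU = - H' + f' + df' * \<rho> + df' * (r - r') - Hp' \<bullet> q - Hp' \<bullet> (p - p') - Hm' * \<rho> - Hm' * (r - r')"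
    by (simp add: algebra_simps)
  moreover have "eu = f - H" using u by simp
  ultimately show ?thesis by (simp add: inner_diff_left algebra_simps)
qed

text \<open>
  The counterpart for the flux: the large bracket consists of products of two errors and of the remainder
  estimated in \<open>flux_taylor\<close>.
\<close>

lemma flux_remainder:
  fixes Hp Hp' h h' p p' q :: "real^'d" and N N' :: "real^'d^'d"
  shows "(\<rho> + r) *\<^sub>R Hp' + r' *\<^sub>R (N' *v (q + p - p')) + (r' * (\<rho> + r - r')) *\<^sub>R h' - r *\<^sub>R Hp
    = \<rho> *\<^sub>R Hp + r *\<^sub>R (N *v q) + (r * \<rho>) *\<^sub>R h
      + (\<rho> *\<^sub>R (Hp' - Hp) + r' *\<^sub>R (N' *v q - N *v q) + (r' - r) *\<^sub>R (N *v q) + (\<rho> * r') *\<^sub>R (h' - h) + (\<rho> * (r' - r)) *\<^sub>R h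
      - (r *\<^sub>R Hp - r' *\<^sub>R Hp' - ((r - r') *\<^sub>R Hp' + r' *\<^sub>R (N' *v (p - p')) + (r' * (r - r')) *\<^sub>R h')))"
proof -
  have "N' *v (q + p - p') = N' *v q + N' *v (p - p')"
    by (simp add: matrix_vector_right_distrib add_diff_eq[symmetric])
  then show ?thesis by (simp add: algebra_simps)
qed

text \<open>
  The constants \<open>L\<close>, \<open>c\<close>, \<open>K\<close> are uniform over all steps because the previous iterate, being within distance
  one of the solution, has its jets in a fixed slab. Data of size \<open>e'\<^sup>2 + e' e\<close> arise from the Taylor
  remainders at the previous iterate and from moving the coefficients from there to the solution.
\<close>

lemma newton_linear_problem:
  fixes u m :: "real^'d \<Rightarrow> real \<Rightarrow> real" and H :: "(real^'d) \<times> real \<times> (real^'d) \<Rightarrow> real"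
  assumes T: "T > 0" and H4: "Ck_on 4 phase H" and Hper: "x_periodic H"
    and pd: "\<And>x r p. r > 0 \<Longrightarrow> positive_definite (monotonicity_matrix H (x, r, p))"
    and f: "\<And>r. r \<ge> 0 \<Longrightarrow> (f has_real_derivative f' r) (at r within {0..})"
    and f': "\<And>r. r \<ge> 0 \<Longrightarrow> (f' has_real_derivative f'' r) (at r within {0..})"
    and fb: "bounded (f' ` {0..})" "bounded (f'' ` {0..})" and f'0: "\<And>r. r \<ge> 0 \<Longrightarrow> f' r \<ge> 0"
    and u: "regular T u" and m: "regular T m" and m0: "\<And>x t. t \<in> {0<..<T} \<Longrightarrow> 0 \<le> m x t"
    and equ: "\<And>x t. t \<in> {0<..<T} \<Longrightarrow> - Dt u x t - laplacian u x t + H (jet u m x t) = f (m x t)"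
    and eqm: "\<And>x t. t \<in> {0<..<T} \<Longrightarrow> Dt m x t - laplacian m x t - divergence (\<lambda>y s. m y s *\<^sub>R d_p H (jet u m y s)) x t = 0"
    and init: "\<And>x. m x 0 = m_ini x" "\<And>x. u x T = uT x" and \<theta>: "\<theta> > 0" "\<And>x. \<theta> \<le> m_ini x"
  shows "\<exists>L\<ge>0. \<exists>c>0. \<exists>K>0. \<forall>u' m' U M e' e D.
    regular T u' \<longrightarrow> regular T m' \<longrightarrow> regular T U \<longrightarrow> regular T M \<longrightarrow>
    (\<forall>x. \<forall>t\<in>{0<..<T}. 0 \<le> m' x t) \<longrightarrow>
    newton_step T H f f' m_ini uT u' m' U M \<longrightarrow>
    (\<forall>x. \<forall>t\<in>{0<..<T}. \<bar>m' x t - m x t\<bar> + norm (Dx u' x t - Dx u x t) \<le> e') \<longrightarrow> e' \<le> 1 \<longrightarrow>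
    (\<forall>x. \<forall>t\<in>{0<..<T}. \<bar>M x t - m x t\<bar> + norm (Dx U x t - Dx u x t) \<le> e) \<longrightarrow>
    K * (e'\<^sup>2 + e' * e) \<le> D \<longrightarrow>
    linear_problem T L c D (\<lambda>x t. U x t - u x t) (\<lambda>x t. M x t - m x t) (newton_flux H u m u' m' U M)"
proof -
  obtain \<delta> where \<delta>: "\<delta> > 0" "\<And>x t. t \<in> {0<..<T} \<Longrightarrow> \<delta> \<le> m x t"
    using density_bounded_below[OF H4 Hper u m m0 eqm, of \<theta>] init(1) \<theta> by auto
  obtain B1 where B1: "B1 \<ge> 0" "\<And>x t. t \<in> {0<..<T} \<Longrightarrow> norm (Dx u x t) \<le> B1"
    by (rule regular_bounded[OF u]) (rule that)
  obtain B2 where B2: "B2 \<ge> 0" "\<And>x t. t \<in> {0..T} \<Longrightarrow> 0 < T \<Longrightarrow> \<bar>m x t\<bar> \<le> B2"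
    by (rule regular_bounded[OF m]) (rule that)
  \<comment> \<open>the summand \<open>1\<close> leaves room for a previous iterate at distance at most one\<close>
  define A where "A = B1 + B2 + 1"
  have A: "A \<ge> 0" "B1 + 1 \<le> A" "B2 + 1 \<le> A" using B1(1) B2(1) by (auto simp: A_def)
  have sym: "d_p (d_p H) (x, r, p) $ i $ j = d_p (d_p H) (x, r, p) $ j $ i" if "r > 0" for x r p i j
  proof -
    have "transpose (monotonicity_matrix H (x, r, p)) $ Some j $ Some i = monotonicity_matrix H (x, r, p) $ Some j $ Some i"
      using pd[OF that] by (simp add: positive_definite_def)
    then show ?thesis using that by (simp add: transpose_def monotonicity_matrix_def Let_def)
  qed
  obtain B where B: "B \<ge> 0" "\<And>z. z \<in> slab A \<Longrightarrow> norm (d_p H z) \<le> B" "\<And>z. z \<in> slab A \<Longrightarrow> \<bar>d_m H z\<bar> \<le> B"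
     "\<And>z. z \<in> slab A \<Longrightarrow> norm (d_m (d_p H) z) \<le> B"
     "\<And>z q. z \<in> slab A \<Longrightarrow> norm (d_p (d_p H) z *v q) \<le> B * norm q"
     "\<And>z z'. z \<in> slab A \<Longrightarrow> z' \<in> slab A \<Longrightarrow> norm (d_p H z - d_p H z') \<le> B * norm (z - z')"
     "\<And>z z'. z \<in> slab A \<Longrightarrow> z' \<in> slab A \<Longrightarrow> \<bar>d_m H z - d_m H z'\<bar> \<le> B * norm (z - z')"
     "\<And>z z'. z \<in> slab A \<Longrightarrow> z' \<in> slab A \<Longrightarrow> norm (d_m (d_p H) z - d_m (d_p H) z') \<le> B * norm (z - z')"
     "\<And>z z' q. z \<in> slab A \<Longrightarrow> z' \<in> slab A \<Longrightarrow> norm (d_p (d_p H) z *v q - d_p (d_p H) z' *v q) \<le> B * norm (z - z') * norm q"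
    using hamiltonian_bounds[OF H4 Hper, of A] by blast
  obtain BT where BT: "BT \<ge> 0" "\<And>x r p r' p'. (x, r, p) \<in> slab A \<Longrightarrow> (x, r', p') \<in> slab A \<Longrightarrow>
     \<bar>H (x, r, p) - H (x, r', p') - (d_m H (x, r', p') * (r - r') + d_p H (x, r', p') \<bullet> (p - p'))\<bar>
       \<le> BT * (\<bar>r - r'\<bar> + norm (p - p'))\<^sup>2"
    using hamiltonian_taylor[OF H4 Hper, of A] by blast
  obtain BF where BF: "BF \<ge> 0" "\<And>x r p r' p'. (x, r, p) \<in> slab A \<Longrightarrow> (x, r', p') \<in> slab A \<Longrightarrow>
     norm (r *\<^sub>R d_p H (x, r, p) - r' *\<^sub>R d_p H (x, r', p') - ((r - r') *\<^sub>R d_p H (x, r', p')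
        + r' *\<^sub>R (d_p (d_p H) (x, r', p') *v (p - p')) + (r' * (r - r')) *\<^sub>R d_m (d_p H) (x, r', p')))
       \<le> BF * (\<bar>r - r'\<bar> + norm (p - p'))\<^sup>2"
    using flux_taylor[OF H4 Hper sym A(1)] by blast
  obtain c where c: "c > 0" "\<And>x r p s q. x \<in> cell \<Longrightarrow> \<delta> \<le> r \<Longrightarrow> r \<le> A \<Longrightarrow> norm p \<le> A \<Longrightarrow>
    c * (s\<^sup>2 + (norm q)\<^sup>2) \<le> - d_m H (x, r, p) * s\<^sup>2 + r * s * (d_m (d_p H) (x, r, p) \<bullet> q)
       + r * (q \<bullet> (d_p (d_p H) (x, r, p) *v q))"
    using matrix_coercive[OF H4 Hper pd \<delta>(1), of A] by blast
  obtain Bf where Bf: "Bf \<ge> 0" "\<And>r. r \<ge> 0 \<Longrightarrow> \<bar>f' r\<bar> \<le> Bf"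
     "\<And>r r'. r \<ge> 0 \<Longrightarrow> r' \<ge> 0 \<Longrightarrow> \<bar>f' r - f' r'\<bar> \<le> Bf * \<bar>r - r'\<bar>"
     "\<And>r r'. r \<ge> 0 \<Longrightarrow> r' \<ge> 0 \<Longrightarrow> \<bar>f r - f r' - f' r' * (r - r')\<bar> \<le> Bf * \<bar>r - r'\<bar>\<^sup>2"
    using nonlinearity_estimates[OF f f' fb] by metis
  define L where "L = 3 * B + Bf + 2 * (A * B)"
  define K where "K = BT + Bf + BF + (2 * B + Bf) + (B + 2 * (A * B + B)) + 1"
  have nn: "0 \<le> A * B" using A B by simp
  have L: "L \<ge> 0" and K: "K > 0" using nn B(1) Bf(1) BT(1) BF(1) by (auto simp: L_def K_def)
  have main: "linear_problem T L c D (\<lambda>x t. U x t - u x t) (\<lambda>x t. M x t - m x t) (newton_flux H u m u' m' U M)"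
    if reg: "regular T u'" "regular T m'" "regular T U" "regular T M"
      and m'0: "\<forall>x. \<forall>t\<in>{0<..<T}. 0 \<le> m' x t"
      and step: "newton_step T H f f' m_ini uT u' m' U M"
      and e': "\<forall>x. \<forall>t\<in>{0<..<T}. \<bar>m' x t - m x t\<bar> + norm (Dx u' x t - Dx u x t) \<le> e'" "e' \<le> 1"
      and e: "\<forall>x. \<forall>t\<in>{0<..<T}. \<bar>M x t - m x t\<bar> + norm (Dx U x t - Dx u x t) \<le> e"
      and D: "K * (e'\<^sup>2 + e' * e) \<le> D"
    for u' m' U M e' e D
  proof -
    have m'0': "0 \<le> m' x t" if "t \<in> {0<..<T}" for x t using m'0 that by blast
    let ?F = "newton_flux H u m u' m' U M" and ?v = "\<lambda>x t. U x t - u x t" and ?\<rho> = "\<lambda>x t. M x t - m x t"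
    have est: "norm (?F x t) \<le> L * (\<bar>?\<rho> x t\<bar> + norm (Dx ?v x t)) + D \<and>
        \<bar>- Dt ?v x t - laplacian ?v x t\<bar> \<le> L * (\<bar>?\<rho> x t\<bar> + norm (Dx ?v x t)) + D \<and>
        (x \<in> cell \<longrightarrow> c * ((?\<rho> x t)\<^sup>2 + (norm (Dx ?v x t))\<^sup>2) - D * (\<bar>?\<rho> x t\<bar> + norm (Dx ?v x t))
          \<le> Dx ?v x t \<bullet> ?F x t + ?\<rho> x t * (- Dt ?v x t - laplacian ?v x t))"
      if t: "t \<in> {0<..<T}" for x t
    proof -
      define r r' p p' \<rho> q where defs: "r = m x t" "r' = m' x t" "p = Dx u x t" "p' = Dx u' x t" "\<rho> = M x t - m x t" "q = Dx U x t - Dx u x t"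
      define w where "w = \<bar>\<rho>\<bar> + norm q"
      define \<epsilon> where "\<epsilon> = \<bar>r - r'\<bar> + norm (p - p')"
      let ?z = "(x, r, p)" and ?z' = "(x, r', p')"
      have jets: "jet u m x t = ?z" "jet u' m' x t = ?z'" by (simp_all add: jet_def defs)
      have MU: "M x t = \<rho> + r" "Dx U x t - Dx u' x t = q + p - p'" "M x t - m' x t = \<rho> + r - r'" by (simp_all add: defs)
      have vq: "Dx ?v x t = q" using regular_diff(2)[OF reg(3) u t] by (simp add: defs)
      have \<epsilon>: "0 \<le> \<epsilon>" "\<epsilon> \<le> e'"
      proof -
        have "\<bar>m' x t - m x t\<bar> + norm (Dx u' x t - Dx u x t) \<le> e'" using e'(1) t by blast
        then show "\<epsilon> \<le> e'" by (simp add: \<epsilon>_def defs abs_minus_commute norm_minus_commute)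
      qed (simp add: \<epsilon>_def)
      have w: "0 \<le> w" "w \<le> e" using e t by (auto simp: w_def defs)
      have w1: "\<bar>\<rho>\<bar> \<le> w" "norm q \<le> w" by (auto simp: w_def)
      have e0: "0 \<le> e'" using \<epsilon> by linarith
      have \<epsilon>2: "\<epsilon>\<^sup>2 \<le> e'\<^sup>2" and \<epsilon>w: "\<epsilon> * w \<le> e' * e"
        using \<epsilon> w e0 by (auto intro!: power_mono mult_mono)
      have r0: "0 \<le> r" "0 \<le> r'" "\<delta> \<le> r" using m0[OF t] m'0'[OF t] \<delta>(2)[OF t] by (auto simp: defs)
      have rA: "r + 1 \<le> A" "norm p + 1 \<le> A"
        using B2(2)[of t x] B1(2)[OF t, of x] A t by (auto simp: defs)
      have r'A: "r' \<le> A" "norm p' \<le> A"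
      proof -
        have "\<bar>r - r'\<bar> \<le> 1" "norm (p - p') \<le> 1" using \<epsilon>(2) e'(2) norm_ge_zero[of "p - p'"] abs_ge_zero[of "r - r'"] unfolding \<epsilon>_def by linarith+
        then show "r' \<le> A" "norm p' \<le> A"
          using rA norm_triangle_ineq2[of p' p] by (auto simp: norm_minus_commute)
      qed
      have z: "?z \<in> slab A" "?z' \<in> slab A" using r0 rA r'A by (auto simp: slab_def)
      have zz: "norm (?z - ?z') \<le> \<epsilon>" unfolding \<epsilon>_def by (rule norm_jet_diff_le)
      have zz': "B * norm (?z - ?z') \<le> B * \<epsilon>" by (rule mult_left_mono[OF zz B(1)])
      have l1: "norm (d_p H ?z - d_p H ?z') \<le> B * \<epsilon>" by (rule order_trans[OF B(6)[OF z] zz'])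
      have l2: "\<bar>d_m H ?z - d_m H ?z'\<bar> \<le> B * \<epsilon>" by (rule order_trans[OF B(7)[OF z] zz'])
      have l3: "norm (d_m (d_p H) ?z - d_m (d_p H) ?z') \<le> B * \<epsilon>" by (rule order_trans[OF B(8)[OF z] zz'])
      have l4: "norm (d_p (d_p H) ?z *v q - d_p (d_p H) ?z' *v q) \<le> B * \<epsilon> * norm q"
        by (rule order_trans[OF B(9)[OF z] mult_right_mono[OF zz']]) simp
      have l5: "\<bar>f' r - f' r'\<bar> \<le> Bf * \<epsilon>"
        by (rule order_trans[OF Bf(3)[OF r0(1,2)] mult_left_mono[OF _ Bf(1)]]) (simp add: \<epsilon>_def)
      let ?g = "- Dt ?v x t - laplacian ?v x t"
      define a where "a = (H ?z - H ?z' - (d_m H ?z' * (r - r') + d_p H ?z' \<bullet> (p - p'))) - (f r - f r' - f' r' * (r - r'))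
         + (d_p H ?z - d_p H ?z') \<bullet> q + (d_m H ?z - d_m H ?z') * \<rho> - (f' r - f' r') * \<rho>"
      have g: "?g = a - d_p H ?z \<bullet> q - d_m H ?z * \<rho> + f' r * \<rho>"
      proof -
        have "- Dt U x t - laplacian U x t + d_p H ?z' \<bullet> (q + p - p') + d_m H ?z' * (\<rho> + r - r') = - H ?z' + f r' + f' r' * (\<rho> + r - r')"
        proof -
          have "- Dt U x t - laplacian U x t + d_p H (jet u' m' x t) \<bullet> Dx (\<lambda>y s. U y s - u' y s) x t
              + d_m H (jet u' m' x t) * (M x t - m' x t)
              = - H (jet u' m' x t) + f (m' x t) + f' (m' x t) * (M x t - m' x t)"
            using step t unfolding newton_step_def by blast
          then show ?thesis unfolding jets regular_diff(2)[OF reg(3) reg(1) t] MU by (simp only: defs(2))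
        qed
        moreover have "- Dt u x t - laplacian u x t + H ?z = f r" using equ[OF t, of x] unfolding jets by (simp only: defs(1))
        ultimately have "(- Dt U x t - laplacian U x t) - (- Dt u x t - laplacian u x t) = a - d_p H ?z \<bullet> q - d_m H ?z * \<rho> + f' r * \<rho>"
          unfolding a_def by (rule hjb_remainder)
        then show ?thesis unfolding regular_diff(4)[OF reg(3) u t] laplacian_diff[OF reg(3) u t] by linarith
      qed
      have aD: "\<bar>a\<bar> \<le> D"
      proof -
        have "\<bar>H ?z - H ?z' - (d_m H ?z' * (r - r') + d_p H ?z' \<bullet> (p - p'))\<bar> \<le> BT * \<epsilon>\<^sup>2"
          unfolding \<epsilon>_def by (rule BT(2)[OF z])
        moreover have "\<bar>f r - f r' - f' r' * (r - r')\<bar> \<le> Bf * \<epsilon>\<^sup>2"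
          by (rule order_trans[OF Bf(4)[OF r0(1,2)] mult_left_mono[OF power_mono Bf(1)]]) (auto simp: \<epsilon>_def)
        moreover have "\<bar>(d_p H ?z - d_p H ?z') \<bullet> q\<bar> \<le> B * \<epsilon> * w"
          by (rule order_trans[OF Cauchy_Schwarz_ineq2 mult_mono[OF l1 w1(2)]]) (use B \<epsilon> in auto)
        moreover have "\<bar>(d_m H ?z - d_m H ?z') * \<rho>\<bar> \<le> B * \<epsilon> * w"
          unfolding abs_mult by (rule mult_mono[OF l2 w1(1)]) (use B \<epsilon> in auto)
        moreover have "\<bar>(f' r - f' r') * \<rho>\<bar> \<le> Bf * \<epsilon> * w"
          unfolding abs_mult by (rule mult_mono[OF l5 w1(1)]) (use Bf \<epsilon> in auto)
        ultimately have "\<bar>a\<bar> \<le> BT * \<epsilon>\<^sup>2 + Bf * \<epsilon>\<^sup>2 + B * \<epsilon> * w + B * \<epsilon> * w + Bf * \<epsilon> * w"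
          unfolding a_def by linarith
        also have "\<dots> = (BT + Bf) * \<epsilon>\<^sup>2 + (2 * B + Bf) * (\<epsilon> * w)" by (simp add: algebra_simps)
        also have "\<dots> \<le> K * e'\<^sup>2 + K * (e' * e)"
          using \<epsilon>2 \<epsilon>w \<epsilon> w nn B(1) Bf(1) BT(1) BF(1) K by (intro add_mono mult_mono) (auto simp: K_def)
        also have "\<dots> \<le> D" using D by (simp add: distrib_left)
        finally show ?thesis .
      qed
      define b where "b = \<rho> *\<^sub>R (d_p H ?z' - d_p H ?z) + r' *\<^sub>R (d_p (d_p H) ?z' *v q - d_p (d_p H) ?z *v q)
         + (r' - r) *\<^sub>R (d_p (d_p H) ?z *v q) + (\<rho> * r') *\<^sub>R (d_m (d_p H) ?z' - d_m (d_p H) ?z) + (\<rho> * (r' - r)) *\<^sub>R d_m (d_p H) ?z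
         - (r *\<^sub>R d_p H ?z - r' *\<^sub>R d_p H ?z' - ((r - r') *\<^sub>R d_p H ?z' + r' *\<^sub>R (d_p (d_p H) ?z' *v (p - p')) + (r' * (r - r')) *\<^sub>R d_m (d_p H) ?z'))"
      have F: "?F x t = \<rho> *\<^sub>R d_p H ?z + r *\<^sub>R (d_p (d_p H) ?z *v q) + (r * \<rho>) *\<^sub>R d_m (d_p H) ?z + b"
        unfolding newton_flux_def jets MU b_def defs(2)[symmetric] defs(1)[symmetric] by (rule flux_remainder)
      have bD: "norm b \<le> D"
      proof -
        have rr: "\<bar>r' - r\<bar> \<le> \<epsilon>" by (simp add: \<epsilon>_def abs_minus_commute)
        have t1: "norm (\<rho> *\<^sub>R (d_p H ?z' - d_p H ?z)) \<le> w * (B * \<epsilon>)"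
          unfolding norm_scaleR using l1 by (intro mult_mono w1 w) (auto simp: norm_minus_commute)
        have t2: "norm (r' *\<^sub>R (d_p (d_p H) ?z' *v q - d_p (d_p H) ?z *v q)) \<le> A * (B * \<epsilon> * w)"
          unfolding norm_scaleR
        proof (intro mult_mono)
          show "norm (d_p (d_p H) ?z' *v q - d_p (d_p H) ?z *v q) \<le> B * \<epsilon> * w"
            using l4 mult_left_mono[OF w1(2), of "B * \<epsilon>"] B(1) \<epsilon>(1) by (simp add: norm_minus_commute)
        qed (use r0 r'A A in auto)
        have t3: "norm ((r' - r) *\<^sub>R (d_p (d_p H) ?z *v q)) \<le> \<epsilon> * (B * w)"
          unfolding norm_scaleR using B(5)[OF z(1), of q] mult_left_mono[OF w1(2) B(1)] rr \<epsilon>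
          by (intro mult_mono) (auto simp del: norm_scaleR)
        have t4: "norm ((\<rho> * r') *\<^sub>R (d_m (d_p H) ?z' - d_m (d_p H) ?z)) \<le> w * A * (B * \<epsilon>)"
          unfolding norm_scaleR abs_mult using l3 r0 r'A A w w1 by (intro mult_mono) (auto simp: norm_minus_commute)
        have t5: "norm ((\<rho> * (r' - r)) *\<^sub>R d_m (d_p H) ?z) \<le> w * \<epsilon> * B"
          unfolding norm_scaleR abs_mult using B(4)[OF z(1)] rr w w1 \<epsilon> by (intro mult_mono) auto
        have t6: "norm (r *\<^sub>R d_p H ?z - r' *\<^sub>R d_p H ?z' - ((r - r') *\<^sub>R d_p H ?z' + r' *\<^sub>R (d_p (d_p H) ?z' *v (p - p')) + (r' * (r - r')) *\<^sub>R d_m (d_p H) ?z')) \<le> BF * \<epsilon>\<^sup>2"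
          unfolding \<epsilon>_def by (rule BF(2)[OF z])
        have tri: "norm (a1 + a2 + a3 + a4 + a5 - a6) \<le> norm a1 + norm a2 + norm a3 + norm a4 + norm a5 + norm a6"
          for a1 a2 a3 a4 a5 a6 :: "real^'d"
          by (intro order_trans[OF norm_triangle_ineq4] order_trans[OF norm_triangle_ineq] add_mono order_refl)
        have "norm b \<le> w * (B * \<epsilon>) + A * (B * \<epsilon> * w) + \<epsilon> * (B * w) + w * A * (B * \<epsilon>) + w * \<epsilon> * B + BF * \<epsilon>\<^sup>2"
          unfolding b_def by (rule order_trans[OF tri]) (intro add_mono t1 t2 t3 t4 t5 t6)
        also have "\<dots> = BF * \<epsilon>\<^sup>2 + (B + 2 * (A * B + B)) * (\<epsilon> * w)" by (simp add: algebra_simps)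
        also have "\<dots> \<le> K * e'\<^sup>2 + K * (e' * e)"
          using \<epsilon>2 \<epsilon>w \<epsilon> w nn B(1) Bf(1) BT(1) BF(1) K by (intro add_mono mult_mono) (auto simp: K_def)
        also have "\<dots> \<le> D" using D by (simp add: distrib_left)
        finally show ?thesis .
      qed
      have Bw: "norm q * B \<le> w * B" "\<bar>\<rho>\<bar> * B \<le> w * B" using w1 B(1) by (auto intro!: mult_right_mono)
      have 1: "norm (?F x t) \<le> L * w + D"
      proof -
        have "norm (\<rho> *\<^sub>R d_p H ?z) \<le> w * B" unfolding norm_scaleR by (intro mult_mono w1 B(2) z w) auto
        moreover have "norm (r *\<^sub>R (d_p (d_p H) ?z *v q)) \<le> A * (B * w)"
          unfolding norm_scaleR using B(5)[OF z(1), of q] mult_left_mono[OF w1(2) B(1)] r0 rA A(1) by (intro mult_mono) auto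
        moreover have "norm ((r * \<rho>) *\<^sub>R d_m (d_p H) ?z) \<le> A * w * B"
          unfolding norm_scaleR abs_mult using B(4)[OF z(1)] r0 rA w1 A(1) w by (intro mult_mono) auto
        ultimately have "norm (?F x t) \<le> w * B + A * (B * w) + A * w * B + D"
          unfolding F using bD by (intro norm_triangle_le add_mono)
        also have "\<dots> \<le> L * w + D" using w B(1) Bf(1) by (simp add: L_def algebra_simps)
        finally show ?thesis .
      qed
      have 2: "\<bar>?g\<bar> \<le> L * w + D"
      proof -
        have "\<bar>d_p H ?z \<bullet> q\<bar> \<le> B * w"
          by (rule order_trans[OF Cauchy_Schwarz_ineq2]) (intro mult_mono w1 B(1,2) z norm_ge_zero)
        moreover have "\<bar>d_m H ?z * \<rho>\<bar> \<le> B * w" unfolding abs_mult by (intro mult_mono w1 B(1,3) z) auto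
        moreover have "\<bar>f' r * \<rho>\<bar> \<le> Bf * w" unfolding abs_mult using Bf(1) Bf(2)[OF r0(1)] w1 by (intro mult_mono) auto
        ultimately have "\<bar>?g\<bar> \<le> D + B * w + B * w + Bf * w" unfolding g using aD by linarith
        also have "\<dots> \<le> L * w + D"
        proof -
          have "0 \<le> B * w" "0 \<le> A * B * w" using nn B(1) w by auto
          then show ?thesis by (simp add: L_def algebra_simps)
        qed
        finally show ?thesis .
      qed
      have 3: "c * (\<rho>\<^sup>2 + (norm q)\<^sup>2) - D * w \<le> q \<bullet> ?F x t + \<rho> * ?g" if x: "x \<in> cell"
      proof -
        have "q \<bullet> ?F x t + \<rho> * ?g = (- d_m H ?z * \<rho>\<^sup>2 + r * \<rho> * (d_m (d_p H) ?z \<bullet> q) + r * (q \<bullet> (d_p (d_p H) ?z *v q)))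
           + f' r * \<rho>\<^sup>2 + q \<bullet> b + \<rho> * a"
          unfolding F g by (simp add: inner_add_right inner_commute[of q] power2_eq_square algebra_simps)
        moreover have "c * (\<rho>\<^sup>2 + (norm q)\<^sup>2) \<le> - d_m H ?z * \<rho>\<^sup>2 + r * \<rho> * (d_m (d_p H) ?z \<bullet> q) + r * (q \<bullet> (d_p (d_p H) ?z *v q))"
          by (rule c(2)[OF x r0(3)]) (use rA in auto)
        moreover have "0 \<le> f' r * \<rho>\<^sup>2" using f'0[OF r0(1)] by simp
        moreover have "\<bar>q \<bullet> b\<bar> \<le> norm q * D" by (rule order_trans[OF Cauchy_Schwarz_ineq2]) (intro mult_left_mono bD norm_ge_zero)
        moreover have "\<bar>\<rho> * a\<bar> \<le> \<bar>\<rho>\<bar> * D" unfolding abs_mult by (intro mult_left_mono aD) auto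
        moreover have "D * w = \<bar>\<rho>\<bar> * D + norm q * D" by (simp add: w_def algebra_simps)
        ultimately show ?thesis by linarith
      qed
      show ?thesis unfolding vq using 1 2 3 by (simp only: w_def defs(5)) simp
    qed
    show ?thesis
      unfolding linear_problem_def
    proof (intro conjI allI ballI)
      show "regular T ?v" by (rule regular_diff(1)[OF reg(3) u])
      show "regular T ?\<rho>" by (rule regular_diff(1)[OF reg(4) m])
      show "flux T ?F" by (rule newton_flux_equation(1)[OF H4 Hper u m reg m0 m'0' eqm step])
      show "U x T - u x T = 0" "M x 0 - m x 0 = 0" for x
        using step init by (auto simp: newton_step_def)
      fix x t assume t: "t \<in> {0<..<T}"
      show "Dt ?\<rho> x t - laplacian ?\<rho> x t = divergence ?F x t" by (rule newton_flux_equation(2)[OF H4 Hper u m reg m0 m'0' eqm step t])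
      show "norm (?F x t) \<le> L * (\<bar>?\<rho> x t\<bar> + norm (Dx ?v x t)) + D"
        "\<bar>- Dt ?v x t - laplacian ?v x t\<bar> \<le> L * (\<bar>?\<rho> x t\<bar> + norm (Dx ?v x t)) + D"
        using est[OF t, of x] by blast+
      show "c * ((?\<rho> x t)\<^sup>2 + (norm (Dx ?v x t))\<^sup>2) - D * (\<bar>?\<rho> x t\<bar> + norm (Dx ?v x t))
          \<le> Dx ?v x t \<bullet> ?F x t + ?\<rho> x t * (- Dt ?v x t - laplacian ?v x t)" if "x \<in> cell"
        using est[OF t, of x] that by blast
    qed
  qed
  show ?thesis
    by (intro exI[of _ L] exI[of _ c] exI[of _ K] conjI L c(1) K allI impI) (rule main)
qed

section \<open>Quadratic convergence\<close>

lemma norm_le_C0_norm: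
  assumes "\<And>x t. t \<in> {0<..<T} \<Longrightarrow> norm (w x t) \<le> B" "t \<in> {0<..<T}"
  shows "norm (w x t) \<le> C0_norm T w"
  unfolding C0_norm_def
proof (rule cSUP_upper2[where x="(x, t)"])
  show "bdd_above ((\<lambda>(x, t). norm (w x t)) ` (UNIV \<times> {0<..<T}))"
    by (rule bdd_aboveI2[where M=B]) (use assms(1) in auto)
qed (use assms(2) in auto)

lemma C0_norm_le:
  assumes "\<And>x t. t \<in> {0<..<T} \<Longrightarrow> norm (w x t) \<le> B" "T > 0"
  shows "C0_norm T w \<le> B"
  unfolding C0_norm_def
proof (rule cSUP_least)
  show "UNIV \<times> {0<..<T} \<noteq> {}" using assms(2) by auto
qed (use assms(1) in auto)

lemma norm_le_C10_norm:
  assumes w: "regular T w" and t: "t \<in> {0<..<T}"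
  shows "\<bar>w x t\<bar> \<le> C0_norm T w" "norm (Dx w x t) \<le> C0_norm T (Dx w)"
proof -
  obtain B where B: "B \<ge> 0" "\<And>x t. t \<in> {0..T} \<Longrightarrow> 0 < T \<Longrightarrow> \<bar>w x t\<bar> \<le> B"
    "\<And>x t. t \<in> {0<..<T} \<Longrightarrow> norm (Dx w x t) \<le> B"
    by (rule regular_bounded[OF w]) (rule that)
  have "norm (w x t) \<le> C0_norm T w"
    by (rule norm_le_C0_norm[where B=B]) (use B(2) t in auto)
  then show "\<bar>w x t\<bar> \<le> C0_norm T w" by simp
  show "norm (Dx w x t) \<le> C0_norm T (Dx w)" by (rule norm_le_C0_norm[OF B(3) t])
qed

text \<open>
  Below \<open>1 / (4 C)\<close> the mixed term is at most a quarter of the new error, and each step halves the error, so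
  the smallness condition persists.
\<close>

lemma quadratic_recursion:
  fixes err :: "nat \<Rightarrow> real"
  assumes C: "C > 0" and nn: "\<And>n. err n \<ge> 0"
    and rec: "\<And>n. err n \<le> 1 \<Longrightarrow> err (Suc n) \<le> C * ((err n)\<^sup>2 + err n * err (Suc n))"
    and small: "err 0 \<le> min 1 (1 / (4 * C))"
  shows "err \<longlonglongrightarrow> 0" "n \<ge> 1 \<Longrightarrow> err n \<le> 2 * C * (err (n - 1))\<^sup>2"
proof -
  let ?\<eta> = "min 1 (1 / (4 * C))"
  have step: "err (Suc n) \<le> 2 * C * (err n)\<^sup>2 \<and> err (Suc n) \<le> err n / 2" if "err n \<le> ?\<eta>" for n
  proof -
    have e1: "err n \<le> 1" and e4: "C * err n \<le> 1 / 4" using that C by (auto simp: field_simps)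
    have "(C * err n) * err (Suc n) \<le> 1 / 4 * err (Suc n)" by (rule mult_right_mono[OF e4 nn])
    with rec[OF e1] have "err (Suc n) \<le> C * (err n)\<^sup>2 + err (Suc n) / 4" by (simp add: distrib_left mult.assoc)
    moreover have "0 \<le> C * (err n)\<^sup>2" using C by simp
    ultimately have 1: "err (Suc n) \<le> 2 * C * (err n)\<^sup>2" by linarith
    have "(C * err n) * err n \<le> 1 / 4 * err n" by (rule mult_right_mono[OF e4 nn])
    then have "2 * C * (err n)\<^sup>2 \<le> err n / 2" by (simp add: power2_eq_square)
    with 1 show ?thesis by linarith
  qed
  have small': "err n \<le> ?\<eta> \<and> err n \<le> (1 / 2) ^ n * err 0" for n
  proof (induction n)
    case (Suc n)
    then have "err (Suc n) \<le> err n / 2" using step by blast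
    moreover have "err n / 2 \<le> (1 / 2) ^ Suc n * err 0" using Suc by simp
    ultimately show ?case using Suc nn[of n] by linarith
  qed (use small in simp)
  show "err \<longlonglongrightarrow> 0"
  proof (rule tendsto_sandwich[of "\<lambda>_. 0"])
    show "\<forall>\<^sub>F n in sequentially. 0 \<le> err n" "\<forall>\<^sub>F n in sequentially. err n \<le> (1 / 2) ^ n * err 0"
      using nn small' by auto
    show "(\<lambda>n. (1 / 2) ^ n * err 0) \<longlonglongrightarrow> 0"
      by (intro tendsto_mult_left_zero LIMSEQ_power_zero) simp
  qed simp
  show "err n \<le> 2 * C * (err (n - 1))\<^sup>2" if "n \<ge> 1"
    using step[of "n - 1"] small'[of "n - 1"] that by simp
qed

theorem theorem3p2:
  fixes T \<alpha> \<theta> Cbar :: real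
    and m0 uT :: "real ^ 'd \<Rightarrow> real"
    and H :: "(real ^ 'd) \<times> real \<times> (real ^ 'd) \<Rightarrow> real"
    and f f' f'' :: "real \<Rightarrow> real"
    and u m :: "real ^ 'd \<Rightarrow> real \<Rightarrow> real"
  assumes T_pos: "T > 0"
    and alpha: "0 < \<alpha>" "\<alpha> < 1"
    and m0_reg: "holder_C2 \<alpha> m0"
    and m0_mass: "integral (cbox 0 1) m0 = 1"
    and theta_pos: "\<theta> > 0"
    and m0_lower: "\<And>x. m0 x \<ge> \<theta>"
    and uT_reg: "holder_C2 \<alpha> uT"
    and H_periodic: "\<And>r p. r \<ge> 0 \<Longrightarrow> periodic (\<lambda>x. H (x, r, p))"
    and H_C4: "Ck_on 4 phase H"
    and Cbar_pos: "Cbar > 0"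
    and H_px: "\<And>x r p. r \<ge> 0 \<Longrightarrow>
      norm (d_x (d_p H) (x, r, p)) \<le> Cbar * (norm p + 1)"
    and H_xx: "\<And>x r p. r \<ge> 0 \<Longrightarrow>
      norm (d_x (d_x H) (x, r, p)) + norm (d_m (d_x (d_x H)) (x, r, p)) \<le> Cbar * ((norm p)\<^sup>2 + 1)"
    and H_mp: "\<And>x r p. r \<ge> 0 \<Longrightarrow>
      norm (d_p (d_m H) (x, r, p)) \<le> Cbar * norm p"
    and H_mm: "\<And>x r p. r \<ge> 0 \<Longrightarrow>
      \<bar>d_m (d_m H) (x, r, p)\<bar> \<le> Cbar * (norm p)\<^sup>2"
    and H_pp: "\<And>x r p. r \<ge> 0 \<Longrightarrow>
      norm (d_p (d_p H) (x, r, p)) + norm (d_m (d_p (d_p H)) (x, r, p)) \<le> Cbar"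
    and H_ppp: "\<And>x r p. r \<ge> 0 \<Longrightarrow>
      norm (d_p (d_p (d_p H)) (x, r, p)) + norm (d_m (d_p (d_p (d_p H))) (x, r, p)) \<le> Cbar"
    and H_monotone: "\<And>x r p. r > 0 \<Longrightarrow> positive_definite (monotonicity_matrix H (x, r, p))"
    and f_deriv: "\<And>r. r \<ge> 0 \<Longrightarrow> (f has_real_derivative f' r) (at r within {0..})"
    and f'_deriv: "\<And>r. r \<ge> 0 \<Longrightarrow> (f' has_real_derivative f'' r) (at r within {0..})"
    and f_bounded: "bounded (f ` {0..})" "bounded (f' ` {0..})" "bounded (f'' ` {0..})"
    and f'_nonneg: "\<And>r. r \<ge> 0 \<Longrightarrow> f' r \<ge> 0"
    and solution: "classical_solution T H f m0 uT u m"
  shows "\<exists>\<eta>>0. \<exists>C>0. \<forall>U M. newton_sequence \<alpha> T H f f' m0 uT U M \<longrightarrow>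
    (let err = (\<lambda>n. C10_norm T (\<lambda>x t. U n x t - u x t) + C0_norm T (\<lambda>x t. M n x t - m x t))
     in err 0 \<le> \<eta> \<longrightarrow>
          err \<longlonglongrightarrow> 0 \<and> (\<forall>n\<ge>1. err n \<le> C * (err (n - 1))\<^sup>2))"
proof -
  have Hper: "x_periodic H"
    unfolding x_periodic_def
  proof (intro ballI)
    fix z k assume z: "z \<in> (phase :: ((real^'d) \<times> real \<times> (real^'d)) set)" and k: "k \<in> (int_lattice :: (real^'d) set)"
    obtain x r p where zz: "z = (x, r, p)" by (cases z)
    have "r \<ge> 0" using z by (simp add: phase_iff zz)
    from H_periodic[OF this, of p] k show "H (z + (k, 0, 0)) = H z" by (simp add: periodic_def zz)
  qed
  obtain \<beta> where \<beta>: "0 < \<beta>" "parabolic_C2 \<beta> T u" "parabolic_C2 \<beta> T m"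
    using solution by (auto simp: classical_solution_def)
  have u: "regular T u" and m: "regular T m" using parabolic_C2_regular[OF _ \<beta>(1)] \<beta>(2,3) by auto
  have m0: "0 \<le> m x t" and equ: "- Dt u x t - laplacian u x t + H (jet u m x t) = f (m x t)"
    and eqm: "Dt m x t - laplacian m x t - divergence (\<lambda>y s. m y s *\<^sub>R d_p H (jet u m y s)) x t = 0"
    if "t \<in> {0<..<T}" for x t
    using solution that by (auto simp: classical_solution_def)
  have init: "m x 0 = m0 x" "u x T = uT x" for x using solution by (auto simp: classical_solution_def)
  obtain L c K where LcK: "L \<ge> 0" "c > 0" "K > 0"
    and lin: "\<And>u' m' U M e' e D. regular T u' \<Longrightarrow> regular T m' \<Longrightarrow> regular T U \<Longrightarrow> regular T M \<Longrightarrow>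
      (\<forall>x. \<forall>t\<in>{0<..<T}. 0 \<le> m' x t) \<Longrightarrow> newton_step T H f f' m0 uT u' m' U M \<Longrightarrow>
      (\<forall>x. \<forall>t\<in>{0<..<T}. \<bar>m' x t - m x t\<bar> + norm (Dx u' x t - Dx u x t) \<le> e') \<Longrightarrow> e' \<le> 1 \<Longrightarrow>
      (\<forall>x. \<forall>t\<in>{0<..<T}. \<bar>M x t - m x t\<bar> + norm (Dx U x t - Dx u x t) \<le> e) \<Longrightarrow>
      K * (e'\<^sup>2 + e' * e) \<le> D \<Longrightarrow>
      linear_problem T L c D (\<lambda>x t. U x t - u x t) (\<lambda>x t. M x t - m x t) (newton_flux H u m u' m' U M)"
    using newton_linear_problem[OF T_pos H_C4 Hper H_monotone f_deriv f'_deriv f_bounded(2,3) f'_nonneg u m m0 equ eqm init theta_pos m0_lower]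
    by blast
  obtain C where C: "C > 0" and stab: "\<And>D v \<rho> F x t. D > 0 \<Longrightarrow> linear_problem T L c D v \<rho> F \<Longrightarrow> t \<in> {0<..<T} \<Longrightarrow>
      \<bar>v (x::real^'d) t\<bar> \<le> C * D \<and> norm (Dx v x t) \<le> C * D \<and> \<bar>\<rho> x t\<bar> \<le> C * D"
    using linear_problem_stability[OF T_pos LcK(1,2), where 'd='d] by blast
  define C' where "C' = 3 * C * K"
  have C': "C' > 0" using C LcK by (simp add: C'_def)
  show ?thesis
    unfolding Let_def
  proof (rule exI[of _ "min 1 (1 / (4 * C'))"], rule conjI[rotated], rule exI[of _ "2 * C'"], intro conjI allI impI)
    show "0 < min 1 (1 / (4 * C'))" "0 < 2 * C'" using C' by auto
    fix U M assume N: "newton_sequence \<alpha> T H f f' m0 uT U M"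
    have reg: "regular T (U n)" "regular T (M n)" and pos: "\<forall>x. \<forall>t\<in>{0<..<T}. 0 \<le> M n x t" for n
      using N parabolic_C2_regular[OF _ alpha(1)] by (auto simp: newton_sequence_def)
    have step: "newton_step T H f f' m0 uT (U n) (M n) (U (Suc n)) (M (Suc n))" for n
      using N unfolding newton_sequence_def by (metis One_nat_def Suc_eq_plus1 diff_Suc_1 le_add2)
    define err where "err = (\<lambda>n. C10_norm T (\<lambda>x t. U n x t - u x t) + C0_norm T (\<lambda>x t. M n x t - m x t))"
    have rv: "regular T (\<lambda>x t. U n x t - u x t)" and r\<rho>: "regular T (\<lambda>x t. M n x t - m x t)" for n
      by (rule regular_diff(1)[OF reg(1) u], rule regular_diff(1)[OF reg(2) m])
    have mid: "T / 2 \<in> {0<..<T}" using T_pos by simp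
    have nonneg: "0 \<le> C0_norm T (\<lambda>x t. U n x t - u x t)" "0 \<le> C0_norm T (Dx (\<lambda>x t. U n x t - u x t))" "0 \<le> C0_norm T (\<lambda>x t. M n x t - m x t)" for n
      using order_trans[OF abs_ge_zero norm_le_C10_norm(1)[OF rv mid, of n 0]] order_trans[OF norm_ge_zero norm_le_C10_norm(2)[OF rv mid, of n 0]]
        order_trans[OF abs_ge_zero norm_le_C10_norm(1)[OF r\<rho> mid, of n 0]] by auto
    have err_ge: "\<forall>x. \<forall>t\<in>{0<..<T}. \<bar>M n x t - m x t\<bar> + norm (Dx (U n) x t - Dx u x t) \<le> err n" for n
    proof (intro allI ballI)
      fix x t assume t: "t \<in> {0<..<T}"
      show "\<bar>M n x t - m x t\<bar> + norm (Dx (U n) x t - Dx u x t) \<le> err n"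
        using norm_le_C10_norm(1)[OF r\<rho> t, of n x] norm_le_C10_norm(2)[OF rv t, of n x] nonneg(1)[of n]
        unfolding regular_diff(2)[OF reg(1) u t] err_def C10_norm_def by linarith
    qed
    have rec: "err (Suc n) \<le> C' * ((err n)\<^sup>2 + err n * err (Suc n))" if small: "err n \<le> 1" for n
    proof (rule field_le_epsilon)
      fix e :: real assume e: "e > 0"
      \<comment> \<open>stability needs positive data, hence the extra \<open>e\<close>\<close>
      define D where "D = K * ((err n)\<^sup>2 + err n * err (Suc n)) + e / (3 * C)"
      have "0 \<le> err n" "0 \<le> err (Suc n)" using nonneg by (auto simp: err_def C10_norm_def)
      then have D: "D > 0" unfolding D_def using LcK e C by (intro add_nonneg_pos mult_nonneg_nonneg add_nonneg_nonneg) auto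
      have "linear_problem T L c D (\<lambda>x t. U (Suc n) x t - u x t) (\<lambda>x t. M (Suc n) x t - m x t) (newton_flux H u m (U n) (M n) (U (Suc n)) (M (Suc n)))"
        by (rule lin[OF reg reg pos step err_ge small err_ge]) (use e C in \<open>simp add: D_def\<close>)
      note S = stab[OF D this]
      have "C0_norm T (\<lambda>x t. U (Suc n) x t - u x t) \<le> C * D" "C0_norm T (Dx (\<lambda>x t. U (Suc n) x t - u x t)) \<le> C * D"
        "C0_norm T (\<lambda>x t. M (Suc n) x t - m x t) \<le> C * D"
        using S by (auto intro!: C0_norm_le T_pos)
      then have "err (Suc n) \<le> 3 * (C * D)" by (simp add: err_def C10_norm_def)
      also have "\<dots> = C' * ((err n)\<^sup>2 + err n * err (Suc n)) + e" using C by (simp add: C'_def D_def field_simps)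
      finally show "err (Suc n) \<le> C' * ((err n)\<^sup>2 + err n * err (Suc n)) + e" .
    qed
    have err0: "err n \<ge> 0" for n using nonneg by (auto simp: err_def C10_norm_def)
    assume small: "C10_norm T (\<lambda>x t. U 0 x t - u x t) + C0_norm T (\<lambda>x t. M 0 x t - m x t) \<le> min 1 (1 / (4 * C'))"
    then have small': "err 0 \<le> min 1 (1 / (4 * C'))" unfolding err_def .
    have Q: "err \<longlonglongrightarrow> 0" "\<And>n. 1 \<le> n \<Longrightarrow> err n \<le> 2 * C' * (err (n - 1))\<^sup>2"
      using quadratic_recursion[where err=err and C=C', OF C' err0 _ small'] rec by blast+
    show "(\<lambda>n. C10_norm T (\<lambda>x t. U n x t - u x t) + C0_norm T (\<lambda>x t. M n x t - m x t)) \<longlonglongrightarrow> 0"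
      using Q(1) unfolding err_def .
    show "C10_norm T (\<lambda>x t. U n x t - u x t) + C0_norm T (\<lambda>x t. M n x t - m x t) \<le> 2 * C' *
        (C10_norm T (\<lambda>x t. U (n - 1) x t - u x t) + C0_norm T (\<lambda>x t. M (n - 1) x t - m x t))\<^sup>2" if "1 \<le> n" for n
      using Q(2)[OF that] unfolding err_def .
  qed
qed

end
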